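(* Let $A$ be a subring of $\mathbb{C}$, $\mathcal{A}=1+zA[[z]]$, and $0<\lambda<+\infty$. Let $\mathcal{E}_\lambda\subset\mathcal{A}$ be the space of entire functions of order $<\lambda$ with constant coefficient $1$. The eñe product $\star$ is an internal operation in $\mathcal{E}_\lambda$, and $(\mathcal{E}_\lambda,\cdot,\star)$ is a subring of $(\mathcal{A},\cdot,\star)$. Moreover, the eñe product $\star:\mathcal{E}_\lambda\times\mathcal{E}_\lambda\to\mathcal{E}_\lambda$, $(f,g)\mapsto f\star g$, is continuous for the topology of uniform convergence on compact subsets of $\mathbb{C}$.
   Context: $(\mathcal{A},\cdot,\star)$ is a commutative ring whose addition is the multiplication of power series (zero element $1$), whose multiplication is the eñe product $\star$, and whose unity is $1-z$. Eñe product: for $n\ge1$, let $Q_n\in\mathbb{Z}[X_1,\dots,X_n,Y_1,\dots,Y_n]$ be the unique polynomial such that in $\mathbb{Z}[x_1,\dots,x_n,y_1,\dots,y_n]$ the $n$-th elementary symmetric polynomial of the $n^2$ products $x_iy_j$ equals $Q_n(e_1(x),\dots,e_n(x),e_1(y),\dots,e_n(y))$, where $e_k$ are the elementary symmetric polynomials. For $f=1+\sum_{n\ge1}a_nz^n$ and $g=1+\sum_{n\ge1}b_nz^n$ in $\mathcal{A}$, $f\star g=1+\sum_{n\ge1}c_nz^n$ with $c_n=(-1)^nQ_n(a_1,\dots,a_n,b_1,\dots,b_n)$.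
   Formalization: "Subring" is false as stated, since the additive inverse 1/(1-z) of the unity is not entire; what is proved instead is that E_λ contains 1 and 1-z, is closed under both operations, and contains the additive inverse 1/f of each of its elements f whenever 1/f is entire. *)

theory Defs
  imports
    "HOL-Analysis.Analysis"
    "HOL-Library.Poly_Mapping"
    "HOL-Algebra.Subrings"
    "HOL-Algebra.Algebraic_Closure_Type"
begin

section \<open>The universal polynomials of the ene product\<close>

text \<open>
  Multivariate integer polynomials in variables of type \<open>'v\<close> are finitely supported maps from
  monomials to coefficients; the product of \<^typ>\<open>('v \<Rightarrow>\<^sub>0 nat) \<Rightarrow>\<^sub>0 int\<close> is the
  polynomial product.
\<close>

type_synonym 'v int_mpoly = "('v \<Rightarrow>\<^sub>0 nat) \<Rightarrow>\<^sub>0 int"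

definition mp_var :: "'v \<Rightarrow> 'v int_mpoly" where
  "mp_var v = Poly_Mapping.single (Poly_Mapping.single v 1) 1"

definition mp_vars :: "'v int_mpoly \<Rightarrow> 'v set" where
  "mp_vars Q = (\<Union>m\<in>Poly_Mapping.keys Q. Poly_Mapping.keys m)"

definition mp_eval :: "('v \<Rightarrow> 'a::comm_ring_1) \<Rightarrow> 'v int_mpoly \<Rightarrow> 'a" where
  "mp_eval \<phi> Q = (\<Sum>m\<in>Poly_Mapping.keys Q. of_int (Poly_Mapping.lookup Q m) *
                    (\<Prod>v\<in>Poly_Mapping.keys m. \<phi> v ^ Poly_Mapping.lookup m v))"

definition elem_sym :: "nat \<Rightarrow> 'i set \<Rightarrow> ('i \<Rightarrow> 'a::comm_semiring_1) \<Rightarrow> 'a" where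
  "elem_sym k I t = (\<Sum>S | S \<subseteq> I \<and> card S = k. \<Prod>i\<in>S. t i)"

text \<open>
  In \<open>nat + nat\<close>, \<^term>\<open>Inl i\<close> indexes the first family of variables (the \<open>X\<^sub>i\<close>, respectively
  the \<open>x\<^sub>i\<close>) and \<^term>\<open>Inr j\<close> the second one (the \<open>Y\<^sub>j\<close>, respectively the \<open>y\<^sub>j\<close>).
\<close>

definition ene_poly :: "nat \<Rightarrow> (nat + nat) int_mpoly" where
  "ene_poly n = (THE Q.
     mp_vars Q \<subseteq> Inl ` {1..n} \<union> Inr ` {1..n} \<and>
     elem_sym n ({1..n} \<times> {1..n}) (\<lambda>(i, j). mp_var (Inl i) * mp_var (Inr j) :: (nat + nat) int_mpoly)
       = mp_eval (case_sum (\<lambda>k. elem_sym k {1..n} (\<lambda>i. mp_var (Inl i)))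
                           (\<lambda>k. elem_sym k {1..n} (\<lambda>j. mp_var (Inr j)))) Q)"

definition ene :: "complex fps \<Rightarrow> complex fps \<Rightarrow> complex fps" where
  "ene f g = Abs_fps (\<lambda>n. if n = 0 then 1
     else (-1) ^ n * mp_eval (case_sum (fps_nth f) (fps_nth g)) (ene_poly n))"

section \<open>The ene ring\<close>

definition one_series :: "complex set \<Rightarrow> complex fps set" where
  "one_series A = {f. fps_nth f 0 = 1 \<and> (\<forall>n\<ge>1. fps_nth f n \<in> A)}"

text \<open>The addition of this ring is the product of power series, so its zero element is \<open>1\<close>.\<close>

definition ene_ring :: "complex set \<Rightarrow> complex fps ring" where
  "ene_ring A = \<lparr>carrier = one_series A, monoid.mult = ene, one = 1 - fps_X,
                 ring.zero = 1, add = (\<lambda>f g. f * g)\<rparr>"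

text \<open>As \<^const>\<open>subring\<close>, but without closure under additive inverses.\<close>

definition subsemiring :: "'a set \<Rightarrow> ('a, 'b) ring_scheme \<Rightarrow> bool" where
  "subsemiring H R \<longleftrightarrow> submonoid H (add_monoid R) \<and> submonoid H R"

section \<open>Entire functions of order less than a given number\<close>

definition max_modulus :: "(complex \<Rightarrow> complex) \<Rightarrow> real \<Rightarrow> real" where
  "max_modulus F r = (SUP z\<in>sphere 0 r. norm (F z))"

text \<open>
  If \<open>F 0 = 1\<close> then \<open>max_modulus F r \<ge> 1\<close> by the maximum principle, with strict inequality for
  \<open>r > 0\<close> unless \<open>F\<close> is constant. The constant \<open>1\<close> gets order \<open>0\<close>, since \<open>ln 0 = 0\<close>.
\<close>

definition entire_order :: "(complex \<Rightarrow> complex) \<Rightarrow> ereal" where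
  "entire_order F = Limsup at_top (\<lambda>r::real. ereal (ln (ln (max_modulus F r)) / ln r))"

text \<open>
  Entire functions are identified with their Taylor series at \<open>0\<close>, that is, with the power series
  of infinite radius of convergence; \<^const>\<open>eval_fps\<close> recovers the function.
\<close>

definition entire_lt :: "complex set \<Rightarrow> real \<Rightarrow> complex fps set" where
  "entire_lt A \<rho> =
     {f \<in> one_series A. fps_conv_radius f = \<infinity> \<and> entire_order (eval_fps f) < ereal \<rho>}"

section \<open>Uniform convergence on compact sets\<close>

text \<open>
  Not to be confused with the topology that \<^typ>\<open>complex fps\<close> carries as a metric space in the
  library, which is the formal one.
\<close>

definition compact_conv_open :: "complex fps set \<Rightarrow> complex fps set \<Rightarrow> bool" where
  "compact_conv_open E U \<longleftrightarrow> U \<subseteq> E \<and>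
     (\<forall>f\<in>U. \<exists>K \<epsilon>. compact K \<and> \<epsilon> > 0 \<and>
        {g\<in>E. \<forall>z\<in>K. dist (eval_fps g z) (eval_fps f z) < \<epsilon>} \<subseteq> U)"

definition compact_conv_topology :: "complex fps set \<Rightarrow> complex fps topology" where
  "compact_conv_topology E = topology (compact_conv_open E)"

lemma istopology_compact_conv: "istopology (compact_conv_open E)"
  unfolding istopology_def
proof (intro conjI allI impI)
  fix S T assume S: "compact_conv_open E S" and T: "compact_conv_open E T"
  show "compact_conv_open E (S \<inter> T)"
    unfolding compact_conv_open_def
  proof (intro conjI ballI)
    show "S \<inter> T \<subseteq> E" using S by (auto simp: compact_conv_open_def)
    fix f assume f: "f \<in> S \<inter> T"
    obtain K e where K: "compact K" "e > 0"
      "{g\<in>E. \<forall>z\<in>K. dist (eval_fps g z) (eval_fps f z) < e} \<subseteq> S"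
      using S f unfolding compact_conv_open_def by blast
    obtain L d where L: "compact L" "d > 0"
      "{g\<in>E. \<forall>z\<in>L. dist (eval_fps g z) (eval_fps f z) < d} \<subseteq> T"
      using T f unfolding compact_conv_open_def by blast
    have "{g\<in>E. \<forall>z\<in>K \<union> L. dist (eval_fps g z) (eval_fps f z) < min e d} \<subseteq> S \<inter> T"
      using K(3) L(3) by auto
    moreover have "compact (K \<union> L)" "min e d > 0"
      using K L by auto
    ultimately show "\<exists>K e. compact K \<and> e > 0 \<and>
        {g\<in>E. \<forall>z\<in>K. dist (eval_fps g z) (eval_fps f z) < e} \<subseteq> S \<inter> T" by blast
  qed
next
  fix \<U> assume U: "\<forall>S\<in>\<U>. compact_conv_open E S"
  show "compact_conv_open E (\<Union>\<U>)"
    unfolding compact_conv_open_def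
  proof (intro conjI ballI)
    show "\<Union>\<U> \<subseteq> E" using U by (auto simp: compact_conv_open_def)
    fix f assume "f \<in> \<Union>\<U>"
    then obtain S where S: "S \<in> \<U>" "f \<in> S" by blast
    hence "\<exists>K e. compact K \<and> e > 0 \<and>
        {g\<in>E. \<forall>z\<in>K. dist (eval_fps g z) (eval_fps f z) < e} \<subseteq> S"
      using U unfolding compact_conv_open_def by simp
    then obtain K e where "compact K" "e > 0"
      and sub: "{g\<in>E. \<forall>z\<in>K. dist (eval_fps g z) (eval_fps f z) < e} \<subseteq> S"
      by (elim exE conjE)
    moreover have "{g\<in>E. \<forall>z\<in>K. dist (eval_fps g z) (eval_fps f z) < e} \<subseteq> \<Union>\<U>"
      using sub Union_upper[OF S(1)] by (rule subset_trans)
    ultimately show "\<exists>K e. compact K \<and> e > 0 \<and>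
        {g\<in>E. \<forall>z\<in>K. dist (eval_fps g z) (eval_fps f z) < e} \<subseteq> \<Union>\<U>"
      by (intro exI conjI)
  qed
qed

lemma openin_compact_conv: "openin (compact_conv_topology E) U \<longleftrightarrow> compact_conv_open E U"
  by (simp add: compact_conv_topology_def istopology_compact_conv)

lemma topspace_compact_conv [simp]: "topspace (compact_conv_topology E) = E"
proof -
  have "compact_conv_open E E"
    unfolding compact_conv_open_def using compact_empty zero_less_one by blast
  thus ?thesis
    unfolding topspace_def openin_compact_conv by (auto simp: compact_conv_open_def)
qed

section \<open>Additive inverses\<close>

text \<open>
  Additive inverses of the ene ring are reciprocals of power series, and the reciprocal of an entire
  function with a zero is not entire. Since the unity \<open>1 - z\<close> has a zero, the set
  \<^const>\<open>entire_lt\<close> is never closed under additive inverses, hence never a subring in the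
  sense of \<^const>\<open>subring\<close>.
\<close>

lemma a_inv_ene_ring:
  assumes "f \<in> one_series A" and "inverse f \<in> one_series A"
  shows "a_inv (ene_ring A) f = inverse f"
proof -
  have f0: "fps_nth f 0 \<noteq> 0"
    using assms by (simp add: one_series_def)
  have *: "f * inverse f = 1" "inverse f * f = 1"
    using inverse_mult_eq_1[OF f0] by (simp_all add: mult.commute)
  have "(THE y. y \<in> one_series A \<and> f * y = 1 \<and> y * f = 1) = inverse f"
  proof (rule the_equality)
    show "inverse f \<in> one_series A \<and> f * inverse f = 1 \<and> inverse f * f = 1"
      using assms * by simp
    fix y assume "y \<in> one_series A \<and> f * y = 1 \<and> y * f = 1"
    hence "inverse f * f * y = inverse f"
      by (simp add: mult.assoc)
    thus "y = inverse f"
      by (simp only: *(2) mult_1_left)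
  qed
  thus ?thesis
    by (simp add: a_inv_def m_inv_def ene_ring_def)
qed

lemma not_subring_entire_lt:
  assumes "1 \<in> A"
  shows "\<not> subring (entire_lt A \<rho>) (ene_ring A)"
proof
  assume sub: "subring (entire_lt A \<rho>) (ene_ring A)"
  define u where "u = (1 - fps_X :: complex fps)"
  have u: "u \<in> entire_lt A \<rho>"
    using submonoid.one_closed[OF subring.axioms(2)[OF sub]] by (simp add: ene_ring_def u_def)
  have inv: "inverse u = Abs_fps (\<lambda>_. 1)"
    
    unfolding u_def
    using fps_inverse_idempotent[of "Abs_fps (\<lambda>_. 1 :: complex)"] by (simp add: fps_inverse_gp')
  have "inverse u \<in> one_series A"
    using assms by (simp add: inv one_series_def)
  moreover have "u \<in> one_series A"
    using u by (simp add: entire_lt_def)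
  ultimately have "a_inv (ene_ring A) u = inverse u"
    by (intro a_inv_ene_ring)
  moreover have "a_inv (ene_ring A) u \<in> entire_lt A \<rho>"
    using subgroup.m_inv_closed[OF subring.axioms(1)[OF sub] u] by (simp add: a_inv_def)
  ultimately have "fps_conv_radius (inverse u) = \<infinity>"
    by (simp add: entire_lt_def)
  hence "summable (\<lambda>n. fps_nth (inverse u) n * 1 ^ n)"
    by (intro summable_fps) simp
  thus False
    by (simp add: inv summable_const_iff)
qed

end

theory Submission
  imports
    Defs
    "Jordan_Normal_Form.Determinant"
    "HOL-Complex_Analysis.Complex_Analysis"
    "HOL-Real_Asymp.Real_Asymp"
begin

text \<open>
  The \<open>n\<close>-th coefficient of \<open>f \<star> g\<close> only depends on the Taylor polynomials of degree \<open>n\<close>, say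
  \<open>\<Prod>i. 1 - x i * z\<close> and \<open>\<Prod>j. 1 - y j * z\<close>, and it is the \<open>n\<close>-th coefficient of
  \<open>P = (\<Prod>i. \<Prod>j. 1 - x i * y j * z)\<close>. So everything reduces to bounding \<open>P\<close> on \<open>\<bar>z\<bar> = r\<close> uniformly
  in \<open>n\<close>, in terms of the majorants \<open>\<Sum>k. \<bar>a k\<bar> * s ^ k\<close>. Put \<open>R\<^sup>2 = 8 * r\<close> and call \<open>x i\<close> large if
  \<open>\<bar>x i\<bar> \<ge> 1 / R\<close>. By the maximum principle there are few large \<open>x i\<close> and \<open>y j\<close>, and a factor of \<open>P\<close>
  with \<open>x i\<close> large is a value of the second Taylor polynomial at \<open>x i * z\<close>. The part of \<open>P\<close> with
  both roots small is the exponential of the Hadamard product of two logarithms, whose coefficients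
  are controlled by the Borel-Caratheodory inequality. Keeping track of the growth in \<open>r\<close> gives the
  order of \<open>f \<star> g\<close>; the local uniformity of the same bound, together with the continuity of each
  coefficient, gives the continuity of \<open>\<star>\<close>.
\<close>

section \<open>Evaluation of integer polynomials\<close>

text \<open>The tempting estimate reads the whole product as values of the second Taylor polynomial
  at the points \<open>x i * z\<close>. For small \<open>x i\<close> this bounds the logarithm of
  the factor only by a multiple of \<bar>x i * z\<bar>, and in general the sum of all \<bar>x
  i\<bar> has no bound independent of \<open>n\<close>. Pairs of small roots are therefore estimated
  together, which keeps the cancellation inside the power sums. The threshold is a compromise: the
  logarithmic series for these pairs needs \<open>R\<^sup>2\<close> large against \<open>r\<close>,
  while the number of large roots and both factors of the exponent for small pairs grow like R ^
  \<mu>; with \<open>R\<close> of size sqrt r the products of two such quantities are of size r ^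
  \<mu>. The sums over large roots force a slightly larger exponent, which the strict inequality in
  the order absorbs. Since \<open>ene_poly\<close> is a definite description, existence and
  uniqueness of the universal polynomials come before any analysis. Existence is read off a
  determinant whose entries are polynomials in the elementary symmetric ones.\<close>

definition mp_monom :: "('v \<Rightarrow> 'a::comm_ring_1) \<Rightarrow> ('v \<Rightarrow>\<^sub>0 nat) \<Rightarrow> 'a" where
  "mp_monom \<phi> m = (\<Prod>v\<in>Poly_Mapping.keys m. \<phi> v ^ Poly_Mapping.lookup m v)"

lemma mp_monom_superset:
  assumes "finite V" "Poly_Mapping.keys m \<subseteq> V"
  shows "mp_monom \<phi> m = (\<Prod>v\<in>V. \<phi> v ^ Poly_Mapping.lookup m v)"
  unfolding mp_monom_def
  by (rule prod.mono_neutral_left) (use assms in \<open>auto simp: in_keys_iff\<close>)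

lemma mp_monom_add: "mp_monom \<phi> (m + m') = mp_monom \<phi> m * mp_monom \<phi> m'"
proof -
  define V where "V = Poly_Mapping.keys m \<union> Poly_Mapping.keys m'"
  have V: "finite V" "Poly_Mapping.keys m \<subseteq> V" "Poly_Mapping.keys m' \<subseteq> V"
    "Poly_Mapping.keys (m + m') \<subseteq> V"
    using Poly_Mapping.keys_add[of m m'] by (auto simp: V_def)
  show ?thesis
    by (simp add: mp_monom_superset[OF V(1) V(2)] mp_monom_superset[OF V(1) V(3)]
        mp_monom_superset[OF V(1) V(4)] lookup_add power_add prod.distrib)
qed

lemma mp_eval_superset:
  assumes "finite K" "Poly_Mapping.keys Q \<subseteq> K"
  shows "mp_eval \<phi> Q = (\<Sum>m\<in>K. of_int (Poly_Mapping.lookup Q m) * mp_monom \<phi> m)"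
  unfolding mp_eval_def mp_monom_def
  by (rule sum.mono_neutral_left) (use assms in \<open>auto simp: in_keys_iff\<close>)

lemma mp_eval_add [simp]: "mp_eval \<phi> (P + Q) = mp_eval \<phi> P + mp_eval \<phi> Q"
proof -
  define K where "K = Poly_Mapping.keys P \<union> Poly_Mapping.keys Q"
  have K: "finite K" "Poly_Mapping.keys P \<subseteq> K" "Poly_Mapping.keys Q \<subseteq> K"
    "Poly_Mapping.keys (P + Q) \<subseteq> K"
    using Poly_Mapping.keys_add[of P Q] by (auto simp: K_def)
  show ?thesis
    by (simp add: mp_eval_superset[OF K(1) K(2)] mp_eval_superset[OF K(1) K(3)]
        mp_eval_superset[OF K(1) K(4)] lookup_add algebra_simps sum.distrib)
qed

lemma mp_eval_0 [simp]: "mp_eval \<phi> 0 = 0"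
  by (simp add: mp_eval_def)

lemma mp_eval_uminus [simp]: "mp_eval \<phi> (- P) = - mp_eval \<phi> P"
  using mp_eval_add[of \<phi> P "- P"] by (simp add: eq_neg_iff_add_eq_0 add.commute)

lemma mp_eval_diff [simp]: "mp_eval \<phi> (P - Q) = mp_eval \<phi> P - mp_eval \<phi> Q"
  using mp_eval_add[of \<phi> P "- Q"] by simp

lemma mp_eval_sum [simp]: "mp_eval \<phi> (sum f I) = (\<Sum>i\<in>I. mp_eval \<phi> (f i))"
  by (induction I rule: infinite_finite_induct) auto

lemma mp_eval_single: "mp_eval \<phi> (Poly_Mapping.single m c) = of_int c * mp_monom \<phi> m"
  by (subst mp_eval_superset[of "{m}"]) auto

lemma int_mpoly_as_sum:
  "P = (\<Sum>m\<in>Poly_Mapping.keys P. Poly_Mapping.single m (Poly_Mapping.lookup P m))"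
proof (rule poly_mapping_eqI)
  fix k
  show "Poly_Mapping.lookup P k =
    Poly_Mapping.lookup (\<Sum>m\<in>Poly_Mapping.keys P. Poly_Mapping.single m (Poly_Mapping.lookup P m)) k"
    by (auto simp: lookup_sum lookup_single when_def in_keys_iff)
qed

lemma mp_eval_mult [simp]: "mp_eval \<phi> (P * Q) = mp_eval \<phi> P * mp_eval \<phi> Q"
proof -
  have "mp_eval \<phi> (P * Q) =
      mp_eval \<phi> ((\<Sum>m\<in>Poly_Mapping.keys P. Poly_Mapping.single m (Poly_Mapping.lookup P m)) *
                 (\<Sum>m\<in>Poly_Mapping.keys Q. Poly_Mapping.single m (Poly_Mapping.lookup Q m)))"
    using int_mpoly_as_sum[of P] int_mpoly_as_sum[of Q] by simp
  also have "\<dots> = (\<Sum>m\<in>Poly_Mapping.keys P. of_int (Poly_Mapping.lookup P m) * mp_monom \<phi> m) *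
                  (\<Sum>m\<in>Poly_Mapping.keys Q. of_int (Poly_Mapping.lookup Q m) * mp_monom \<phi> m)"
    by (simp add: sum_product mult_single mp_eval_single mp_monom_add mult_ac)
  also have "\<dots> = mp_eval \<phi> P * mp_eval \<phi> Q"
    by (simp add: mp_eval_superset[OF _ order_refl])
  finally show ?thesis .
qed

lemma mp_eval_1 [simp]: "mp_eval \<phi> 1 = 1"
  using mp_eval_single[of \<phi> 0 1] by (simp add: mp_monom_def)

lemma mp_eval_prod [simp]: "mp_eval \<phi> (prod f I) = (\<Prod>i\<in>I. mp_eval \<phi> (f i))"
  by (induction I rule: infinite_finite_induct) auto

lemma mp_eval_power [simp]: "mp_eval \<phi> (P ^ n) = mp_eval \<phi> P ^ n"
  by (induction n) auto

lemma mp_eval_of_int [simp]: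
  fixes \<phi> :: "'v \<Rightarrow> 'a::comm_ring_1"
  shows "mp_eval \<phi> (of_int k) = of_int k"
proof -
  have "(of_int k :: 'v int_mpoly) = Poly_Mapping.single 0 k"
    by (metis of_int_eq_id id_apply single_of_int)
  thus ?thesis by (simp add: mp_eval_single mp_monom_def)
qed

lemma mp_eval_var [simp]: "mp_eval \<phi> (mp_var v) = \<phi> v"
  by (simp add: mp_var_def mp_eval_single mp_monom_def)

text \<open>Transports the formal identity that defines \<open>ene_poly\<close> to numbers: the
  inner substitution inserts elementary symmetric polynomials, the outer one inserts the
  roots.\<close>

lemma mp_eval_mp_eval: "mp_eval \<theta> (mp_eval \<phi> Q) = mp_eval (\<lambda>v. mp_eval \<theta> (\<phi> v)) Q"
  unfolding mp_eval_def[of \<phi>] mp_eval_def[of "\<lambda>v. mp_eval \<theta> (\<phi> v)"] by simp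

lemma mp_eval_cong:
  assumes "\<And>v. v \<in> mp_vars Q \<Longrightarrow> \<phi> v = \<psi> v"
  shows "mp_eval \<phi> Q = mp_eval \<psi> Q"
  unfolding mp_eval_def
proof (intro sum.cong refl arg_cong2[where f = "(*)"] prod.cong)
  fix m v assume "m \<in> Poly_Mapping.keys Q" "v \<in> Poly_Mapping.keys m"
  hence "v \<in> mp_vars Q" by (auto simp: mp_vars_def)
  from assms[OF this] show "\<phi> v ^ Poly_Mapping.lookup m v = \<psi> v ^ Poly_Mapping.lookup m v"
    by simp
qed

lemma mp_eval_elem_sym [simp]:
  "mp_eval \<phi> (elem_sym k I t) = elem_sym k I (\<lambda>i. mp_eval \<phi> (t i))"
  by (simp add: elem_sym_def)

section \<open>Variables occurring in a polynomial\<close>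

lemma mp_vars_add: "mp_vars (P + Q) \<subseteq> mp_vars P \<union> mp_vars Q"
  using Poly_Mapping.keys_add[of P Q] by (auto simp: mp_vars_def)

lemma mp_vars_uminus [simp]: "mp_vars (- P) = mp_vars P"
  by (simp add: mp_vars_def)

lemma mp_vars_diff: "mp_vars (P - Q) \<subseteq> mp_vars P \<union> mp_vars Q"
  using mp_vars_add[of P "- Q"] by simp

lemma mp_vars_mult: "mp_vars (P * Q) \<subseteq> mp_vars P \<union> mp_vars Q"
proof
  fix v assume "v \<in> mp_vars (P * Q)"
  then obtain m where m: "m \<in> Poly_Mapping.keys (P * Q)" "v \<in> Poly_Mapping.keys m"
    by (auto simp: mp_vars_def)
  from m(1) keys_mult[of P Q] obtain a b
    where "m = a + b" "a \<in> Poly_Mapping.keys P" "b \<in> Poly_Mapping.keys Q" by blast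
  with m(2) Poly_Mapping.keys_add[of a b] show "v \<in> mp_vars P \<union> mp_vars Q"
    by (auto simp: mp_vars_def)
qed

text \<open>Kronecker substitution turns a nonzero integer polynomial into a nonzero univariate one.\<close>

lemma separating_weights:
  fixes S :: "('v \<Rightarrow> nat) set"
  assumes "finite S" "finite V"
  shows "\<exists>w. \<forall>m\<in>S. \<forall>m'\<in>S. (\<Sum>v\<in>V. w v * m v) = (\<Sum>v\<in>V. w v * m' v) \<longrightarrow> (\<forall>v\<in>V. m v = m' v)"
  using assms(2)
proof (induction V rule: finite_induct)
  case empty
  show ?case by auto
next
  case (insert u V)
  then obtain w :: "'v \<Rightarrow> nat" where w: "\<And>m m'. m \<in> S \<Longrightarrow> m' \<in> S \<Longrightarrow>
      (\<Sum>v\<in>V. w v * m v) = (\<Sum>v\<in>V. w v * m' v) \<Longrightarrow> (\<forall>v\<in>V. m v = m' v)"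
    by blast
  define W where "W m = (\<Sum>v\<in>V. w v * m v)" for m
  \<comment> \<open>\<open>B\<close> exceeds every \<open>W m\<close> with \<open>m\<close> in
    \<open>S\<close>, so \<open>m u * B + W m\<close> is a positional notation: the remainder modulo
    \<open>B\<close> gives back \<open>W m\<close>, and then \<open>m u\<close> follows.\<close>
  define B where "B = Suc (Max (insert 0 (W ` S)))"
  have B: "W m < B" if "m \<in> S" for m
    using Max_ge[of "insert 0 (W ` S)" "W m"] that assms(1) by (auto simp: B_def less_Suc_eq_le)
  define w' where "w' = w(u := B)"
  have W': "(\<Sum>v\<in>insert u V. w' v * m v) = m u * B + W m" for m
  proof -
    have "(\<Sum>v\<in>V. w' v * m v) = W m"
      unfolding W_def by (rule sum.cong) (use insert.hyps in \<open>auto simp: w'_def\<close>)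
    thus ?thesis using insert.hyps by (simp add: w'_def)
  qed
  show ?case
  proof (intro exI[of _ w'] ballI impI)
    fix m m' v
    assume m: "m \<in> S" "m' \<in> S"
      and eq: "(\<Sum>v\<in>insert u V. w' v * m v) = (\<Sum>v\<in>insert u V. w' v * m' v)"
      and v: "v \<in> insert u V"
    from eq have eq': "m u * B + W m = m' u * B + W m'" by (simp only: W')
    have "W m = (m u * B + W m) mod B" using B[OF m(1)] by simp
    also have "\<dots> = W m'" using B[OF m(2)] by (simp add: eq')
    finally have WW: "W m = W m'" .
    have "m u = m' u" using eq' WW B[OF m(1)] by auto
    thus "m v = m' v" using w[OF m] WW v by (auto simp: W_def)
  qed
qed

text \<open>Complex values suffice because a univariate polynomial vanishing on all complex numbers
  is zero and the integers embed there. This is the tool for the uniqueness of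
  \<open>ene_poly\<close>.\<close>

lemma int_mpoly_zeroI:
  fixes Q :: "'v int_mpoly"
  assumes "\<And>\<phi> :: 'v \<Rightarrow> complex. mp_eval \<phi> Q = 0"
  shows "Q = 0"
proof (rule ccontr)
  assume "Q \<noteq> 0"
  define K where "K = Poly_Mapping.keys Q"
  have K: "finite K" "K \<noteq> {}" using \<open>Q \<noteq> 0\<close> by (auto simp: K_def)
  define V where "V = mp_vars Q"
  have V: "finite V" by (simp add: V_def mp_vars_def)
  have keysV: "Poly_Mapping.keys m \<subseteq> V" if "m \<in> K" for m
    using that by (auto simp: V_def mp_vars_def K_def)
  define W where "W w m = (\<Sum>v\<in>V. w v * Poly_Mapping.lookup m v)" for w and m :: "'v \<Rightarrow>\<^sub>0 nat"
  from separating_weights[OF finite_imageI[OF K(1), of Poly_Mapping.lookup] V]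
  obtain w where w: "\<forall>m\<in>Poly_Mapping.lookup ` K. \<forall>m'\<in>Poly_Mapping.lookup ` K.
      (\<Sum>v\<in>V. w v * m v) = (\<Sum>v\<in>V. w v * m' v) \<longrightarrow> (\<forall>v\<in>V. m v = m' v)"
    by (elim exE)
  have inj: "m = m'" if "m \<in> K" "m' \<in> K" "W w m = W w m'" for m m'
  proof (rule poly_mapping_eqI)
    fix v
    show "Poly_Mapping.lookup m v = Poly_Mapping.lookup m' v"
    proof (cases "v \<in> V")
      case True
      show ?thesis
        by (rule bspec[OF mp[OF bspec[OF bspec[OF w imageI] imageI]], OF that(1,2) _ True])
          (use that(3) in \<open>simp only: W_def\<close>)
    next
      case False
      hence "v \<notin> Poly_Mapping.keys m" "v \<notin> Poly_Mapping.keys m'"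
        using keysV that by blast+
      thus ?thesis by (simp add: in_keys_iff)
    qed
  qed
  define p :: "complex poly" where
    "p = (\<Sum>m\<in>K. Polynomial.monom (of_int (Poly_Mapping.lookup Q m)) (W w m))"
  have "poly p t = mp_eval (\<lambda>v. t ^ w v) Q" for t
  proof -
    have "mp_eval (\<lambda>v. t ^ w v) Q = (\<Sum>m\<in>K. of_int (Poly_Mapping.lookup Q m) * t ^ W w m)"
    proof (subst mp_eval_superset[of K], goal_cases)
      case 3
      show ?case
        by (intro sum.cong refl)
          (simp add: mp_monom_superset[OF V keysV] power_mult[symmetric] power_sum W_def)
    qed (use K in \<open>auto simp: K_def\<close>)
    thus ?thesis by (simp add: p_def poly_sum poly_monom)
  qed
  with assms have "p = 0" by (subst poly_all_0_iff_0[symmetric]) simp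
  obtain m where m: "m \<in> K" using K by blast
  have "Polynomial.coeff p (W w m) = (\<Sum>m'\<in>K. if m' = m then of_int (Poly_Mapping.lookup Q m) else 0)"
    unfolding p_def Polynomial.coeff_sum by (intro sum.cong refl) (use inj m in auto)
  also have "\<dots> = of_int (Poly_Mapping.lookup Q m)" using m K by simp
  finally have "Poly_Mapping.lookup Q m = 0" using \<open>p = 0\<close> by simp
  with m show False by (simp add: K_def in_keys_iff)
qed

lemma int_mpoly_eqI:
  fixes P Q :: "'v int_mpoly"
  assumes "\<And>\<phi> :: 'v \<Rightarrow> complex. mp_eval \<phi> P = mp_eval \<phi> Q"
  shows "P = Q"
  using int_mpoly_zeroI[of "P - Q"] assms by simp

section \<open>Norms of polynomials in a symmetric set of elements\<close>

text \<open>Subrings of a type class ring as bare sets. Three kinds occur: the given set of complex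
  numbers, the integer polynomials in the elementary symmetric ones, and the univariate polynomials
  with coefficients in such a set.\<close>

definition ring_closed :: "'a::comm_ring_1 set \<Rightarrow> bool" where
  "ring_closed S \<longleftrightarrow> 1 \<in> S \<and> (\<forall>a\<in>S. \<forall>b\<in>S. a - b \<in> S \<and> a * b \<in> S)"

lemma ring_closedD:
  assumes "ring_closed S"
  shows ring_closed_1: "1 \<in> S"
    and ring_closed_0: "0 \<in> S"
    and ring_closed_diff: "\<And>a b. a \<in> S \<Longrightarrow> b \<in> S \<Longrightarrow> a - b \<in> S"
    and ring_closed_mult: "\<And>a b. a \<in> S \<Longrightarrow> b \<in> S \<Longrightarrow> a * b \<in> S"
    and ring_closed_uminus: "\<And>a. a \<in> S \<Longrightarrow> - a \<in> S"
    and ring_closed_add: "\<And>a b. a \<in> S \<Longrightarrow> b \<in> S \<Longrightarrow> a + b \<in> S"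
proof -
  show one: "1 \<in> S" and diff: "\<And>a b. a \<in> S \<Longrightarrow> b \<in> S \<Longrightarrow> a - b \<in> S"
    and "\<And>a b. a \<in> S \<Longrightarrow> b \<in> S \<Longrightarrow> a * b \<in> S"
    using assms by (auto simp: ring_closed_def)
  show zero: "0 \<in> S" using diff[OF one one] by simp
  show um: "- a \<in> S" if "a \<in> S" for a using diff[OF zero that] by simp
  show "a + b \<in> S" if "a \<in> S" "b \<in> S" for a b using diff[OF that(1) um[OF that(2)]] by simp
qed

lemma ring_closed_sum:
  assumes "ring_closed S" "\<And>i. i \<in> I \<Longrightarrow> f i \<in> S"
  shows "sum f I \<in> S"
  using assms(2)
  by (induction I rule: infinite_finite_induct)
    (auto intro: ring_closed_0[OF assms(1)] ring_closed_add[OF assms(1)])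

lemma ring_closed_prod:
  assumes "ring_closed S" "\<And>i. i \<in> I \<Longrightarrow> f i \<in> S"
  shows "prod f I \<in> S"
  using assms(2)
  by (induction I rule: infinite_finite_induct)
    (auto intro: ring_closed_1[OF assms(1)] ring_closed_mult[OF assms(1)])

lemma ring_closed_power:
  assumes "ring_closed S" "a \<in> S"
  shows "a ^ n \<in> S"
  using ring_closed_prod[OF assms(1), of "{..<n}" "\<lambda>_. a"] assms(2) by simp

lemma ring_closed_of_nat:
  assumes "ring_closed S"
  shows "of_nat n \<in> S"
  using ring_closed_sum[OF assms, of "{..<n}" "\<lambda>_. 1"] ring_closed_1[OF assms] by simp

lemma ring_closed_of_int:
  assumes "ring_closed S"
  shows "of_int n \<in> S"
  by (cases n rule: int_cases2)
    (auto intro: ring_closed_of_nat ring_closed_uminus assms)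

lemma ring_closed_signof:
  assumes "ring_closed S"
  shows "signof p \<in> S"
  by (auto simp: sign_def intro: ring_closed_1 ring_closed_uminus assms)

lemma ring_closed_det:
  assumes "ring_closed S" "A \<in> carrier_mat n n" "\<And>i j. i < n \<Longrightarrow> j < n \<Longrightarrow> A $$ (i, j) \<in> S"
  shows "Determinant.det A \<in> S"
  unfolding det_def'[OF assms(2)]
proof (intro ring_closed_sum ring_closed_mult ring_closed_signof ring_closed_prod assms)
  fix p i assume "p \<in> {p. p permutes {0..<n}}" "i \<in> {0..<n}"
  thus "i < n" "p i < n" using permutes_in_image[of p "{0..<n}" i] by auto
qed

lemma ring_closed_coeffs:
  assumes "ring_closed S"
  shows "ring_closed {p. \<forall>i. Polynomial.coeff p i \<in> S}"
  unfolding ring_closed_def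
  by (auto simp: Polynomial.coeff_mult coeff_1
      intro!: ring_closed_0 ring_closed_1 ring_closed_diff ring_closed_sum ring_closed_mult assms)

text \<open>The value at the matrix \<open>A\<close> of the polynomial with coefficient list
  \<open>cs\<close>, constant term first; Horner's rule makes its properties inductions on
  \<open>cs\<close>.\<close>

primrec mat_horner :: "nat \<Rightarrow> 'a::comm_ring_1 mat \<Rightarrow> 'a list \<Rightarrow> 'a mat" where
  "mat_horner n A [] = 0\<^sub>m n n"
| "mat_horner n A (c # cs) = c \<cdot>\<^sub>m 1\<^sub>m n + A * mat_horner n A cs"

lemma mat_horner_carrier [simp]:
  "A \<in> carrier_mat n n \<Longrightarrow> mat_horner n A cs \<in> carrier_mat n n"
  by (induction cs) auto

lemma mat_horner_Cons_index:
  assumes "A \<in> carrier_mat n n" "i < n" "j < n"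
  shows "mat_horner n A (c # cs) $$ (i, j) =
    (if i = j then c else 0) + (\<Sum>k<n. A $$ (i, k) * mat_horner n A cs $$ (k, j))"
  using assms carrier_matD[OF mat_horner_carrier[OF assms(1), of cs]]
  by (simp add: scalar_prod_def lessThan_atLeast0)

text \<open>Similarity of \<open>A\<close> and \<open>L\<close> without an inverse of
  \<open>U\<close>, so that over any commutative ring only the determinant of \<open>U\<close> has
  to be cancelled.\<close>

lemma mat_horner_intertwine:
  assumes A: "A \<in> carrier_mat n n" and L: "L \<in> carrier_mat n n" and U: "U \<in> carrier_mat n n"
    and AU: "A * U = U * L"
  shows "mat_horner n A cs * U = U * mat_horner n L cs"
proof (induction cs)
  case Nil
  show ?case using U by simp
next
  case (Cons c cs)
  have HA: "mat_horner n A cs \<in> carrier_mat n n" and HL: "mat_horner n L cs \<in> carrier_mat n n"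
    using A L by auto
  have "A * mat_horner n A cs * U = A * (U * mat_horner n L cs)"
    using A U HA Cons.IH by (simp add: assoc_mult_mat[of _ n n _ n _ n])
  also have "\<dots> = U * L * mat_horner n L cs"
    using A U HL AU by (simp add: assoc_mult_mat[of _ n n _ n _ n, symmetric])
  also have "\<dots> = U * (L * mat_horner n L cs)"
    using U L HL by (simp add: assoc_mult_mat[of _ n n _ n _ n])
  finally have step: "A * mat_horner n A cs * U = U * (L * mat_horner n L cs)" .
  have "c \<cdot>\<^sub>m 1\<^sub>m n * U = U * (c \<cdot>\<^sub>m 1\<^sub>m n)"
    using U by (simp add: mult_smult_assoc_mat[of _ n n _ n] mult_smult_distrib[of _ n n _ n])
  thus ?case
    using U A L HA HL step
    by (simp add: add_mult_distrib_mat[of _ n n _ _ n] mult_add_distrib_mat[of _ n n _ n])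
qed

text \<open>The two claims share one induction: a diagonal entry of \<open>L\<close> times the
  previous value collapses to a single product because that value is already known to be lower
  triangular.\<close>

lemma mat_horner_lower_triangular:
  fixes L :: "'a::comm_ring_1 mat"
  assumes L: "L \<in> carrier_mat n n" and low: "\<And>i j. i < j \<Longrightarrow> j < n \<Longrightarrow> L $$ (i, j) = 0"
  shows "(\<forall>i j. i < j \<longrightarrow> j < n \<longrightarrow> mat_horner n L cs $$ (i, j) = 0) \<and>
         (\<forall>i<n. mat_horner n L cs $$ (i, i) = poly (Poly cs) (L $$ (i, i)))"
proof (induction cs)
  case Nil
  show ?case by auto
next
  case (Cons c cs)
  let ?M = "mat_horner n L cs"
  have off: "(\<Sum>k<n. L $$ (i, k) * ?M $$ (k, j)) = 0" if "i < j" "j < n" for i j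
  proof -
    have "L $$ (i, k) * ?M $$ (k, j) = 0" if "k < n" for k
      using low[of i k] Cons.IH that \<open>i < j\<close> \<open>j < n\<close> by (cases "i < k") auto
    thus ?thesis by simp
  qed
  have diag: "(\<Sum>k<n. L $$ (i, k) * ?M $$ (k, i)) = L $$ (i, i) * ?M $$ (i, i)" if "i < n" for i
  proof -
    have "(\<Sum>k<n. L $$ (i, k) * ?M $$ (k, i)) = (\<Sum>k<n. if k = i then L $$ (i, i) * ?M $$ (i, i) else 0)"
    proof (intro sum.cong refl)
      fix k assume "k \<in> {..<n}"
      thus "L $$ (i, k) * ?M $$ (k, i) = (if k = i then L $$ (i, i) * ?M $$ (i, i) else 0)"
        using low[of i k] Cons.IH that by (cases i k rule: linorder_cases) auto
    qed
    also have "\<dots> = L $$ (i, i) * ?M $$ (i, i)" using that by simp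
    finally show ?thesis .
  qed
  show ?case
    using off diag Cons.IH by (auto simp del: mat_horner.simps(2) simp: mat_horner_Cons_index[OF L])
qed

text \<open>
  Multiplication by \<open>t\<close> on polynomials modulo \<open>F = (\<Prod>j<n. t - y j)\<close> has the companion matrix of
  \<open>F\<close> in the monomial basis, and a lower triangular matrix with diagonal \<open>y\<close> in the Newton basis
  \<open>\<Prod>j<k. t - y j\<close>. The change of basis is unitriangular, so it is harmless over any ring.
\<close>

lemma prod_poly_in_ring_closed:
  fixes y :: "nat \<Rightarrow> 'a::comm_ring_1"
  assumes S: "ring_closed S"
    and F: "\<And>i. Polynomial.coeff (\<Prod>j<n. [:- y j, 1:]) i \<in> S"
    and cs: "set cs \<subseteq> S"
  shows "(\<Prod>j<n. poly (Poly cs) (y j)) \<in> S"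
proof -
  define N where "N k = (\<Prod>j<k. [:- y j, 1:])" for k
  have N_Suc: "N (Suc k) = pCons 0 (N k) - Polynomial.smult (y k) (N k)" for k
    by (simp add: N_def algebra_simps)
  have cN: "Polynomial.coeff (N (Suc k)) i =
      (if i = 0 then 0 else Polynomial.coeff (N k) (i - 1)) - y k * Polynomial.coeff (N k) i" for k i
    unfolding N_Suc by (simp add: coeff_pCons split: nat.splits)
  have N_lt: "Polynomial.coeff (N k) i = (if i = k then 1 else 0)" if "i \<ge> k" for k i
    using that
  proof (induction k arbitrary: i)
    case 0
    show ?case by (simp add: N_def)
  next
    case (Suc k)
    show ?case using Suc.IH[of "i - 1"] Suc.IH[of i] Suc.prems by (auto simp: cN)
  qed
  define A where "A = mat n n (\<lambda>(i, j). if j + 1 = n then - Polynomial.coeff (N n) i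
                                        else if i = j + 1 then 1 else 0)"
  define U where "U = mat n n (\<lambda>(i, j). Polynomial.coeff (N j) i)"
  define L where "L = mat n n (\<lambda>(i, j). if i = j then y j else if i = j + 1 then 1 else 0)"
  have car: "A \<in> carrier_mat n n" "U \<in> carrier_mat n n" "L \<in> carrier_mat n n"
    by (auto simp: A_def U_def L_def)
  have "A * U = U * L"
  proof (rule eq_matI)
    fix i k assume "i < dim_row (U * L)" "k < dim_col (U * L)"
    hence ik: "i < n" "k < n" using car by auto
    have "(A * U) $$ (i, k) = (\<Sum>l<n. A $$ (i, l) * U $$ (l, k))"
      using car ik by (simp add: scalar_prod_def lessThan_atLeast0)
    \<comment> \<open>Row \<open>i\<close> of \<open>A\<close> has at most two nonzero entries, in
      the last column and in column \<open>i - 1\<close>; for \<open>i = 0\<close> the second one is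
      absent although \<open>i - 1 = 0\<close>.\<close>
    also have "\<dots> = (\<Sum>l<n. (if l = n - 1 then - Polynomial.coeff (N n) i * Polynomial.coeff (N k) (n - 1) else 0)
                      + (if l = i - 1 then if i = 0 then 0 else Polynomial.coeff (N k) (i - 1) else 0))"
      using ik by (intro sum.cong refl) (auto simp: A_def U_def)
    also have "\<dots> = (if i = 0 then 0 else Polynomial.coeff (N k) (i - 1))
                    - Polynomial.coeff (N n) i * Polynomial.coeff (N k) (n - 1)"
      using ik by (simp add: sum.distrib)
    \<comment> \<open>Column \<open>k\<close> of \<open>A * U\<close> holds t * N k reduced modulo
      \<open>N n\<close>. Since t * N k = y k * N k + N (k + 1), the reduction removes exactly the
      term \<open>N n\<close> that occurs for k + 1 = n.\<close>
    also have "\<dots> = y k * Polynomial.coeff (N k) i + (if k + 1 < n then Polynomial.coeff (N (k + 1)) i else 0)"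
    proof (cases "k + 1 < n")
      case True
      thus ?thesis using N_lt[of k "n - 1"] by (simp add: cN)
    next
      case False
      hence "n = Suc k" using ik by simp
      thus ?thesis using N_lt[of k k] by (simp add: cN)
    qed
    also have "\<dots> = (\<Sum>l<n. (if l = k then y k * Polynomial.coeff (N k) i else 0)
                      + (if l = k + 1 then Polynomial.coeff (N (k + 1)) i else 0))"
      using ik by (simp add: sum.distrib)
    also have "\<dots> = (\<Sum>l<n. U $$ (i, l) * L $$ (l, k))"
      using ik by (intro sum.cong refl) (auto simp: U_def L_def)
    also have "\<dots> = (U * L) $$ (i, k)"
      using car ik by (simp add: scalar_prod_def lessThan_atLeast0)
    finally show "(A * U) $$ (i, k) = (U * L) $$ (i, k)" .
  qed (use car in auto)
  from mat_horner_intertwine[OF car(1,3,2) this, of cs]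
  have "Determinant.det (mat_horner n A cs) * Determinant.det U =
        Determinant.det U * Determinant.det (mat_horner n L cs)"
    using car det_mult[of "mat_horner n A cs" n U] det_mult[of U n "mat_horner n L cs"] by simp
  moreover have "Determinant.det U = 1"
  proof -
    have "upper_triangular U" using N_lt by (auto simp: U_def upper_triangular_def)
    from det_upper_triangular[OF this car(2)] show ?thesis
      using N_lt by (simp add: prod_list_diag_prod U_def)
  qed
  moreover have "Determinant.det (mat_horner n L cs) = (\<Prod>j<n. poly (Poly cs) (y j))"
  proof -
    have "L $$ (i, j) = 0" if "i < j" "j < n" for i j using that by (simp add: L_def)
    from mat_horner_lower_triangular[OF car(3) this, of cs]
    have low: "\<And>i j. i < j \<Longrightarrow> j < n \<Longrightarrow> mat_horner n L cs $$ (i, j) = 0"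
      and diag: "\<And>i. i < n \<Longrightarrow> mat_horner n L cs $$ (i, i) = poly (Poly cs) (y i)"
      by (auto simp: L_def)
    show ?thesis
      using det_lower_triangular[of n "mat_horner n L cs"] low diag car
        carrier_matD[OF mat_horner_carrier[OF car(3), of cs]]
      by (simp add: prod_list_diag_prod lessThan_atLeast0)
  qed
  \<comment> \<open>Only \<open>cs\<close> and the coefficients of the product \<open>N n\<close>
    enter this side; the triangular side shows the individual \<open>y j\<close>.\<close>
  moreover have "Determinant.det (mat_horner n A cs) \<in> S"
  proof (rule ring_closed_det[OF S])
    have AS: "A $$ (i, j) \<in> S" if "i < n" "j < n" for i j
      using that F[of i] by (auto simp: A_def N_def intro: ring_closed_0 ring_closed_1 ring_closed_uminus S)
    show "mat_horner n A cs $$ (i, j) \<in> S" if "i < n" "j < n" for i j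
      using cs that
    proof (induction cs arbitrary: i j)
      case Nil
      thus ?case by (simp add: ring_closed_0[OF S])
    next
      case (Cons c cs)
      have "mat_horner n A (c # cs) $$ (i, j) =
          (if i = j then c else 0) + (\<Sum>k<n. A $$ (i, k) * mat_horner n A cs $$ (k, j))"
        by (rule mat_horner_Cons_index[OF car(1) Cons.prems(2,3)])
      also have "\<dots> \<in> S"
        using Cons AS
        by (intro ring_closed_add[OF S] ring_closed_sum[OF S] ring_closed_mult[OF S])
          (auto intro: ring_closed_0[OF S])
      finally show ?case .
    qed
  qed (use car in simp)
  ultimately show ?thesis by simp
qed

section \<open>The universal polynomials\<close>

lemma elem_sym_0 [simp]: "finite I \<Longrightarrow> elem_sym 0 I t = 1"
proof -
  assume "finite I"
  hence "{S. S \<subseteq> I \<and> card S = 0} = {{}}" by (auto dest: finite_subset)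
  thus ?thesis by (simp add: elem_sym_def)
qed

lemma elem_sym_eq_0:
  assumes "finite I" "card I < k"
  shows "elem_sym k I t = 0"
proof -
  have "card S \<noteq> k" if "S \<subseteq> I" for S using card_mono[OF assms(1) that] assms(2) by simp
  hence none: "{S. S \<subseteq> I \<and> card S = k} = {}" by blast
  show ?thesis unfolding elem_sym_def none by simp
qed

lemma elem_sym_insert:
  assumes I: "finite I" "x \<notin> I"
  shows "elem_sym (Suc k) (insert x I) t = elem_sym (Suc k) I t + t x * elem_sym k I t"
proof -
  define B where "B k = {S. S \<subseteq> I \<and> card S = k}" for k
  have fin: "finite (B k)" for k using I by (simp add: B_def)
  have "{S. S \<subseteq> insert x I \<and> card S = Suc k} = B (Suc k) \<union> insert x ` B k"
  proof (intro equalityI subsetI)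
    fix S assume "S \<in> {S. S \<subseteq> insert x I \<and> card S = Suc k}"
    hence S: "S \<subseteq> insert x I" "card S = Suc k" by auto
    show "S \<in> B (Suc k) \<union> insert x ` B k"
    proof (cases "x \<in> S")
      case True
      have "S = insert x (S - {x})" "S - {x} \<in> B k"
        using True S I finite_subset[OF S(1)] by (auto simp: B_def)
      thus ?thesis by blast
    next
      case False
      thus ?thesis using S by (auto simp: B_def)
    qed
  next
    fix S assume "S \<in> B (Suc k) \<union> insert x ` B k"
    thus "S \<in> {S. S \<subseteq> insert x I \<and> card S = Suc k}"
    proof
      assume "S \<in> insert x ` B k"
      then obtain S' where S': "S' \<subseteq> I" "card S' = k" "S = insert x S'" by (auto simp: B_def)
      have "finite S'" "x \<notin> S'" using S'(1) I by (auto intro: finite_subset)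
      thus ?thesis using S' by auto
    qed (auto simp: B_def)
  qed
  moreover have "B (Suc k) \<inter> insert x ` B k = {}" using I by (auto simp: B_def)
  moreover have "inj_on (insert x) (B k)"
  proof (rule inj_onI)
    fix S T assume "S \<in> B k" "T \<in> B k" "insert x S = insert x T"
    moreover from this have "x \<notin> S" "x \<notin> T" using I by (auto simp: B_def)
    ultimately show "S = T" by (simp add: insert_ident)
  qed
  moreover have "(\<Prod>i\<in>insert x S. t i) = t x * (\<Prod>i\<in>S. t i)" if "S \<in> B k" for S
  proof -
    have "finite S" "x \<notin> S" using that I by (auto simp: B_def intro: finite_subset)
    thus ?thesis by simp
  qed
  ultimately show ?thesis
    unfolding elem_sym_def
    using fin by (simp add: sum.union_disjoint sum.reindex sum_distrib_left B_def)
qed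

lemma elem_sym_hom:
  fixes h :: "'a::comm_ring_1 \<Rightarrow> 'b::comm_ring_1"
  assumes add: "\<And>a b. h (a + b) = h a + h b" and mult: "\<And>a b. h (a * b) = h a * h b"
    and one: "h 1 = 1"
  shows "elem_sym k I (\<lambda>i. h (t i)) = h (elem_sym k I t)"
proof -
  have zero: "h 0 = 0" using add[of 0 0] by simp
  have sum: "h (sum f A) = (\<Sum>a\<in>A. h (f a))" for f and A :: "'c set set"
    by (induction A rule: infinite_finite_induct) (auto simp: zero add)
  have prod: "h (prod f A) = (\<Prod>a\<in>A. h (f a))" for f and A :: "'c set"
    by (induction A rule: infinite_finite_induct) (auto simp: one mult)
  show ?thesis by (simp add: elem_sym_def sum prod)
qed

lemma elem_sym_scale:
  "elem_sym k I (\<lambda>i. c * t i) = c ^ k * elem_sym k I (t :: 'i \<Rightarrow> 'a::comm_ring_1)"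
  unfolding elem_sym_def sum_distrib_left
  by (rule sum.cong) (simp_all add: prod.distrib)

lemma elem_sym_uminus:
  "elem_sym k I (\<lambda>i. - t i) = (-1) ^ k * elem_sym k I (t :: 'i \<Rightarrow> 'a::comm_ring_1)"
  using elem_sym_scale[of k I "-1" t] by (simp only: mult_minus1)

lemma coeff_prod_one_plus:
  assumes "finite I"
  shows "Polynomial.coeff (\<Prod>i\<in>I. [:1, t i:]) k = elem_sym k I (t :: 'i \<Rightarrow> 'a::comm_ring_1)"
  using assms
proof (induction I arbitrary: k rule: finite_induct)
  case empty
  show ?case by (cases k) (auto simp: elem_sym_eq_0)
next
  case (insert x I)
  show ?case
  proof (cases k)
    case 0
    thus ?thesis using insert by simp
  next
    case (Suc m)
    thus ?thesis using insert by (simp add: elem_sym_insert algebra_simps)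
  qed
qed

lemma coeff_prod_plus_X:
  assumes "finite I"
  shows "Polynomial.coeff (\<Prod>i\<in>I. [:t i, 1:]) k =
    (if k \<le> card I then elem_sym (card I - k) I (t :: 'i \<Rightarrow> 'a::comm_ring_1) else 0)"
  using assms
proof (induction I arbitrary: k rule: finite_induct)
  case empty
  show ?case by (simp add: coeff_1)
next
  case (insert x I)
  define P where "P = (\<Prod>i\<in>I. [:t i, 1:])"
  have P: "(\<Prod>i\<in>insert x I. [:t i, 1:]) = Polynomial.smult (t x) P + pCons 0 P"
    using insert.hyps by (simp add: P_def)
  have IH: "Polynomial.coeff P k = (if k \<le> card I then elem_sym (card I - k) I t else 0)" for k
    unfolding P_def by (rule insert.IH)
  have card: "card (insert x I) = Suc (card I)" using insert.hyps by simp
  show ?case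
  proof (cases k)
    case 0
    thus ?thesis
      using insert.hyps elem_sym_eq_0[of I "Suc (card I)" t]
      by (simp add: P card IH elem_sym_insert)
  next
    case (Suc m)
    have k: "Polynomial.coeff (\<Prod>i\<in>insert x I. [:t i, 1:]) k =
        t x * Polynomial.coeff P (Suc m) + Polynomial.coeff P m"
      by (simp add: P Suc)
    consider "m < card I" | "m = card I" | "m > card I" by linarith
    thus ?thesis
    proof cases
      case 1
      hence "card I - m = Suc (card I - Suc m)" by simp
      thus ?thesis unfolding k card using 1 Suc insert.hyps by (simp add: IH elem_sym_insert)
    next
      case 2
      thus ?thesis unfolding k card using Suc insert.hyps by (simp add: IH)
    next
      case 3
      thus ?thesis unfolding k card using Suc by (simp add: IH)
    qed
  qed
qed

section \<open>Existence and uniqueness of the universal polynomials\<close>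

lemma prod_poly_in_ring_closed':
  fixes y :: "'i \<Rightarrow> 'a::comm_ring_1"
  assumes S: "ring_closed S" and I: "finite I"
    and e: "\<And>k. elem_sym k I y \<in> S"
    and p: "\<And>k. Polynomial.coeff p k \<in> S"
  shows "(\<Prod>i\<in>I. poly p (y i)) \<in> S"
proof -
  obtain h where h: "bij_betw h {..<card I} I"
    using ex_bij_betw_nat_finite[OF I] by (auto simp: lessThan_atLeast0)
  have "(\<Prod>j<card I. poly (Poly (coeffs p)) (y (h j))) \<in> S"
  proof (rule prod_poly_in_ring_closed[OF S])
    fix i
    have "(\<Prod>j<card I. [:- y (h j), 1:]) = (\<Prod>i\<in>I. [:- y i, 1:])"
      by (rule prod.reindex_bij_betw[OF h, of "\<lambda>i. [:- y i, 1:]"])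
    thus "Polynomial.coeff (\<Prod>j<card I. [:- y (h j), 1:]) i \<in> S"
      using e by (auto simp: coeff_prod_plus_X[OF I] elem_sym_uminus intro!: ring_closed_0[OF S]
          ring_closed_mult[OF S] ring_closed_power[OF S] ring_closed_uminus[OF S] ring_closed_1[OF S])
  next
    show "set (coeffs p) \<subseteq> S"
    proof
      fix c assume "c \<in> set (coeffs p)"
      hence "c \<in> range (Polynomial.coeff p)" by (simp add: range_coeff)
      thus "c \<in> S" using p by auto
    qed
  qed
  also have "(\<Prod>j<card I. poly (Poly (coeffs p)) (y (h j))) = (\<Prod>i\<in>I. poly p (y i))"
    using prod.reindex_bij_betw[OF h, of "\<lambda>i. poly p (y i)"] by simp
  finally show ?thesis .
qed

text \<open>With a marker T, the products x i * y j have the generating polynomial \<Prod>j.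
  \<Prod>i. 1 + x i * y j * T, which is the product over \<open>j\<close> of the values at Y = y j
  of the polynomial \<Sum>k. e_k(x) * T ^ k * Y ^ k. Its coefficients in Y lie in S[T], so the norm
  argument applies over S[T]; this takes the place of the fundamental theorem on symmetric
  polynomials.\<close>

lemma elem_sym_products_in_ring_closed:
  fixes x :: "'i \<Rightarrow> 'a::comm_ring_1" and y :: "'j \<Rightarrow> 'a"
  assumes S: "ring_closed S" and I: "finite I" and J: "finite J"
    and ex: "\<And>k. elem_sym k I x \<in> S" and ey: "\<And>k. elem_sym k J y \<in> S"
  shows "elem_sym n (I \<times> J) (\<lambda>(i, j). x i * y j) \<in> S"
proof -
  define S' where "S' = {p. \<forall>i. Polynomial.coeff p i \<in> S}"
  have S': "ring_closed S'" unfolding S'_def by (rule ring_closed_coeffs[OF S])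
  define p where "p = (\<Sum>k\<le>card I. Polynomial.monom (Polynomial.monom (elem_sym k I x) k) k)"
  have factor: "poly p [:y j:] = (\<Prod>i\<in>I. [:1, x i * y j:])" for j
  proof (rule poly_eqI)
    fix k
    have "poly p [:y j:] = (\<Sum>k\<le>card I. Polynomial.monom (elem_sym k I x * y j ^ k) k)"
      unfolding p_def poly_sum poly_monom
      by (intro sum.cong refl) (simp add: poly_const_pow mult.commute smult_monom)
    also have "Polynomial.coeff \<dots> k = (if k \<le> card I then elem_sym k I x * y j ^ k else 0)"
      by (simp add: Polynomial.coeff_sum)
    also have "\<dots> = elem_sym k I (\<lambda>i. y j * x i)"
      using elem_sym_eq_0[OF I, of k x] by (auto simp: elem_sym_scale)
    also have "\<dots> = Polynomial.coeff (\<Prod>i\<in>I. [:1, x i * y j:]) k"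
      by (simp add: coeff_prod_one_plus[OF I] mult.commute)
    finally show "Polynomial.coeff (poly p [:y j:]) k = Polynomial.coeff (\<Prod>i\<in>I. [:1, x i * y j:]) k" .
  qed
  have "(\<Prod>j\<in>J. poly p [:y j:]) \<in> S'"
  proof (rule prod_poly_in_ring_closed'[OF S' J])
    fix k
    have "elem_sym k J (\<lambda>j. [:y j:]) = [:elem_sym k J y:]"
      by (rule elem_sym_hom) auto
    thus "elem_sym k J (\<lambda>j. [:y j:]) \<in> S'"
      using ey by (auto simp: S'_def coeff_pCons ring_closed_0[OF S] split: nat.splits)
    have "Polynomial.coeff p k = (if k \<le> card I then Polynomial.monom (elem_sym k I x) k else 0)"
      by (simp add: p_def Polynomial.coeff_sum)
    thus "Polynomial.coeff p k \<in> S'"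
      using ex by (auto simp: S'_def ring_closed_0[OF S])
  qed
  also have "(\<Prod>j\<in>J. poly p [:y j:]) = (\<Prod>j\<in>J. \<Prod>i\<in>I. [:1, x i * y j:])"
    by (simp only: factor)
  also have "\<dots> = (\<Prod>(i, j)\<in>I \<times> J. [:1, x i * y j:])"
    by (subst prod.swap) (simp add: prod.cartesian_product)
  finally have "Polynomial.coeff (\<Prod>(i, j)\<in>I \<times> J. [:1, x i * y j:]) n \<in> S"
    by (simp add: S'_def)
  also have "(\<Prod>(i, j)\<in>I \<times> J. [:1, x i * y j:]) = (\<Prod>ij\<in>I \<times> J. [:1, case ij of (i, j) \<Rightarrow> x i * y j:])"
    by (intro prod.cong) auto
  finally show ?thesis using I J by (simp add: coeff_prod_one_plus)
qed

text \<open>The \<open>x i\<close> are the negated roots of t ^ n + a 1 * t ^ (n - 1) + ... + a n,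
  which exist over the complex numbers; the negation matches the factors t + x i in
  \<open>coeff_prod_plus_X\<close>.\<close>

lemma exists_elem_sym_eq:
  fixes a :: "nat \<Rightarrow> complex"
  obtains x where "\<And>k. k \<in> {1..n} \<Longrightarrow> elem_sym k {1..n} x = a k"
proof -
  define p where "p = Polynomial.monom 1 n + (\<Sum>k<n. Polynomial.monom (a (n - k)) k)"
  have cp: "Polynomial.coeff p k = (if k = n then 1 else if k < n then a (n - k) else 0)" for k
    by (auto simp: p_def Polynomial.coeff_sum)
  have deg: "Polynomial.degree p = n"
    by (intro antisym degree_le le_degree) (auto simp: cp)
  have "p \<noteq> 0" using cp[of n] by auto
  obtain A where A: "size A = Polynomial.degree p"
    "p = Polynomial.smult (Polynomial.lead_coeff p) (\<Prod>r\<in>#A. [:-r, 1:])"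
    using alg_closed_imp_factorization[OF \<open>p \<noteq> 0\<close>] by blast
  obtain rs where rs: "mset rs = A" using ex_mset by blast
  have len: "length rs = n" using A(1) rs deg by (metis size_mset)
  define x where "x i = - rs ! (i - 1)" for i
  have "p = (\<Prod>r\<in>#A. [:-r, 1:])" using A(2) by (simp add: deg cp)
  also have "\<dots> = prod_list (map (\<lambda>r. [:-r, 1:]) rs)"
    by (simp flip: rs prod_mset_prod_list)
  also have "\<dots> = (\<Prod>i<n. [:- rs ! i, 1:])"
    by (simp add: prod.list_conv_set_nth len lessThan_atLeast0)
  also have "\<dots> = (\<Prod>i\<in>{1..n}. [:x i, 1:])"
    by (rule prod.reindex_bij_witness[of _ "\<lambda>i. i - 1" Suc]) (auto simp: x_def)
  finally have p: "p = (\<Prod>i\<in>{1..n}. [:x i, 1:])" .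
  show ?thesis
  proof (rule that[of x])
    fix k assume k: "k \<in> {1..n}"
    have "Polynomial.coeff p (n - k) = elem_sym k {1..n} x"
      using k by (simp add: p coeff_prod_plus_X)
    moreover have "n - k \<noteq> n" "n - k < n" "n - (n - k) = k" using k by auto
    ultimately show "elem_sym k {1..n} x = a k" using cp[of "n - k"] by simp
  qed
qed

text \<open>Justifies the definite description in \<open>ene_poly\<close>. The integer polynomials
  in the two families of elementary symmetric ones form a ring-closed set, which gives existence.
  Uniqueness is the algebraic independence of these families: they take arbitrary complex values
  simultaneously.\<close>

lemma ene_poly_unique:
  "\<exists>!Q. mp_vars Q \<subseteq> Inl ` {1..n} \<union> Inr ` {1..n} \<and>
     elem_sym n ({1..n} \<times> {1..n}) (\<lambda>(i, j). mp_var (Inl i) * mp_var (Inr j) :: (nat + nat) int_mpoly)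
       = mp_eval (case_sum (\<lambda>k. elem_sym k {1..n} (\<lambda>i. mp_var (Inl i)))
                           (\<lambda>k. elem_sym k {1..n} (\<lambda>j. mp_var (Inr j)))) Q"
  (is "\<exists>!Q. ?V Q \<and> ?e = mp_eval ?\<phi> Q")
proof (rule ex_ex1I)
  define S where "S = {mp_eval ?\<phi> Q | Q. ?V Q}"
  have S: "ring_closed S"
    unfolding ring_closed_def
  proof (intro conjI ballI)
    have "?V 1" by (auto simp: mp_vars_def)
    thus "1 \<in> S" unfolding S_def using mp_eval_1[of ?\<phi>] by (metis (mono_tags, lifting) mem_Collect_eq)
    fix a b assume "a \<in> S" "b \<in> S"
    then obtain P Q where PQ: "a = mp_eval ?\<phi> P" "b = mp_eval ?\<phi> Q" "?V P" "?V Q"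
      unfolding S_def by blast
    have "a - b = mp_eval ?\<phi> (P - Q)" "?V (P - Q)" "a * b = mp_eval ?\<phi> (P * Q)" "?V (P * Q)"
      using PQ mp_vars_diff[of P Q] mp_vars_mult[of P Q] by auto
    thus "a - b \<in> S" "a * b \<in> S" unfolding S_def by blast+
  qed
  have var: "?\<phi> v \<in> S" if "v \<in> Inl ` {1..n} \<union> Inr ` {1..n}" for v
  proof -
    have "mp_eval ?\<phi> (mp_var v) = ?\<phi> v" by (rule mp_eval_var)
    moreover have "?V (mp_var v)" using that by (auto simp: mp_vars_def mp_var_def)
    ultimately show ?thesis unfolding S_def by (metis (mono_tags, lifting) mem_Collect_eq)
  qed
  \<comment> \<open>Outside 1..n the elementary symmetric polynomial is 1 or 0, so indices without a
    variable in \<open>Q\<close> do no harm.\<close>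
  have e_in: "elem_sym k {1..n} t \<in> S" if "k \<in> {1..n} \<Longrightarrow> elem_sym k {1..n} t \<in> S" for k t
  proof (cases "k \<in> {1..n}")
    case False
    hence "k = 0 \<or> card {1..n} < k" by auto
    thus ?thesis using elem_sym_eq_0[of "{1..n}" k t] ring_closed_0[OF S] ring_closed_1[OF S] by auto
  qed (use that in blast)
  have "?e \<in> S"
  proof (rule elem_sym_products_in_ring_closed[OF S])
    show "elem_sym k {1..n} (\<lambda>i. mp_var (Inl i)) \<in> S" for k
      by (rule e_in) (use var[of "Inl k"] in auto)
    show "elem_sym k {1..n} (\<lambda>i. mp_var (Inr i)) \<in> S" for k
      by (rule e_in) (use var[of "Inr k"] in auto)
  qed auto
  thus "\<exists>Q. ?V Q \<and> ?e = mp_eval ?\<phi> Q" unfolding S_def by blast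
next
  fix P Q
  assume P: "?V P \<and> ?e = mp_eval ?\<phi> P" and Q: "?V Q \<and> ?e = mp_eval ?\<phi> Q"
  show "P = Q"
  proof (rule int_mpoly_eqI)
    fix \<psi> :: "nat + nat \<Rightarrow> complex"
    obtain x where x: "\<And>k. k \<in> {1..n} \<Longrightarrow> elem_sym k {1..n} x = \<psi> (Inl k)"
      using exists_elem_sym_eq[of n "\<lambda>k. \<psi> (Inl k)"] by blast
    obtain y where y: "\<And>k. k \<in> {1..n} \<Longrightarrow> elem_sym k {1..n} y = \<psi> (Inr k)"
      using exists_elem_sym_eq[of n "\<lambda>k. \<psi> (Inr k)"] by blast
    have "mp_eval \<psi> R = mp_eval (case_sum x y) (mp_eval ?\<phi> R)" if "?V R" for R
      unfolding mp_eval_mp_eval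
    proof (rule mp_eval_cong)
      fix v assume "v \<in> mp_vars R"
      with that have "v \<in> Inl ` {1..n} \<union> Inr ` {1..n}" by blast
      thus "\<psi> v = mp_eval (case_sum x y) (?\<phi> v)" using x y by auto
    qed
    thus "mp_eval \<psi> P = mp_eval \<psi> Q" using P Q by simp
  qed
qed

lemma mp_vars_ene_poly: "mp_vars (ene_poly n) \<subseteq> Inl ` {1..n} \<union> Inr ` {1..n}"
  using theI'[OF ene_poly_unique[of n]] unfolding ene_poly_def by blast

lemma mp_eval_ene_poly:
  fixes x y :: "nat \<Rightarrow> 'a::comm_ring_1"
  assumes "\<And>k. k \<in> {1..n} \<Longrightarrow> \<psi> (Inl k) = elem_sym k {1..n} x"
    and "\<And>k. k \<in> {1..n} \<Longrightarrow> \<psi> (Inr k) = elem_sym k {1..n} y"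
  shows "mp_eval \<psi> (ene_poly n) = elem_sym n ({1..n} \<times> {1..n}) (\<lambda>(i, j). x i * y j)"
proof -
  let ?\<phi> = "case_sum (\<lambda>k. elem_sym k {1..n} (\<lambda>i. mp_var (Inl i)))
                     (\<lambda>k. elem_sym k {1..n} (\<lambda>j. mp_var (Inr j))) :: nat + nat \<Rightarrow> (nat + nat) int_mpoly"
  have "mp_eval \<psi> (ene_poly n) = mp_eval (case_sum x y) (mp_eval ?\<phi> (ene_poly n))"
    unfolding mp_eval_mp_eval
  proof (rule mp_eval_cong)
    fix v assume "v \<in> mp_vars (ene_poly n)"
    hence "v \<in> Inl ` {1..n} \<union> Inr ` {1..n}" using mp_vars_ene_poly by blast
    thus "\<psi> v = mp_eval (case_sum x y) (?\<phi> v)" using assms by auto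
  qed
  also have "mp_eval ?\<phi> (ene_poly n) = elem_sym n ({1..n} \<times> {1..n})
      (\<lambda>(i, j). mp_var (Inl i) * mp_var (Inr j) :: (nat + nat) int_mpoly)"
    using theI'[OF ene_poly_unique[of n]] unfolding ene_poly_def by simp
  finally show ?thesis by (simp add: case_prod_unfold)
qed

lemma prod_one_minus_eq_truncation:
  fixes x :: "nat \<Rightarrow> complex"
  assumes "fps_nth f 0 = 1" "\<And>k. k \<in> {1..n} \<Longrightarrow> elem_sym k {1..n} (\<lambda>i. - x i) = fps_nth f k"
  shows "(\<Prod>i\<in>{1..n}. 1 - x i * z) = (\<Sum>k\<le>n. fps_nth f k * z ^ k)"
proof -
  define p where "p = (\<Prod>i\<in>{1..n}. [:1, - x i:])"
  have "Polynomial.coeff p k = (if k \<le> n then fps_nth f k else 0)" for k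
    using assms elem_sym_eq_0[of "{1..n}" k "\<lambda>i. - x i"]
    by (cases "k = 0") (auto simp: p_def coeff_prod_one_plus)
  hence "p = (\<Sum>k\<le>n. Polynomial.monom (fps_nth f k) k)"
    by (intro poly_eqI) (simp add: Polynomial.coeff_sum)
  hence "poly p z = (\<Sum>k\<le>n. fps_nth f k * z ^ k)" by (simp add: poly_sum poly_monom)
  thus ?thesis by (simp add: p_def poly_prod mult.commute)
qed

text \<open>The sign (-1) ^ n of the ene product is absorbed by passing from e_n of the products x'
  i * y' j to e_n of their negatives; a second change of sign, x = - x', turns the Taylor
  polynomials into products of 1 - x i * z. Some \<open>x i\<close> vanish when a Taylor polynomial
  has degree below \<open>n\<close>. The roots depend on \<open>n\<close>, and only coefficient
  \<open>n\<close> is compared.\<close>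

lemma ene_nth_roots:
  assumes "fps_nth f 0 = 1" "fps_nth g 0 = 1"
  obtains x y :: "nat \<Rightarrow> complex" where
    "\<And>z. (\<Prod>i\<in>{1..n}. 1 - x i * z) = (\<Sum>k\<le>n. fps_nth f k * z ^ k)"
    "\<And>z. (\<Prod>j\<in>{1..n}. 1 - y j * z) = (\<Sum>k\<le>n. fps_nth g k * z ^ k)"
    "fps_nth (ene f g) n = Polynomial.coeff (\<Prod>(i, j)\<in>{1..n} \<times> {1..n}. [:1, - (x i * y j):]) n"
proof -
  obtain x' where x': "\<And>k. k \<in> {1..n} \<Longrightarrow> elem_sym k {1..n} x' = fps_nth f k"
    using exists_elem_sym_eq by blast
  obtain y' where y': "\<And>k. k \<in> {1..n} \<Longrightarrow> elem_sym k {1..n} y' = fps_nth g k"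
    using exists_elem_sym_eq by blast
  have "mp_eval (case_sum (fps_nth f) (fps_nth g)) (ene_poly n) =
      elem_sym n ({1..n} \<times> {1..n}) (\<lambda>(i, j). x' i * y' j)"
    by (rule mp_eval_ene_poly) (use x' y' in auto)
  hence "fps_nth (ene f g) n = (-1) ^ n * elem_sym n ({1..n} \<times> {1..n}) (\<lambda>(i, j). x' i * y' j)"
    by (auto simp: ene_def)
  also have "\<dots> = elem_sym n ({1..n} \<times> {1..n}) (\<lambda>ij. - (case ij of (i, j) \<Rightarrow> x' i * y' j))"
    by (simp add: elem_sym_uminus)
  also have "\<dots> = Polynomial.coeff
      (\<Prod>ij\<in>{1..n} \<times> {1..n}. [:1, - (case ij of (i, j) \<Rightarrow> x' i * y' j):]) n"
    by (subst coeff_prod_one_plus) auto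
  also have "(\<Prod>ij\<in>{1..n} \<times> {1..n}. [:1, - (case ij of (i, j) \<Rightarrow> x' i * y' j):]) =
      (\<Prod>(i, j)\<in>{1..n} \<times> {1..n}. [:1, - ((- x' i) * (- y' j)):])"
    by (intro prod.cong) auto
  finally show ?thesis
    by (intro that[of "\<lambda>i. - x' i" "\<lambda>i. - y' i"] prod_one_minus_eq_truncation)
      (use x' y' assms in auto)
qed

section \<open>The Borel-Caratheodory inequality and products over small roots\<close>

text \<open>The map w / (2 * A - w) sends the half-plane Re w < A into the unit disc and fixes 0,
  since such w are nearer to 0 than to 2 * A. Schwarz's lemma for its composite with
  \<open>H\<close>, rescaled to the unit disc, gives the inequality after solving for the norm of
  \<open>H z\<close>.\<close>

lemma borel_caratheodory:
  fixes H :: "complex \<Rightarrow> complex"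
  assumes hol: "H holomorphic_on ball 0 R" and H0: "H 0 = 0"
    and Re: "\<And>z. norm z < R \<Longrightarrow> Re (H z) < A"
    and z: "norm z < R"
  shows "norm (H z) \<le> 2 * A * norm z / (R - norm z)"
proof -
  have R: "R > 0" using z norm_ge_zero[of z] by linarith
  have A: "A > 0" using Re[of 0] R H0 by simp
  define \<phi> where "\<phi> w = H (of_real R * w) / (2 * of_real A - H (of_real R * w))" for w
  have in_ball: "norm (of_real R * w) < R" if "norm w < 1" for w :: complex
    using that R by (simp add: norm_mult)
  have nz: "2 * of_real A - H (of_real R * w) \<noteq> 0" if "norm w < 1" for w
  proof
    assume "2 * of_real A - H (of_real R * w) = 0"
    hence "Re (2 * of_real A - H (of_real R * w)) = 0" by simp
    with Re[OF in_ball[OF that]] A show False by simp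
  qed
  have less: "norm w < norm (2 * of_real A - w)" if "Re w < A" for w
  proof -
    have "(norm w)\<^sup>2 < (norm (2 * of_real A - w))\<^sup>2"
      using that A mult_strict_left_mono[of "Re w" A "4 * A"]
      by (simp add: cmod_power2) (simp add: power2_eq_square algebra_simps)
    thus ?thesis by (rule power2_less_imp_less) simp
  qed
  have hol_comp: "(\<lambda>w. H (of_real R * w)) holomorphic_on ball 0 1"
  proof (rule holomorphic_on_compose_gen[OF _ hol, unfolded o_def])
    show "(*) (complex_of_real R) ` ball 0 1 \<subseteq> ball 0 R" using in_ball by auto
  qed (intro holomorphic_intros)
  have "norm (\<phi> (z / of_real R)) \<le> norm (z / of_real R)"
  proof (rule Schwarz_Lemma(1))
    show "\<phi> holomorphic_on ball 0 1"
      unfolding \<phi>_def by (intro holomorphic_intros hol_comp) (use nz in auto)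
    show "\<phi> 0 = 0" by (simp add: \<phi>_def H0)
    show "norm (\<phi> w) < 1" if "norm w < 1" for w
      using less[OF Re[OF in_ball[OF that]]] nz[OF that] by (simp add: \<phi>_def norm_divide divide_simps)
    show "norm (z / of_real R) < 1" using z R by (simp add: norm_divide)
  qed
  moreover have zR: "norm (z / of_real R) < 1" using z R by (simp add: norm_divide)
  ultimately have "norm (H z) / norm (2 * of_real A - H z) \<le> norm z / R"
    using R by (simp add: \<phi>_def norm_divide)
  moreover have "norm (2 * of_real A - H z) > 0" using nz[OF zR] R by simp
  ultimately have "norm (H z) \<le> norm z / R * norm (2 * of_real A - H z)"
    by (simp add: pos_divide_le_eq)
  also have "\<dots> \<le> norm z / R * (2 * A + norm (H z))"
  proof (rule mult_left_mono)
    show "norm (2 * of_real A - H z) \<le> 2 * A + norm (H z)"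
      using norm_triangle_ineq4[of "2 * of_real A" "H z"] A by (simp add: norm_mult)
  qed (use R in simp)
  finally have "norm (H z) * R \<le> norm z * (2 * A + norm (H z))" using R by (simp add: field_simps)
  hence "norm (H z) * (R - norm z) \<le> 2 * A * norm z" by (simp add: algebra_simps)
  thus ?thesis using z by (simp add: pos_le_divide_eq)
qed

lemma fps_nth_cauchy_bound:
  fixes F :: "complex fps"
  assumes r: "r > 0" "ereal r < fps_conv_radius F"
    and B: "\<And>z. norm z = r \<Longrightarrow> norm (eval_fps F z) \<le> B"
  shows "norm (fps_nth F n) * r ^ n \<le> B"
proof -
  have sub: "cball (0 :: complex) r \<subseteq> eball 0 (fps_conv_radius F)"
  proof
    fix z :: complex assume "z \<in> cball 0 r"
    hence "ereal (norm z) \<le> ereal r" by simp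
    also have "\<dots> < fps_conv_radius F" by fact
    finally show "z \<in> eball 0 (fps_conv_radius F)" by simp
  qed
  have "norm ((deriv ^^ n) (eval_fps F) 0) \<le> fact n * B / r ^ n"
  proof (rule Cauchy_inequality)
    show "eval_fps F holomorphic_on ball 0 r"
      by (rule holomorphic_on_eval_fps) (use sub ball_subset_cball[of 0 r] in blast)
    show "continuous_on (cball 0 r) (eval_fps F)"
      by (rule continuous_on_subset[OF continuous_on_eval_fps sub])
  qed (use r B in auto)
  moreover have "fps_conv_radius F > 0"
    using r by (metis ereal_less(2) less_trans)
  ultimately show ?thesis
    using r by (simp add: fps_nth_conv_deriv norm_divide norm_fact field_simps)
qed

lemma poly_coeff_cauchy_bound:
  fixes p :: "complex poly"
  assumes "r > 0" "\<And>z. norm z = r \<Longrightarrow> norm (poly p z) \<le> B"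
  shows "norm (Polynomial.coeff p n) * r ^ n \<le> B"
  using fps_nth_cauchy_bound[of r "fps_of_poly p" B n] assms by simp

text \<open>The term with m = 0 is 1 / 0 = 0 by convention, so the series starts at m = 1.\<close>

lemma Ln_one_minus_sums:
  fixes u :: complex
  assumes "norm u < 1"
  shows "(\<lambda>m. - (u ^ m / of_nat m)) sums Ln (1 - u)"
  using Ln_series'[of "- u"] assms by simp

lemma norm_le_of_sums:
  fixes a :: "nat \<Rightarrow> complex"
  assumes "a sums s" "b sums B" "\<And>m. norm (a m) \<le> b m"
  shows "norm s \<le> B"
  using assms norm_suminf_le[of a b] by (simp add: sums_iff)

text \<open>The Taylor coefficients of \<open>H\<close>, the sum of the Ln (1 - x i * z), are the
  power sums divided by - m, and Re H is the logarithm of the modulus of the product.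
  Borel-Caratheodory on the circle of radius R / 2 bounds \<open>H\<close> by 2 * A, and Cauchy's
  inequality there gives the factor (2 / R) ^ m. The number of roots does not enter.\<close>

lemma power_sum_bound:
  fixes x :: "'i \<Rightarrow> complex"
  assumes I: "finite I" and R: "R > 0" and small: "\<And>i. i \<in> I \<Longrightarrow> norm (x i) * R < 1"
    and bound: "\<And>z. norm z < R \<Longrightarrow> norm (\<Prod>i\<in>I. 1 - x i * z) < exp A"
    and m: "m > 0"
  shows "norm (\<Sum>i\<in>I. x i ^ m) \<le> of_nat m * (2 * A * (2 / R) ^ m)"
proof -
  have xz: "norm (x i * z) < 1" if "i \<in> I" "norm z < R" for i z
  proof -
    have "norm (x i) * norm z \<le> norm (x i) * R" using that by (intro mult_left_mono) auto
    thus ?thesis using small[OF that(1)] by (simp add: norm_mult)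
  qed
  \<comment> \<open>The real part is positive, so the principal branch of \<open>Ln\<close> is
    holomorphic along the whole disc.\<close>
  have nonpos: "1 - x i * z \<notin> \<real>\<^sub>\<le>\<^sub>0" if "i \<in> I" "norm z < R" for i z
  proof
    assume "1 - x i * z \<in> \<real>\<^sub>\<le>\<^sub>0"
    hence "Re (1 - x i * z) \<le> 0" by (simp add: complex_nonpos_Reals_iff)
    moreover have "Re (x i * z) < 1" using xz[OF that] complex_Re_le_cmod[of "x i * z"] by linarith
    ultimately show False by simp
  qed
  define H where "H z = (\<Sum>i\<in>I. Ln (1 - x i * z))" for z
  define F where "F = Abs_fps (\<lambda>m. - ((\<Sum>i\<in>I. x i ^ m) / of_nat m))"
  have H_sums: "(\<lambda>m. fps_nth F m * z ^ m) sums H z" if "norm z < R" for z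
  proof -
    have "(\<lambda>m. \<Sum>i\<in>I. - ((x i * z) ^ m / of_nat m)) sums H z"
      unfolding H_def using xz that by (intro sums_sum Ln_one_minus_sums) auto
    moreover have "(\<Sum>i\<in>I. - ((x i * z) ^ m / of_nat m)) = fps_nth F m * z ^ m" for m
      by (simp add: F_def sum_negf power_mult_distrib sum_divide_distrib sum_distrib_right)
    ultimately show ?thesis by simp
  qed
  have ReH: "Re (H z) < A" if "norm z < R" for z
  proof -
    have nz: "1 - x i * z \<noteq> 0" if "i \<in> I" for i using nonpos[OF that \<open>norm z < R\<close>] by auto
    have "exp (Re (H z)) = norm (exp (H z))" by simp
    also have "exp (H z) = (\<Prod>i\<in>I. 1 - x i * z)"
      unfolding H_def exp_sum[OF I] using nz by (intro prod.cong refl) simp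
    also have "norm \<dots> < exp A" using bound[OF that] .
    finally show ?thesis by simp
  qed
  have hol: "H holomorphic_on ball 0 R"
    unfolding H_def by (intro holomorphic_intros) (use nonpos in auto)
  have conv: "fps_conv_radius F \<ge> R"
    unfolding fps_conv_radius_def
  proof (rule conv_radius_geI_ex')
    fix r :: real assume "0 < r" "ereal r < ereal R"
    thus "summable (\<lambda>m. fps_nth F m * of_real r ^ m)" using H_sums[of "of_real r"] by (auto simp: sums_iff)
  qed
  have "norm (fps_nth F m) * (R / 2) ^ m \<le> 2 * A"
  proof (rule fps_nth_cauchy_bound)
    have "ereal (R / 2) < ereal R" using R by simp
    thus "ereal (R / 2) < fps_conv_radius F" using conv by (rule less_le_trans)
    fix z :: complex assume z: "norm z = R / 2"
    have "eval_fps F z = H z" unfolding eval_fps_def using H_sums[of z] z R by (simp add: sums_iff)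
    moreover have "norm (H z) \<le> 2 * A * norm z / (R - norm z)"
      by (rule borel_caratheodory[OF hol]) (use ReH z R in \<open>auto simp: H_def\<close>)
    ultimately show "norm (eval_fps F z) \<le> 2 * A" using z R by simp
  qed (use R in simp)
  moreover have "norm (fps_nth F m) = norm (\<Sum>i\<in>I. x i ^ m) / of_nat m"
    by (simp add: F_def norm_divide)
  ultimately show ?thesis
    using m R by (simp add: field_simps power_divide)
qed

text \<open>
  The logarithm of the product is the Hadamard product \<open>- (\<Sum>m. p m * q m * z ^ m / m)\<close> of the
  power sums, which converges well inside the disc of radius \<open>R\<^sup>2\<close>.
\<close>

lemma small_roots_product_bound:
  fixes x :: "'i \<Rightarrow> complex" and y :: "'j \<Rightarrow> complex"
  assumes I: "finite I" and J: "finite J" and R: "R > 0"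
    and xs: "\<And>i. i \<in> I \<Longrightarrow> norm (x i) * R < 1" and ys: "\<And>j. j \<in> J \<Longrightarrow> norm (y j) * R < 1"
    and A: "\<And>z. norm z < R \<Longrightarrow> norm (\<Prod>i\<in>I. 1 - x i * z) < exp A"
    and B: "\<And>z. norm z < R \<Longrightarrow> norm (\<Prod>j\<in>J. 1 - y j * z) < exp B"
    and z: "8 * norm z \<le> R\<^sup>2"
  shows "norm (\<Prod>i\<in>I. \<Prod>j\<in>J. 1 - x i * y j * z) \<le> exp (8 * A * B)"
proof -
  have AB: "A > 0" "B > 0" using A[of 0] B[of 0] R by auto
  define p where "p m = (\<Sum>i\<in>I. x i ^ m)" for m
  define q where "q m = (\<Sum>j\<in>J. y j ^ m)" for m
  have p: "norm (p m) \<le> of_nat m * (2 * A * (2 / R) ^ m)" if "m > 0" for m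
    unfolding p_def by (rule power_sum_bound[OF I R xs A that])
  have q: "norm (q m) \<le> of_nat m * (2 * B * (2 / R) ^ m)" if "m > 0" for m
    unfolding q_def by (rule power_sum_bound[OF J R ys B that])
  have small: "norm (x i * y j * z) < 1" if "i \<in> I" "j \<in> J" for i j
  proof -
    have "(norm (x i) * R) * (norm (y j) * R) \<le> 1 * 1"
      using xs[OF that(1)] ys[OF that(2)] R by (intro mult_mono) auto
    hence *: "norm (x i * y j) * R\<^sup>2 \<le> 1" by (simp add: norm_mult power2_eq_square mult_ac)
    have "8 * norm (x i * y j * z) = norm (x i * y j) * (8 * norm z)" by (simp add: norm_mult)
    also have "\<dots> \<le> norm (x i * y j) * R\<^sup>2" using z by (intro mult_left_mono) auto
    finally show ?thesis using * by simp
  qed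
  define s where "s = (\<Sum>i\<in>I. \<Sum>j\<in>J. Ln (1 - x i * y j * z))"
  have "(\<lambda>m. \<Sum>i\<in>I. \<Sum>j\<in>J. - ((x i * y j * z) ^ m / of_nat m)) sums s"
    unfolding s_def using small by (intro sums_sum Ln_one_minus_sums) auto
  moreover have "(\<Sum>i\<in>I. \<Sum>j\<in>J. - ((x i * y j * z) ^ m / of_nat m)) = - (p m * q m * z ^ m / of_nat m)" for m
    by (simp add: p_def q_def sum_negf power_mult_distrib sum_divide_distrib sum_distrib_right
        sum_distrib_left) (rule sum.swap)
  ultimately have "(\<lambda>m. - (p m * q m * z ^ m / of_nat m)) sums s" by simp
  \<comment> \<open>The series of m / 2 ^ m has sum 2, whence the constant 8 = 4 * 2 in the
    exponent.\<close>
  moreover have "(\<lambda>m. 4 * A * B * (of_nat m * (1 / 2) ^ m)) sums (4 * A * B * 2)"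
  proof (intro sums_mult)
    have "(\<lambda>m. of_nat (Suc m) * (1 / 2) ^ m) sums (1 / (1 - 1 / 2 :: real)\<^sup>2)"
      by (rule geometric_deriv_sums) simp
    hence "(\<lambda>m. 1 / 2 * (of_nat (Suc m) * (1 / 2) ^ m)) sums (1 / 2 * (1 / (1 - 1 / 2 :: real)\<^sup>2))"
      by (rule sums_mult)
    hence "(\<lambda>m. of_nat (Suc m) * (1 / 2) ^ Suc m) sums (2 :: real)"
      by (simp add: power2_eq_square mult_ac)
    thus "(\<lambda>m. of_nat m * (1 / 2) ^ m) sums (2 :: real)"
      using sums_Suc_iff[of "\<lambda>m. of_nat m * (1 / 2) ^ m :: real" 2] by simp
  qed
  moreover have "norm (- (p m * q m * z ^ m / of_nat m)) \<le> 4 * A * B * (of_nat m * (1 / 2) ^ m)" for m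
  proof (cases "m = 0")
    case False
    hence m: "m > 0" by simp
    have "norm (p m) * norm (q m) \<le>
        (of_nat m * (2 * A * (2 / R) ^ m)) * (of_nat m * (2 * B * (2 / R) ^ m))"
      using AB R by (intro mult_mono p q m) auto
    hence "norm (p m) * norm (q m) * norm z ^ m / of_nat m \<le>
        (of_nat m * (2 * A * (2 / R) ^ m)) * (of_nat m * (2 * B * (2 / R) ^ m)) * norm z ^ m / of_nat m"
      by (intro divide_right_mono mult_right_mono) auto
    also have "\<dots> = 4 * A * B * (of_nat m * ((2 / R) ^ m * (2 / R) ^ m * norm z ^ m))"
      using m by (simp add: field_simps)
    \<comment> \<open>Each power sum contributes (2 / R) ^ m, so the majorizing series has ratio 4 *
      \<bar>z\<bar> / R^2; the condition 8 * \<bar>z\<bar> \<le> R^2 is chosen to make this at most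
      1 / 2.\<close>
    also have "(2 / R) ^ m * (2 / R) ^ m * norm z ^ m = (4 * norm z / R\<^sup>2) ^ m"
      by (simp flip: power_mult_distrib) (simp add: power2_eq_square)
    also have "4 * A * B * (of_nat m * (4 * norm z / R\<^sup>2) ^ m) \<le> 4 * A * B * (of_nat m * (1 / 2) ^ m)"
      using AB R z by (intro mult_left_mono power_mono) (auto simp: field_simps)
    finally show ?thesis by (simp add: norm_mult norm_divide norm_power)
  qed simp
  ultimately have "norm s \<le> 4 * A * B * 2" by (rule norm_le_of_sums)
  hence "norm (exp s) \<le> exp (4 * A * B * 2)"
    using norm_exp[of s] by (meson exp_le_cancel_iff order_trans)
  moreover have "exp s = (\<Prod>i\<in>I. \<Prod>j\<in>J. 1 - x i * y j * z)"
    unfolding s_def exp_sum[OF I] exp_sum[OF J]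
  proof (intro prod.cong refl)
    fix i j assume "i \<in> I" "j \<in> J"
    hence "1 - x i * y j * z \<noteq> 0" using small[of i j] by force
    thus "exp (Ln (1 - x i * y j * z)) = 1 - x i * y j * z" by simp
  qed
  ultimately show ?thesis by (simp add: mult_ac)
qed

section \<open>Products over pairs of roots\<close>

lemma norm_le_of_sphere_bound:
  fixes h :: "complex \<Rightarrow> complex"
  assumes "h holomorphic_on UNIV" "s > 0" "\<And>w. norm w = s \<Longrightarrow> norm (h w) \<le> B" "norm z \<le> s"
  shows "norm (h z) \<le> B"
proof (rule maximum_modulus_frontier[of h "cball 0 s"])
  show "h holomorphic_on interior (cball 0 s)" "continuous_on (closure (cball 0 s)) h"
    using assms(1) by (auto intro: holomorphic_on_subset holomorphic_on_imp_continuous_on)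
qed (use assms in auto)

text \<open>A factor with a large root has modulus at least s / R - 1 on the sphere of radius
  \<open>s\<close>. Dividing these factors out leaves a polynomial, so the improved bound moves
  inwards by the maximum principle. At z = 0 it counts the large roots; for general \<open>z\<close>
  it controls the small part at no cost, because s \<ge> 2 * R makes s / R - 1 at least 1.\<close>

lemma split_roots_bound:
  fixes x :: "'i \<Rightarrow> complex"
  assumes I: "finite I" and R: "R > 0" and s: "s \<ge> 2 * R"
    and bound: "\<And>z. norm z = s \<Longrightarrow> norm (\<Prod>i\<in>I. 1 - x i * z) \<le> B"
    and z: "norm z \<le> s"
  shows "norm (\<Prod>i\<in>{i \<in> I. norm (x i) * R < 1}. 1 - x i * z) *
           (s / R - 1) ^ card {i \<in> I. norm (x i) * R \<ge> 1} \<le> B"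
proof -
  define I0 where "I0 = {i \<in> I. norm (x i) * R < 1}"
  define I1 where "I1 = {i \<in> I. norm (x i) * R \<ge> 1}"
  have fin: "finite I0" "finite I1" and II: "I = I0 \<union> I1" "I0 \<inter> I1 = {}"
    using I by (auto simp: I0_def I1_def)
  have q: "s / R - 1 \<ge> 1" using R s by (simp add: field_simps)
  have "norm (\<Prod>i\<in>I0. 1 - x i * z) \<le> B / (s / R - 1) ^ card I1"
  proof (rule norm_le_of_sphere_bound[where s = s and h = "\<lambda>z. \<Prod>i\<in>I0. 1 - x i * z"])
    show "(\<lambda>z. \<Prod>i\<in>I0. 1 - x i * z) holomorphic_on UNIV" by (intro holomorphic_intros)
    fix w :: complex assume w: "norm w = s"
    have "(s / R - 1) ^ card I1 = (\<Prod>i\<in>I1. s / R - 1)" by simp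
    also have "\<dots> \<le> (\<Prod>i\<in>I1. norm (1 - x i * w))"
    proof (intro prod_mono conjI)
      fix i assume i: "i \<in> I1"
      have "s / R \<le> norm (x i) * s"
        using i R s by (simp add: I1_def field_simps mult_right_mono)
      also have "\<dots> = norm (x i * w)" using w by (simp add: norm_mult)
      finally show "s / R - 1 \<le> norm (1 - x i * w)"
        using norm_triangle_ineq2[of "x i * w" 1] by (simp add: norm_minus_commute)
    qed (use q in auto)
    finally have "norm (\<Prod>i\<in>I0. 1 - x i * w) * (s / R - 1) ^ card I1 \<le>
        norm (\<Prod>i\<in>I0. 1 - x i * w) * (\<Prod>i\<in>I1. norm (1 - x i * w))"
      by (intro mult_left_mono) auto
    also have "\<dots> = norm (\<Prod>i\<in>I. 1 - x i * w)"
      using II fin by (simp add: prod.union_disjoint norm_mult prod_norm)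
    also have "\<dots> \<le> B" using bound[OF w] .
    finally show "norm (\<Prod>i\<in>I0. 1 - x i * w) \<le> B / (s / R - 1) ^ card I1"
      using q by (simp add: field_simps)
  qed (use R s z in auto)
  thus ?thesis using q by (simp add: I0_def I1_def field_simps)
qed

text \<open>A substitute for Jensen's formula: at the origin, with s = 4 * R, each large root costs
  a factor 3, and 3 \<ge> e.\<close>

lemma card_large_roots_le:
  fixes x :: "'i \<Rightarrow> complex"
  assumes I: "finite I" and R: "R > 0"
    and bound: "\<And>z. norm z = 4 * R \<Longrightarrow> norm (\<Prod>i\<in>I. 1 - x i * z) \<le> exp a"
  shows "of_nat (card {i \<in> I. norm (x i) * R \<ge> 1}) \<le> a"
proof -
  let ?n = "card {i \<in> I. norm (x i) * R \<ge> 1}"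
  have "exp (of_nat ?n) = exp (1 :: real) ^ ?n" by (simp flip: exp_of_nat_mult)
  also have "\<dots> \<le> 3 ^ ?n" by (intro power_mono exp_le) auto
  also have "\<dots> \<le> exp a"
    using split_roots_bound[OF I R, of "4 * R" x "exp a" 0] bound R by simp
  finally show ?thesis by simp
qed

text \<open>The pairs are split into large \<open>x i\<close>, small \<open>x i\<close> with large
  \<open>y j\<close>, and both small. In the second class only the product over the small
  \<open>x i\<close> is at hand; \<open>split_roots_bound\<close> controls it on radii from 2 * R
  on, whence the maximum in the second sum. Its use at radius 2 * R also gives the bounds on the
  disc of radius \<open>R\<close> for the third class.\<close>

lemma product_roots_bound:
  fixes x :: "'i \<Rightarrow> complex" and y :: "'j \<Rightarrow> complex"
  assumes I: "finite I" and J: "finite J" and R: "R > 0"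
    and \<phi>: "\<And>z. norm (\<Prod>i\<in>I. 1 - x i * z) \<le> exp (\<phi> (norm z))"
    and \<psi>: "\<And>z. norm (\<Prod>j\<in>J. 1 - y j * z) \<le> exp (\<psi> (norm z))"
    and z: "8 * norm z \<le> R\<^sup>2"
  shows "norm (\<Prod>i\<in>I. \<Prod>j\<in>J. 1 - x i * y j * z) \<le>
    exp ((\<Sum>i\<in>{i \<in> I. norm (x i) * R \<ge> 1}. \<psi> (norm (x i) * norm z)) +
         (\<Sum>j\<in>{j \<in> J. norm (y j) * R \<ge> 1}. \<phi> (max (norm (y j) * norm z) (2 * R))) +
         8 * (\<phi> (2 * R) + 1) * (\<psi> (2 * R) + 1))"
proof -
  define I0 where "I0 = {i \<in> I. norm (x i) * R < 1}"
  define I1 where "I1 = {i \<in> I. norm (x i) * R \<ge> 1}"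
  define J0 where "J0 = {j \<in> J. norm (y j) * R < 1}"
  define J1 where "J1 = {j \<in> J. norm (y j) * R \<ge> 1}"
  have fin: "finite I0" "finite I1" "finite J0" "finite J1"
    and II: "I = I0 \<union> I1" "I0 \<inter> I1 = {}" and JJ: "J = J0 \<union> J1" "J0 \<inter> J1 = {}"
    using I J by (auto simp: I0_def I1_def J0_def J1_def)
  have small: "norm (\<Prod>i\<in>{i \<in> K. norm (t i) * R < 1}. 1 - t i * w) \<le> exp (\<theta> (max (norm w) (2 * R)))"
    if K: "finite K" and \<theta>: "\<And>z. norm (\<Prod>i\<in>K. 1 - t i * z) \<le> exp (\<theta> (norm z))"
    for K :: "'k set" and t :: "'k \<Rightarrow> complex" and \<theta> :: "real \<Rightarrow> real" and w
  proof -
    define s where "s = max (norm w) (2 * R)"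
    have s: "2 * R \<le> s" "norm w \<le> s" by (auto simp: s_def)
    have "norm (\<Prod>i\<in>{i \<in> K. norm (t i) * R < 1}. 1 - t i * w) * 1 \<le>
          norm (\<Prod>i\<in>{i \<in> K. norm (t i) * R < 1}. 1 - t i * w) *
          (s / R - 1) ^ card {i \<in> K. norm (t i) * R \<ge> 1}"
      using R s by (intro mult_left_mono one_le_power) (auto simp: field_simps)
    also have "\<dots> \<le> exp (\<theta> s)"
    proof (rule split_roots_bound[OF K R s(1)])
      show "norm (\<Prod>i\<in>K. 1 - t i * z) \<le> exp (\<theta> s)" if "norm z = s" for z
        using \<theta>[of z] that by simp
    qed (rule s(2))
    finally show ?thesis by (simp add: s_def)
  qed
  have hx: "norm (\<Prod>i\<in>I0. 1 - x i * w) \<le> exp (\<phi> (max (norm w) (2 * R)))" for w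
    unfolding I0_def by (rule small[OF I \<phi>])
  have hy: "norm (\<Prod>j\<in>J0. 1 - y j * w) \<le> exp (\<psi> (max (norm w) (2 * R)))" for w
    unfolding J0_def by (rule small[OF J \<psi>])
  \<comment> \<open>The summands 1 turn \<le> into the strict inequality that describes the
    half-plane in Borel-Caratheodory.\<close>
  have "norm (\<Prod>i\<in>I0. \<Prod>j\<in>J0. 1 - x i * y j * z) \<le> exp (8 * (\<phi> (2 * R) + 1) * (\<psi> (2 * R) + 1))"
  proof (rule small_roots_product_bound[OF fin(1,3) R _ _ _ _ z])
    fix w :: complex assume w: "norm w < R"
    hence max: "max (norm w) (2 * R) = 2 * R" using R by simp
    show "norm (\<Prod>i\<in>I0. 1 - x i * w) < exp (\<phi> (2 * R) + 1)"
      using hx[of w] unfolding max by (rule le_less_trans) simp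
    show "norm (\<Prod>j\<in>J0. 1 - y j * w) < exp (\<psi> (2 * R) + 1)"
      using hy[of w] unfolding max by (rule le_less_trans) simp
  qed (auto simp: I0_def J0_def)
  moreover have "norm (\<Prod>i\<in>I1. \<Prod>j\<in>J. 1 - x i * y j * z) \<le> exp (\<Sum>i\<in>I1. \<psi> (norm (x i) * norm z))"
  proof -
    have "(\<Prod>i\<in>I1. norm (\<Prod>j\<in>J. 1 - x i * y j * z)) \<le> (\<Prod>i\<in>I1. exp (\<psi> (norm (x i) * norm z)))"
    proof (intro prod_mono conjI norm_ge_zero)
      fix i
      show "norm (\<Prod>j\<in>J. 1 - x i * y j * z) \<le> exp (\<psi> (norm (x i) * norm z))"
        using \<psi>[of "x i * z"] by (simp add: norm_mult mult_ac)
    qed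
    thus ?thesis by (simp add: prod_norm exp_sum fin)
  qed
  moreover have "norm (\<Prod>i\<in>I0. \<Prod>j\<in>J1. 1 - x i * y j * z) \<le>
      exp (\<Sum>j\<in>J1. \<phi> (max (norm (y j) * norm z) (2 * R)))"
  proof -
    have "(\<Prod>j\<in>J1. norm (\<Prod>i\<in>I0. 1 - x i * y j * z)) \<le>
        (\<Prod>j\<in>J1. exp (\<phi> (max (norm (y j) * norm z) (2 * R))))"
    proof (intro prod_mono conjI norm_ge_zero)
      fix j
      show "norm (\<Prod>i\<in>I0. 1 - x i * y j * z) \<le> exp (\<phi> (max (norm (y j) * norm z) (2 * R)))"
        using hx[of "y j * z"] by (simp add: norm_mult mult_ac)
    qed
    thus ?thesis by (subst prod.swap) (simp add: prod_norm exp_sum fin)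
  qed
  moreover have "(\<Prod>i\<in>I. \<Prod>j\<in>J. 1 - x i * y j * z) =
      (\<Prod>i\<in>I1. \<Prod>j\<in>J. 1 - x i * y j * z) *
      ((\<Prod>i\<in>I0. \<Prod>j\<in>J1. 1 - x i * y j * z) * (\<Prod>i\<in>I0. \<Prod>j\<in>J0. 1 - x i * y j * z))"
  proof -
    have J_split: "(\<Prod>j\<in>J. 1 - x i * y j * z) =
        (\<Prod>j\<in>J1. 1 - x i * y j * z) * (\<Prod>j\<in>J0. 1 - x i * y j * z)" for i
      unfolding JJ(1) using fin JJ(2) by (subst prod.union_disjoint) auto
    have "(\<Prod>i\<in>I. \<Prod>j\<in>J. 1 - x i * y j * z) =
      (\<Prod>i\<in>I1. \<Prod>j\<in>J. 1 - x i * y j * z) * (\<Prod>i\<in>I0. \<Prod>j\<in>J. 1 - x i * y j * z)"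
      unfolding II(1) using fin II(2) by (subst prod.union_disjoint) auto
    also have "(\<Prod>i\<in>I0. \<Prod>j\<in>J. 1 - x i * y j * z) =
        (\<Prod>i\<in>I0. \<Prod>j\<in>J1. 1 - x i * y j * z) * (\<Prod>i\<in>I0. \<Prod>j\<in>J0. 1 - x i * y j * z)"
      by (simp only: J_split prod.distrib)
    finally show ?thesis .
  qed
  ultimately show ?thesis
    unfolding I1_def[symmetric] J1_def[symmetric]
    by (simp add: norm_mult exp_add mult.assoc mult_mono del: mult_exp_exp)
qed

text \<open>In decreasing order the k-th weight is at most K / k: take that weight itself for
  \<open>t\<close>. The induction removes a smallest weight, whose rank is the cardinality of
  \<open>I\<close>.\<close>

lemma sum_powr_of_count:
  fixes w :: "'i \<Rightarrow> real"
  assumes "finite I" "q > 1" "K \<ge> 0" "\<And>i. i \<in> I \<Longrightarrow> w i \<ge> 0"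
    and "\<And>t. t > 0 \<Longrightarrow> of_nat (card {i \<in> I. w i \<ge> t}) * t \<le> K"
  shows "(\<Sum>i\<in>I. w i powr q) \<le> (\<Sum>k=1..card I. (K / of_nat k) powr q)"
  using assms
proof (induction "card I" arbitrary: I)
  case 0
  thus ?case by simp
next
  case (Suc n)
  note I = Suc.prems(1) and w0 = Suc.prems(4) and count = Suc.prems(5)
  have "I \<noteq> {}" using Suc.hyps(2) by auto
  then obtain i where i: "i \<in> I" "\<And>j. j \<in> I \<Longrightarrow> w i \<le> w j"
    using ex_min_if_finite[of "w ` I"] I by (metis (no_types, lifting) arg_min_if_finite not_less)
  have n: "n = card (I - {i})" using Suc.hyps(2) I i(1) by simp
  have "(\<Sum>j\<in>I - {i}. w j powr q) \<le> (\<Sum>k=1..card (I - {i}). (K / of_nat k) powr q)"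
  proof (rule Suc.hyps(1)[OF n])
    fix t :: real assume t: "t > 0"
    have "card {j \<in> I - {i}. w j \<ge> t} \<le> card {j \<in> I. w j \<ge> t}"
      using I by (intro card_mono) auto
    hence "of_nat (card {j \<in> I - {i}. w j \<ge> t}) * t \<le> of_nat (card {j \<in> I. w j \<ge> t}) * t"
      using t by simp
    also have "\<dots> \<le> K" by (rule count[OF t])
    finally show "of_nat (card {j \<in> I - {i}. w j \<ge> t}) * t \<le> K" .
  qed (use Suc.prems in auto)
  moreover have "w i powr q \<le> (K / of_nat (Suc n)) powr q"
  proof (cases "w i > 0")
    case True
    have "{j \<in> I. w j \<ge> w i} = I" using i(2) by auto
    hence "of_nat (Suc n) * w i \<le> K" using count[OF True] Suc.hyps(2) by simp
    hence "w i \<le> K / of_nat (Suc n)" by (simp add: field_simps)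
    thus ?thesis using Suc.prems(2) True by (intro powr_mono2) auto
  next
    case False
    hence "w i = 0" using w0[OF i(1)] by simp
    thus ?thesis by simp
  qed
  moreover have "(\<Sum>j\<in>I. w j powr q) = w i powr q + (\<Sum>j\<in>I - {i}. w j powr q)"
    using I i(1) by (rule sum.remove)
  moreover have "(\<Sum>k=1..card I. (K / of_nat k) powr q) =
      (\<Sum>k=1..n. (K / of_nat k) powr q) + (K / of_nat (Suc n)) powr q"
    by (simp flip: Suc.hyps(2))
  ultimately show ?case using n by simp
qed

text \<open>\<open>T\<close> is K ^ q times the sum of the k ^ (- q), finite for q > 1. The families
  are quantified inside the conclusion because one \<open>T\<close> has to serve the roots for every
  \<open>n\<close>.\<close>

lemma sum_powr_of_count_bounded:
  fixes q K :: real
  assumes "q > 1" "K \<ge> 0"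
  obtains T where "T \<ge> 0"
    "\<forall>(I :: 'i set) (w :: 'i \<Rightarrow> real). finite I \<longrightarrow> (\<forall>i\<in>I. w i \<ge> 0) \<longrightarrow>
       (\<forall>t>0. of_nat (card {i \<in> I. w i \<ge> t}) * t \<le> K) \<longrightarrow> (\<Sum>i\<in>I. w i powr q) \<le> T"
proof -
  have sm: "summable (\<lambda>k. real k powr - q)"
    using assms(1) by (simp add: summable_real_powr_iff)
  define T where "T = K powr q * suminf (\<lambda>k. real k powr - q)"
  show ?thesis
  proof (rule that[of T])
    show "T \<ge> 0" unfolding T_def by (intro mult_nonneg_nonneg suminf_nonneg sm) auto
  next
    show "\<forall>(I :: 'i set) (w :: 'i \<Rightarrow> real). finite I \<longrightarrow> (\<forall>i\<in>I. w i \<ge> 0) \<longrightarrow>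
       (\<forall>t>0. of_nat (card {i \<in> I. w i \<ge> t}) * t \<le> K) \<longrightarrow> (\<Sum>i\<in>I. w i powr q) \<le> T"
    proof (intro allI impI)
      fix I :: "'i set" and w :: "'i \<Rightarrow> real"
      assume I: "finite I" "\<forall>i\<in>I. w i \<ge> 0"
        "\<forall>t>0. of_nat (card {i \<in> I. w i \<ge> t}) * t \<le> K"
      have "(\<Sum>i\<in>I. w i powr q) \<le> (\<Sum>k=1..card I. (K / of_nat k) powr q)"
        by (rule sum_powr_of_count[OF I(1) assms]) (use I(2,3) in auto)
      also have "\<dots> = K powr q * (\<Sum>k=1..card I. real k powr - q)"
        unfolding sum_distrib_left using assms
        by (intro sum.cong refl) (simp add: powr_divide powr_minus field_simps)
      also have "\<dots> \<le> T"
        unfolding T_def by (intro mult_left_mono sum_le_suminf sm) auto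
      finally show "(\<Sum>i\<in>I. w i powr q) \<le> T" .
    qed
  qed
qed

section \<open>Coefficients of ene products\<close>

text \<open>Dominates the Taylor polynomial on the circle of radius \<open>s\<close>, yet depends
  only on absolute values of coefficients: the function on the circle of radius 2 * s controls it
  for all \<open>n\<close> at once, and small changes of the coefficients change it little.\<close>

definition fps_majorant :: "nat \<Rightarrow> complex fps \<Rightarrow> real \<Rightarrow> real" where
  "fps_majorant n f s = (\<Sum>k\<le>n. norm (fps_nth f k) * s ^ k)"

lemma fps_majorant_ge_1:
  assumes "fps_nth f 0 = 1" "s \<ge> 0"
  shows "fps_majorant n f s \<ge> 1"
  using member_le_sum[of 0 "{..n}" "\<lambda>k. norm (fps_nth f k) * s ^ k"] assms
  by (simp add: fps_majorant_def)

lemma fps_majorant_mono: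
  assumes "0 \<le> s" "s \<le> t"
  shows "fps_majorant n f s \<le> fps_majorant n f t"
  unfolding fps_majorant_def using assms by (intro sum_mono mult_left_mono power_mono) auto

lemma fps_majorant_near_0:
  assumes "fps_nth f 0 = 1" "0 \<le> s" "s \<le> 1"
  shows "fps_majorant n f s \<le> 1 + s * fps_majorant n f 1"
proof -
  have "fps_majorant n f s \<le> (\<Sum>k\<le>n. (if k = 0 then 1 else 0) + s * norm (fps_nth f k))"
    unfolding fps_majorant_def
  proof (rule sum_mono)
    fix k
    show "norm (fps_nth f k) * s ^ k \<le> (if k = 0 then 1 else 0) + s * norm (fps_nth f k)"
    proof (cases k)
      case (Suc m)
      have "s ^ k \<le> s" using assms by (simp add: Suc mult_left_le power_le_one)
      hence "norm (fps_nth f k) * s ^ k \<le> norm (fps_nth f k) * s" by (intro mult_left_mono) auto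
      thus ?thesis using Suc by (simp add: mult.commute)
    qed (use assms in simp)
  qed
  also have "\<dots> = 1 + s * fps_majorant n f 1"
    by (simp add: sum.distrib fps_majorant_def sum_distrib_left)
  finally show ?thesis .
qed

lemma norm_truncation_le: "norm (\<Sum>k\<le>n. fps_nth f k * z ^ k) \<le> fps_majorant n f (norm z)"
  unfolding fps_majorant_def by (rule order_trans[OF norm_sum]) (simp add: norm_mult norm_power)

lemma ln_le_of_le_exp:
  fixes a :: real
  assumes "0 < a" "a \<le> exp b"
  shows "ln a \<le> b"
proof -
  have "ln a \<le> ln (exp b)" using assms by (subst ln_le_cancel_iff) auto
  thus ?thesis by simp
qed

text \<open>The roots are obtained once, before \<open>r\<close> and \<open>R\<close>: the growth
  estimate combines the coefficient bound at one threshold with counts at all others. The radius 4 *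
  R is that of \<open>card_large_roots_le\<close>.\<close>

lemma ene_nth_bound:
  fixes f g :: "complex fps"
  defines "\<phi> \<equiv> \<lambda>n s. ln (fps_majorant n f s)" and "\<psi> \<equiv> \<lambda>n s. ln (fps_majorant n g s)"
  assumes f0: "fps_nth f 0 = 1" and g0: "fps_nth g 0 = 1"
  obtains x y :: "nat \<Rightarrow> complex" where
    "\<And>R. R > 0 \<Longrightarrow> of_nat (card {i \<in> {1..n}. norm (x i) * R \<ge> 1}) \<le> \<phi> n (4 * R)"
    "\<And>R. R > 0 \<Longrightarrow> of_nat (card {j \<in> {1..n}. norm (y j) * R \<ge> 1}) \<le> \<psi> n (4 * R)"
    "\<And>r R. r > 0 \<Longrightarrow> R > 0 \<Longrightarrow> 8 * r \<le> R\<^sup>2 \<Longrightarrow> norm (fps_nth (ene f g) n) * r ^ n \<le>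
      exp ((\<Sum>i\<in>{i \<in> {1..n}. norm (x i) * R \<ge> 1}. \<psi> n (norm (x i) * r)) +
           (\<Sum>j\<in>{j \<in> {1..n}. norm (y j) * R \<ge> 1}. \<phi> n (max (norm (y j) * r) (2 * R))) +
           8 * (\<phi> n (2 * R) + 1) * (\<psi> n (2 * R) + 1))"
proof -
  obtain x y :: "nat \<Rightarrow> complex" where
    x: "\<And>z. (\<Prod>i\<in>{1..n}. 1 - x i * z) = (\<Sum>k\<le>n. fps_nth f k * z ^ k)" and
    y: "\<And>z. (\<Prod>j\<in>{1..n}. 1 - y j * z) = (\<Sum>k\<le>n. fps_nth g k * z ^ k)" and
    c: "fps_nth (ene f g) n = Polynomial.coeff (\<Prod>(i, j)\<in>{1..n} \<times> {1..n}. [:1, - (x i * y j):]) n"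
    by (rule ene_nth_roots[OF f0 g0, where n = n]) (rule that)
  have exp_phi: "exp (\<phi> n (norm z)) = fps_majorant n f (norm z)" for z :: complex
    using fps_majorant_ge_1[OF f0, of "norm z" n] by (simp add: \<phi>_def)
  have exp_psi: "exp (\<psi> n (norm z)) = fps_majorant n g (norm z)" for z :: complex
    using fps_majorant_ge_1[OF g0, of "norm z" n] by (simp add: \<psi>_def)
  have bx: "norm (\<Prod>i\<in>{1..n}. 1 - x i * z) \<le> exp (\<phi> n (norm z))" for z
    unfolding x exp_phi by (rule norm_truncation_le)
  have yb: "norm (\<Prod>j\<in>{1..n}. 1 - y j * z) \<le> exp (\<psi> n (norm z))" for z
    unfolding y exp_psi by (rule norm_truncation_le)
  show ?thesis
  proof (rule that[of x y])
    fix R :: real assume R: "R > 0"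
    show "of_nat (card {i \<in> {1..n}. norm (x i) * R \<ge> 1}) \<le> \<phi> n (4 * R)"
      by (rule card_large_roots_le[OF _ R]) (simp, metis bx)
    show "of_nat (card {j \<in> {1..n}. norm (y j) * R \<ge> 1}) \<le> \<psi> n (4 * R)"
      by (rule card_large_roots_le[OF _ R]) (simp, metis yb)
  next
    fix r R :: real assume r: "r > 0" and R: "R > 0" and rR: "8 * r \<le> R\<^sup>2"
    show "norm (fps_nth (ene f g) n) * r ^ n \<le>
      exp ((\<Sum>i\<in>{i \<in> {1..n}. norm (x i) * R \<ge> 1}. \<psi> n (norm (x i) * r)) +
           (\<Sum>j\<in>{j \<in> {1..n}. norm (y j) * R \<ge> 1}. \<phi> n (max (norm (y j) * r) (2 * R))) +
           8 * (\<phi> n (2 * R) + 1) * (\<psi> n (2 * R) + 1))"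
      unfolding c
    proof (rule poly_coeff_cauchy_bound[OF r])
      fix z :: complex assume z: "norm z = r"
      have "poly (\<Prod>(i, j)\<in>{1..n} \<times> {1..n}. [:1, - (x i * y j):]) z =
          (\<Prod>i\<in>{1..n}. \<Prod>j\<in>{1..n}. 1 - x i * y j * z)"
        by (simp add: poly_prod prod.cartesian_product case_prod_unfold mult_ac)
      thus "norm (poly (\<Prod>(i, j)\<in>{1..n} \<times> {1..n}. [:1, - (x i * y j):]) z) \<le>
        exp ((\<Sum>i\<in>{i \<in> {1..n}. norm (x i) * R \<ge> 1}. \<psi> n (norm (x i) * r)) +
           (\<Sum>j\<in>{j \<in> {1..n}. norm (y j) * R \<ge> 1}. \<phi> n (max (norm (y j) * r) (2 * R))) +
           8 * (\<phi> n (2 * R) + 1) * (\<psi> n (2 * R) + 1))"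
        using product_roots_bound[OF _ _ R bx yb, of z] rR by (simp add: z)
    qed
  qed
qed

text \<open>At radius s = 1 / (2 * M) the majorant is at most 3 / 2, so the number of roots with
  \<bar>x i\<bar> \<ge> 4 / s = 8 * M is at most 1 / 2, hence zero.\<close>

lemma root_bound_of_count:
  fixes x :: "nat \<Rightarrow> complex"
  assumes count: "\<And>R. R > 0 \<Longrightarrow>
      of_nat (card {i \<in> {1..n}. norm (x i) * R \<ge> 1}) \<le> ln (fps_majorant n f (4 * R))"
    and f0: "fps_nth f 0 = 1" and M: "fps_majorant n f 1 \<le> M" and i: "i \<in> {1..n}"
  shows "norm (x i) < 8 * M"
proof -
  have M1: "M \<ge> 1" using M fps_majorant_ge_1[OF f0, of 1 n] by simp
  define s where "s = 1 / (2 * M)"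
  have s: "0 < s" "s \<le> 1" using M1 by (auto simp: s_def)
  have "fps_majorant n f s \<le> 1 + s * M"
    using fps_majorant_near_0[OF f0, of s n] s mult_left_mono[OF M, of s] by linarith
  also have "s * M = 1 / 2" using M1 by (simp add: s_def)
  finally have "ln (fps_majorant n f s) \<le> 1 / 2"
    using ln_le_minus_one[of "fps_majorant n f s"] fps_majorant_ge_1[OF f0, of s n] s by simp
  moreover have "of_nat (card {i \<in> {1..n}. norm (x i) * (s / 4) \<ge> 1}) \<le> ln (fps_majorant n f s)"
    using count[of "s / 4"] s by simp
  ultimately have "real (card {i \<in> {1..n}. norm (x i) * (s / 4) \<ge> 1}) < 1" by linarith
  hence "{i \<in> {1..n}. norm (x i) * (s / 4) \<ge> 1} = {}" by simp
  hence "\<not> norm (x i) * (s / 4) \<ge> 1" using i by blast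
  thus ?thesis using M1 by (simp add: s_def field_simps)
qed

text \<open>\<open>S\<close> lies beyond every radius at which a majorant is evaluated: 4 * R for
  the counts, and 8 * M * r because all roots are below 8 * M. The three exponents are at most K^2,
  K^2 and 8 * (K + 1)^2, whence the constant 10. The bound aims at local uniformity in
  \<open>f\<close> and \<open>g\<close>.\<close>

lemma ene_nth_bound_crude:
  assumes f0: "fps_nth f 0 = 1" and g0: "fps_nth g 0 = 1" and r: "r > 0"
    and M: "fps_majorant n f 1 \<le> M" "fps_majorant n g 1 \<le> M"
    and S: "4 * sqrt (8 * r) \<le> S" "8 * M * r \<le> S"
    and K: "fps_majorant n f S \<le> exp K" "fps_majorant n g S \<le> exp K"
  shows "norm (fps_nth (ene f g) n) * r ^ n \<le> exp (10 * (K + 1)\<^sup>2)"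
proof -
  define R where "R = sqrt (8 * r)"
  have R: "R > 0" "8 * r \<le> R\<^sup>2" "4 * R \<le> S" using r S by (auto simp: R_def)
  obtain x y :: "nat \<Rightarrow> complex" where
    cx: "\<And>R. R > 0 \<Longrightarrow>
      of_nat (card {i \<in> {1..n}. norm (x i) * R \<ge> 1}) \<le> ln (fps_majorant n f (4 * R))" and
    cy: "\<And>R. R > 0 \<Longrightarrow>
      of_nat (card {j \<in> {1..n}. norm (y j) * R \<ge> 1}) \<le> ln (fps_majorant n g (4 * R))" and
    bound: "\<And>r R. r > 0 \<Longrightarrow> R > 0 \<Longrightarrow> 8 * r \<le> R\<^sup>2 \<Longrightarrow> norm (fps_nth (ene f g) n) * r ^ n \<le>
      exp ((\<Sum>i\<in>{i \<in> {1..n}. norm (x i) * R \<ge> 1}. ln (fps_majorant n g (norm (x i) * r))) +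
           (\<Sum>j\<in>{j \<in> {1..n}. norm (y j) * R \<ge> 1}. ln (fps_majorant n f (max (norm (y j) * r) (2 * R)))) +
           8 * (ln (fps_majorant n f (2 * R)) + 1) * (ln (fps_majorant n g (2 * R)) + 1))"
    by (rule ene_nth_bound[OF f0 g0, where n = n]) (rule that)
  have le_K: "0 \<le> ln (fps_majorant n h s)" "ln (fps_majorant n h s) \<le> K"
    if h: "fps_nth h 0 = 1" "fps_majorant n h S \<le> exp K" and s: "0 \<le> s" "s \<le> S" for h s
  proof -
    show "0 \<le> ln (fps_majorant n h s)" using fps_majorant_ge_1[OF h(1) s(1)] by simp
    have "fps_majorant n h s \<le> exp K" using fps_majorant_mono[OF s] h(2) by (rule order_trans)
    thus "ln (fps_majorant n h s) \<le> K"
      using fps_majorant_ge_1[OF h(1) s(1), of n] by (intro ln_le_of_le_exp) auto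
  qed
  have "0 \<le> S" using R by linarith
  hence K0: "K \<ge> 0" using order_trans[OF le_K[OF f0 K(1)]] by blast
  have in_range: "norm (x i) * r \<le> S" "norm (y i) * r \<le> S" if "i \<in> {1..n}" for i
  proof -
    have "norm (x i) * r \<le> 8 * M * r" "norm (y i) * r \<le> 8 * M * r"
      using root_bound_of_count[OF cx f0 M(1) that] root_bound_of_count[OF cy g0 M(2) that] r
      by (auto intro!: mult_right_mono)
    thus "norm (x i) * r \<le> S" "norm (y i) * r \<le> S" using S by auto
  qed
  have "(\<Sum>i\<in>{i \<in> {1..n}. norm (x i) * R \<ge> 1}. ln (fps_majorant n g (norm (x i) * r))) \<le>
      of_nat (card {i \<in> {1..n}. norm (x i) * R \<ge> 1}) * K"
    using in_range r by (intro sum_bounded_above le_K[OF g0 K(2)]) auto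
  also have "\<dots> \<le> K * K"
    using order_trans[OF cx[OF R(1)] le_K(2)[OF f0 K(1)]] R K0 by (intro mult_right_mono) auto
  finally have 1: "(\<Sum>i\<in>{i \<in> {1..n}. norm (x i) * R \<ge> 1}. ln (fps_majorant n g (norm (x i) * r))) \<le> K * K" .
  have "(\<Sum>j\<in>{j \<in> {1..n}. norm (y j) * R \<ge> 1}. ln (fps_majorant n f (max (norm (y j) * r) (2 * R)))) \<le>
      of_nat (card {j \<in> {1..n}. norm (y j) * R \<ge> 1}) * K"
    using in_range r R by (intro sum_bounded_above le_K[OF f0 K(1)]) auto
  also have "\<dots> \<le> K * K"
    using order_trans[OF cy[OF R(1)] le_K(2)[OF g0 K(2)]] R K0 by (intro mult_right_mono) auto
  finally have 2: "(\<Sum>j\<in>{j \<in> {1..n}. norm (y j) * R \<ge> 1}.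
      ln (fps_majorant n f (max (norm (y j) * r) (2 * R)))) \<le> K * K" .
  have 3: "8 * (ln (fps_majorant n f (2 * R)) + 1) * (ln (fps_majorant n g (2 * R)) + 1) \<le>
      8 * (K + 1) * (K + 1)"
    using le_K[OF f0 K(1), of "2 * R"] le_K[OF g0 K(2), of "2 * R"] R K0
    by (intro mult_mono) auto
  have "K * K \<le> (K + 1)\<^sup>2" using K0 by (simp add: power2_eq_square algebra_simps)
  moreover have "8 * (K + 1) * (K + 1) = 8 * (K + 1)\<^sup>2" by (simp add: power2_eq_square)
  ultimately show ?thesis
    using bound[OF r R(1,2)] 1 2 3 by (elim order_trans) simp
qed

section \<open>Growth of the coefficients of an ene product\<close>

lemma powr_le_one_plus_powr:
  fixes t :: real
  assumes "0 \<le> t" "\<mu> \<le> \<nu>" "0 \<le> \<mu>"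
  shows "t powr \<mu> \<le> 1 + t powr \<nu>"
proof (cases "t \<le> 1")
  case True
  hence "t powr \<mu> \<le> 1" using assms by (simp add: powr_le1)
  also have "1 \<le> 1 + t powr \<nu>" by simp
  finally show ?thesis .
next
  case False
  hence "t powr \<mu> \<le> t powr \<nu>" using assms by (intro powr_mono) auto
  thus ?thesis by simp
qed

text \<open>The count of roots bounds the sum of the \<bar>x i\<bar> ^ \<nu> uniformly in
  \<open>n\<close> as soon as \<nu> > \<mu>; this is where the exponent grows. The terms that
  involve only counts and the radius 2 * R are at most quadratic in r ^ (\<mu> / 2).\<close>

lemma ene_nth_growth:
  fixes f g :: "complex fps"
  assumes f0: "fps_nth f 0 = 1" and g0: "fps_nth g 0 = 1"
    and \<mu>: "0 < \<mu>" "\<mu> < \<nu>" and C: "C \<ge> 0"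
    and gf: "\<And>n s. s \<ge> 0 \<Longrightarrow> fps_majorant n f s \<le> exp (C * (1 + s powr \<mu>))"
    and gg: "\<And>n s. s \<ge> 0 \<Longrightarrow> fps_majorant n g s \<le> exp (C * (1 + s powr \<mu>))"
  obtains C' where "C' \<ge> 0"
    "\<And>n r. r \<ge> 1 \<Longrightarrow> norm (fps_nth (ene f g) n) * r ^ n \<le> exp (C' * r powr \<nu>)"
proof -
  \<comment> \<open>The majorants at radius 1 are at most exp (C * (1 + 1)), so all roots are below
    \<open>D\<close>.\<close>
  define M where "M = exp (2 * C)"
  define D where "D = 8 * M"
  have D: "D > 0" by (simp add: D_def M_def)
  \<comment> \<open>Bounds t times the number of roots with \<bar>x i\<bar> ^ \<mu> \<ge> t: the
    count is at most C * (1 + 4 ^ \<mu> / t), and there is no such root once t > D ^ \<mu>.\<close>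
  define K where "K = C * (D powr \<mu> + 4 powr \<mu>)"
  have K: "K \<ge> 0" using C by (simp add: K_def)
  define q where "q = \<nu> / \<mu>"
  have q: "q > 1" using \<mu> by (simp add: q_def)
  obtain T where T: "T \<ge> 0" and T_sum: "\<forall>(I :: nat set) (w :: nat \<Rightarrow> real). finite I \<longrightarrow> (\<forall>i\<in>I. w i \<ge> 0) \<longrightarrow>
       (\<forall>t>0. of_nat (card {i \<in> I. w i \<ge> t}) * t \<le> K) \<longrightarrow> (\<Sum>i\<in>I. w i powr q) \<le> T"
    by (rule sum_powr_of_count_bounded[OF q K]) (rule that)
  define k where "k = (4 * sqrt 8) powr \<mu>"
  have k: "k \<ge> 0" by (simp add: k_def)
  define a where "a = C * (1 + k)"
  have a: "a \<ge> 0" using C k by (simp add: a_def)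
  define C' where "C' = 4 * C * a + 2 * C * T + C * k * a + 8 * (a + 1)\<^sup>2"
  have ln_le: "ln (fps_majorant n h s) \<le> C * (1 + s powr \<mu>)"
    if "fps_nth h 0 = 1" "\<And>n s. s \<ge> 0 \<Longrightarrow> fps_majorant n h s \<le> exp (C * (1 + s powr \<mu>))" "s \<ge> 0"
    for n h s
    using fps_majorant_ge_1[OF that(1,3), of n] that(2)[OF that(3), of n]
    by (intro ln_le_of_le_exp) auto
  have ln_f: "ln (fps_majorant n f s) \<le> C * (1 + s powr \<mu>)"
    and ln_g: "ln (fps_majorant n g s) \<le> C * (1 + s powr \<mu>)" if "s \<ge> 0" for n s
    by (rule ln_le; use f0 g0 gf gg that in simp)+
  have sum_roots: "(\<Sum>i\<in>{1..n}. norm (x i) powr \<nu>) \<le> T"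
    if h: "fps_nth h 0 = 1" "\<And>n s. s \<ge> 0 \<Longrightarrow> fps_majorant n h s \<le> exp (C * (1 + s powr \<mu>))"
      and cx: "\<And>R. R > 0 \<Longrightarrow>
        of_nat (card {i \<in> {1..n}. norm (x i) * R \<ge> 1}) \<le> ln (fps_majorant n h (4 * R))"
    for n h and x :: "nat \<Rightarrow> complex"
  proof -
    have root: "norm (x i) < D" if "i \<in> {1..n}" for i
      unfolding D_def
    proof (rule root_bound_of_count[OF cx h(1) _ that])
      show "fps_majorant n h 1 \<le> M" using h(2)[of 1 n] by (simp add: M_def mult.commute)
    qed
    have "(\<Sum>i\<in>{1..n}. (norm (x i) powr \<mu>) powr q) \<le> T"
    proof (rule T_sum[rule_format])
      fix t :: real assume t: "t > 0"
      show "of_nat (card {i \<in> {1..n}. t \<le> norm (x i) powr \<mu>}) * t \<le> K"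
      proof (cases "t \<le> D powr \<mu>")
        case True
        define s where "s = t powr (1 / \<mu>)"
        have s: "s > 0" "s powr \<mu> = t" using t \<mu> by (auto simp: s_def powr_powr)
        have "{i \<in> {1..n}. t \<le> norm (x i) powr \<mu>} \<subseteq> {i \<in> {1..n}. norm (x i) * (1 / s) \<ge> 1}"
        proof safe
          fix i assume "t \<le> norm (x i) powr \<mu>"
          hence "s powr \<mu> \<le> norm (x i) powr \<mu>" using s by simp
          hence "s \<le> norm (x i)" using powr_less_mono2[of \<mu> "norm (x i)" s] \<mu> by (force simp: not_le[symmetric])
          thus "norm (x i) * (1 / s) \<ge> 1" using s by (simp add: field_simps)
        qed
        hence "card {i \<in> {1..n}. t \<le> norm (x i) powr \<mu>} \<le> card {i \<in> {1..n}. norm (x i) * (1 / s) \<ge> 1}"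
          by (intro card_mono) auto
        hence "real (card {i \<in> {1..n}. t \<le> norm (x i) powr \<mu>}) \<le> ln (fps_majorant n h (4 * (1 / s)))"
          using cx[of "1 / s"] s by simp
        also have "\<dots> \<le> C * (1 + (4 * (1 / s)) powr \<mu>)"
          by (rule ln_le[OF h]) (use s in auto)
        also have "(4 * (1 / s)) powr \<mu> = 4 powr \<mu> / t" using s by (simp add: powr_divide)
        finally have "real (card {i \<in> {1..n}. t \<le> norm (x i) powr \<mu>}) * t \<le> C * (1 + 4 powr \<mu> / t) * t"
          using t by (intro mult_right_mono) auto
        also have "\<dots> = C * (t + 4 powr \<mu>)" using t by (simp add: mult.assoc distrib_right)
        also have "\<dots> \<le> K" unfolding K_def using True C by (intro mult_left_mono) auto
        finally show ?thesis .
      next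
        case False
        have "\<not> t \<le> norm (x i) powr \<mu>" if "i \<in> {1..n}" for i
          using False powr_mono2[of \<mu> "norm (x i)" D] root[OF that] \<mu> by simp
        hence none: "{i \<in> {1..n}. t \<le> norm (x i) powr \<mu>} = {}" by blast
        show ?thesis unfolding none using K by simp
      qed
    qed auto
    thus ?thesis using \<mu> by (simp add: powr_powr q_def)
  qed
  show ?thesis
  proof (rule that[of C'])
    show "C' \<ge> 0" using C a k T by (simp add: C'_def)
    fix n :: nat and r :: real assume r: "r \<ge> 1"
    obtain x y :: "nat \<Rightarrow> complex" where
      cx: "\<And>R. R > 0 \<Longrightarrow>
        of_nat (card {i \<in> {1..n}. norm (x i) * R \<ge> 1}) \<le> ln (fps_majorant n f (4 * R))" and
      cy: "\<And>R. R > 0 \<Longrightarrow>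
        of_nat (card {j \<in> {1..n}. norm (y j) * R \<ge> 1}) \<le> ln (fps_majorant n g (4 * R))" and
      bound: "\<And>r R. r > 0 \<Longrightarrow> R > 0 \<Longrightarrow> 8 * r \<le> R\<^sup>2 \<Longrightarrow> norm (fps_nth (ene f g) n) * r ^ n \<le>
        exp ((\<Sum>i\<in>{i \<in> {1..n}. norm (x i) * R \<ge> 1}. ln (fps_majorant n g (norm (x i) * r))) +
           (\<Sum>j\<in>{j \<in> {1..n}. norm (y j) * R \<ge> 1}. ln (fps_majorant n f (max (norm (y j) * r) (2 * R)))) +
           8 * (ln (fps_majorant n f (2 * R)) + 1) * (ln (fps_majorant n g (2 * R)) + 1))"
      by (rule ene_nth_bound[OF f0 g0, where n = n]) (rule that)
    define R where "R = sqrt (8 * r)"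
    have R: "R > 0" "8 * r \<le> R\<^sup>2" using r by (auto simp: R_def)
    \<comment> \<open>\<open>R\<close> is of size sqrt r, so the counts of large roots and the
      logarithms of the majorants at 2 * R are of size \<open>u\<close>.\<close>
    define u where "u = r powr (\<mu> / 2)"
    have u: "u \<ge> 1" using r \<mu> by (simp add: u_def ge_one_powr_ge_zero)
    define v where "v = r powr \<nu>"
    have "u\<^sup>2 = r powr \<mu>" using r by (simp add: u_def power2_eq_square flip: powr_add)
    also have "\<dots> \<le> v" unfolding v_def using r \<mu> by (intro powr_mono) auto
    finally have uv: "u\<^sup>2 \<le> v" .
    have u2: "u \<le> u\<^sup>2" using u by (simp add: power2_eq_square)
    have "(4 * R) powr \<mu> = k * sqrt r powr \<mu>"
      using r by (simp add: R_def k_def real_sqrt_mult powr_mult mult_ac)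
    also have "sqrt r powr \<mu> = u" using r by (simp add: u_def powr_half_sqrt[symmetric] powr_powr)
    finally have R4: "(4 * R) powr \<mu> = k * u" .
    have R2: "(2 * R) powr \<mu> \<le> k * u" using R R4 \<mu> powr_mono2[of \<mu> "2 * R" "4 * R"] by simp
    have au: "C * (1 + s powr \<mu>) \<le> a * u" if "s powr \<mu> \<le> k * u" for s
    proof -
      have "1 + s powr \<mu> \<le> (1 + k) * u" using that u by (simp add: algebra_simps)
      thus ?thesis unfolding a_def mult.assoc using C by (intro mult_left_mono)
    qed
    define N where "N = (\<lambda>x :: nat \<Rightarrow> complex. of_nat (card {i \<in> {1..n}. norm (x i) * R \<ge> 1}) :: real)"
    have Nx: "N x \<le> a * u"
    proof -
      have "N x \<le> ln (fps_majorant n f (4 * R))" unfolding N_def by (rule cx[OF R(1)])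
      also have "\<dots> \<le> C * (1 + (4 * R) powr \<mu>)" by (rule ln_f) (use R(1) in simp)
      also have "\<dots> \<le> a * u" by (rule au) (simp only: R4 order_refl)
      finally show ?thesis .
    qed
    have Ny: "N y \<le> a * u"
    proof -
      have "N y \<le> ln (fps_majorant n g (4 * R))" unfolding N_def by (rule cy[OF R(1)])
      also have "\<dots> \<le> C * (1 + (4 * R) powr \<mu>)" by (rule ln_g) (use R(1) in simp)
      also have "\<dots> \<le> a * u" by (rule au) (simp only: R4 order_refl)
      finally show ?thesis .
    qed
    have Tx: "(\<Sum>i\<in>{1..n}. norm (x i) powr \<nu>) \<le> T"
      by (rule sum_roots[OF f0 _ cx]) (rule gf)
    have Ty: "(\<Sum>j\<in>{1..n}. norm (y j) powr \<nu>) \<le> T"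
      by (rule sum_roots[OF g0 _ cy]) (rule gg)
    \<comment> \<open>The exponent is raised from \<mu> to \<nu> so that the sum over the large
      roots is bounded by \<open>T\<close>.\<close>
    have summand: "C * (1 + (norm w * r) powr \<mu>) \<le> 2 * C + C * v * norm w powr \<nu>" for w :: complex
    proof -
      have "(norm w * r) powr \<mu> \<le> 1 + (norm w * r) powr \<nu>"
        using \<mu> r by (intro powr_le_one_plus_powr) auto
      also have "(norm w * r) powr \<nu> = v * norm w powr \<nu>"
        using r by (simp add: powr_mult v_def)
      finally have "C * (1 + (norm w * r) powr \<mu>) \<le> C * (1 + (1 + v * norm w powr \<nu>))"
        using C by (intro mult_left_mono) auto
      thus ?thesis by (simp add: algebra_simps)
    qed
    have sub_sum: "(\<Sum>i\<in>{i \<in> {1..n}. norm (w i) * R \<ge> 1}. norm (w i) powr \<nu>) \<le> T"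
      if "(\<Sum>i\<in>{1..n}. norm (w i) powr \<nu>) \<le> T" for w :: "nat \<Rightarrow> complex"
      by (rule order_trans[OF sum_mono2 that]) auto
    have v0: "v \<ge> 0" by (simp add: v_def)
    have "(\<Sum>i\<in>{i \<in> {1..n}. norm (x i) * R \<ge> 1}. ln (fps_majorant n g (norm (x i) * r))) \<le>
        (\<Sum>i\<in>{i \<in> {1..n}. norm (x i) * R \<ge> 1}. 2 * C + C * v * norm (x i) powr \<nu>)"
      using r by (intro sum_mono order_trans[OF ln_g summand]) auto
    also have "\<dots> = 2 * C * N x + C * v * (\<Sum>i\<in>{i \<in> {1..n}. norm (x i) * R \<ge> 1}. norm (x i) powr \<nu>)"
      by (simp add: sum.distrib N_def sum_distrib_left)
    also have "\<dots> \<le> 2 * C * (a * u) + C * v * T"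
      using Nx C v0 sub_sum[OF Tx] by (intro add_mono mult_left_mono) auto
    finally have 1: "(\<Sum>i\<in>{i \<in> {1..n}. norm (x i) * R \<ge> 1}. ln (fps_majorant n g (norm (x i) * r))) \<le>
        2 * C * (a * u) + C * v * T" .
    have "(\<Sum>j\<in>{j \<in> {1..n}. norm (y j) * R \<ge> 1}. ln (fps_majorant n f (max (norm (y j) * r) (2 * R)))) \<le>
        (\<Sum>j\<in>{j \<in> {1..n}. norm (y j) * R \<ge> 1}. 2 * C + C * k * u + C * v * norm (y j) powr \<nu>)"
    proof (rule sum_mono)
      fix j
      have "ln (fps_majorant n f (max (norm (y j) * r) (2 * R))) \<le>
          C * (1 + (max (norm (y j) * r) (2 * R)) powr \<mu>)"
        by (rule ln_f) (use r R(1) in \<open>auto simp: max_def\<close>)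
      also have "\<dots> \<le> C * (1 + (norm (y j) * r) powr \<mu>) + C * (k * u)"
        unfolding distrib_left[symmetric]
      proof (rule mult_left_mono[OF _ C])
        show "1 + (max (norm (y j) * r) (2 * R)) powr \<mu> \<le> 1 + (norm (y j) * r) powr \<mu> + k * u"
          using R2 k u by (auto simp: max_def intro: add_increasing)
      qed
      also have "\<dots> \<le> 2 * C + C * v * norm (y j) powr \<nu> + C * (k * u)"
        using summand[of "y j"] by simp
      finally show "ln (fps_majorant n f (max (norm (y j) * r) (2 * R))) \<le>
          2 * C + C * k * u + C * v * norm (y j) powr \<nu>" by (simp add: algebra_simps)
    qed
    also have "\<dots> = (2 * C + C * k * u) * N y + C * v * (\<Sum>j\<in>{j \<in> {1..n}. norm (y j) * R \<ge> 1}. norm (y j) powr \<nu>)"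
      by (simp add: sum.distrib N_def sum_distrib_left)
    also have "\<dots> \<le> (2 * C + C * k * u) * (a * u) + C * v * T"
      using Ny C v0 k u sub_sum[OF Ty] by (intro add_mono mult_left_mono) auto
    finally have 2: "(\<Sum>j\<in>{j \<in> {1..n}. norm (y j) * R \<ge> 1}.
        ln (fps_majorant n f (max (norm (y j) * r) (2 * R)))) \<le> (2 * C + C * k * u) * (a * u) + C * v * T" .
    have ln_ge: "ln (fps_majorant n h (2 * R)) \<ge> 0" if "fps_nth h 0 = 1" for h
      using fps_majorant_ge_1[OF that, of "2 * R" n] R(1) by simp
    have "0 \<le> 2 * R" using R(1) by simp
    hence ln_2R: "ln (fps_majorant n f (2 * R)) \<le> a * u" "ln (fps_majorant n g (2 * R)) \<le> a * u"
      by (rule order_trans[OF ln_f au[OF R2]] order_trans[OF ln_g au[OF R2]])+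
    have "8 * (ln (fps_majorant n f (2 * R)) + 1) * (ln (fps_majorant n g (2 * R)) + 1) \<le>
        8 * (a * u + 1) * (a * u + 1)"
      using ln_2R ln_ge[OF f0] ln_ge[OF g0] by (intro mult_mono) auto
    also have "\<dots> \<le> 8 * ((a + 1) * u) * ((a + 1) * u)"
      using a u by (intro mult_mono) (auto simp: algebra_simps)
    also have "\<dots> = 8 * (a + 1)\<^sup>2 * u\<^sup>2" by (simp add: power2_eq_square)
    finally have 3: "8 * (ln (fps_majorant n f (2 * R)) + 1) * (ln (fps_majorant n g (2 * R)) + 1) \<le>
        8 * (a + 1)\<^sup>2 * u\<^sup>2" .
    have "4 * C * a * u \<le> 4 * C * a * v"
      using C a u2 uv by (intro mult_left_mono) auto
    moreover have "C * k * a * u\<^sup>2 \<le> C * k * a * v" "8 * (a + 1)\<^sup>2 * u\<^sup>2 \<le> 8 * (a + 1)\<^sup>2 * v"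
      using C a k uv by (intro mult_left_mono; simp)+
    moreover have "C' * v = 4 * C * a * v + 2 * C * T * v + C * k * a * v + 8 * (a + 1)\<^sup>2 * v"
      by (simp add: C'_def algebra_simps)
    moreover have "2 * C * (a * u) + C * v * T + ((2 * C + C * k * u) * (a * u) + C * v * T) =
        4 * C * a * u + 2 * C * T * v + C * k * a * u\<^sup>2"
      by (simp add: algebra_simps power2_eq_square)
    ultimately have "(\<Sum>i\<in>{i \<in> {1..n}. norm (x i) * R \<ge> 1}. ln (fps_majorant n g (norm (x i) * r))) +
           (\<Sum>j\<in>{j \<in> {1..n}. norm (y j) * R \<ge> 1}. ln (fps_majorant n f (max (norm (y j) * r) (2 * R)))) +
           8 * (ln (fps_majorant n f (2 * R)) + 1) * (ln (fps_majorant n g (2 * R)) + 1) \<le> C' * v"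
      using 1 2 3 by linarith
    hence "exp ((\<Sum>i\<in>{i \<in> {1..n}. norm (x i) * R \<ge> 1}. ln (fps_majorant n g (norm (x i) * r))) +
           (\<Sum>j\<in>{j \<in> {1..n}. norm (y j) * R \<ge> 1}. ln (fps_majorant n f (max (norm (y j) * r) (2 * R)))) +
           8 * (ln (fps_majorant n f (2 * R)) + 1) * (ln (fps_majorant n g (2 * R)) + 1)) \<le> exp (C' * v)"
      by (simp only: exp_le_cancel_iff)
    moreover have "r > 0" using r by simp
    ultimately show "norm (fps_nth (ene f g) n) * r ^ n \<le> exp (C' * r powr \<nu>)"
      using bound[of r R] R unfolding v_def[symmetric] by (meson order_trans)
  qed
qed

section \<open>Growth and order\<close>

text \<open>The summand 1 takes care of small \<open>s\<close>. Bounding all truncations at once is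
  the form in which the coefficient estimates use growth; \<open>fps_growth_iff\<close> compares it
  with the modulus of the function.\<close>

definition fps_growth :: "real \<Rightarrow> complex fps \<Rightarrow> bool" where
  "fps_growth \<mu> f \<longleftrightarrow> (\<exists>C\<ge>0. \<forall>n. \<forall>s\<ge>0. fps_majorant n f s \<le> exp (C * (1 + s powr \<mu>)))"

text \<open>Going from radius \<open>r\<close> to half of it turns a bound for each coefficient into
  a geometric series with sum 2 * B, uniformly in \<open>n\<close>.\<close>

lemma fps_majorant_le_of_coeffs:
  assumes B: "\<And>k. norm (fps_nth f k) * r ^ k \<le> B" and s: "0 \<le> s" "2 * s \<le> r" "r > 0"
  shows "fps_majorant n f s \<le> 2 * B"
proof -
  have B0: "B \<ge> 0" using order_trans[OF norm_ge_zero] B[of 0] by simp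
  have "fps_majorant n f s \<le> (\<Sum>k\<le>n. B * (1 / 2) ^ k)"
    unfolding fps_majorant_def
  proof (rule sum_mono)
    fix k
    have "norm (fps_nth f k) * s ^ k \<le> norm (fps_nth f k) * (r * (1 / 2)) ^ k"
      using s by (intro mult_left_mono power_mono) auto
    also have "\<dots> = norm (fps_nth f k) * r ^ k * (1 / 2) ^ k"
      by (simp only: power_mult_distrib mult.assoc)
    also have "\<dots> \<le> B * (1 / 2) ^ k" using B[of k] by (intro mult_right_mono) auto
    finally show "norm (fps_nth f k) * s ^ k \<le> B * (1 / 2) ^ k" .
  qed
  also have "\<dots> = B * (\<Sum>k\<le>n. (1 / 2) ^ k)" by (simp add: sum_distrib_left)
  also have "\<dots> \<le> B * 2"
  proof (intro mult_left_mono B0)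
    have "(\<Sum>k\<le>n. (1 / 2) ^ k) \<le> suminf (\<lambda>k. (1 / 2 :: real) ^ k)"
      by (intro sum_le_suminf summable_geometric) auto
    also have "\<dots> = 2" by (simp add: suminf_geometric)
    finally show "(\<Sum>k\<le>n. (1 / 2) ^ k) \<le> (2 :: real)" .
  qed
  finally show ?thesis by simp
qed

lemma fps_majorant_le_of_sphere:
  assumes "fps_conv_radius f = \<infinity>" "\<And>z. norm z = r \<Longrightarrow> norm (eval_fps f z) \<le> B"
    and "0 \<le> s" "2 * s \<le> r" "r > 0"
  shows "fps_majorant n f s \<le> 2 * B"
proof (rule fps_majorant_le_of_coeffs)
  show "norm (fps_nth f k) * r ^ k \<le> B" for k
    by (rule fps_nth_cauchy_bound) (use assms in auto)
qed (use assms in auto)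

lemma norm_nth_le_fps_majorant:
  assumes "s \<ge> 0"
  shows "norm (fps_nth f k) * s ^ k \<le> fps_majorant k f s"
  unfolding fps_majorant_def using assms by (intro member_le_sum) auto

lemma conv_radius_of_coeff_bounds:
  fixes f :: "complex fps"
  assumes "\<And>r. r > 0 \<Longrightarrow> \<exists>B. \<forall>k. norm (fps_nth f k) * r ^ k \<le> B"
  shows "fps_conv_radius f = \<infinity>"
proof -
  have "conv_radius (fps_nth f) \<ge> \<infinity>"
  proof (rule conv_radius_geI_ex')
    fix r :: real assume r: "0 < r"
    obtain B where B: "norm (fps_nth f k) * (2 * r) ^ k \<le> B" for k
      using assms[of "2 * r"] r by auto
    show "summable (\<lambda>n. fps_nth f n * of_real r ^ n)"
    proof (rule summable_comparison_test')
      show "summable (\<lambda>k. B * (1 / 2) ^ k)" by (intro summable_mult summable_geometric) auto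
      fix k
      have "norm (fps_nth f k * of_real r ^ k) = norm (fps_nth f k) * (2 * r) ^ k * (1 / 2) ^ k"
        using r by (simp add: norm_mult norm_power power_mult_distrib power_divide)
      also have "\<dots> \<le> B * (1 / 2) ^ k" using B[of k] by (intro mult_right_mono) auto
      finally show "norm (fps_nth f k * of_real r ^ k) \<le> B * (1 / 2) ^ k" .
    qed
  qed
  thus ?thesis by (simp add: fps_conv_radius_def)
qed

lemma norm_eval_fps_le:
  fixes f :: "complex fps"
  assumes "fps_conv_radius f = \<infinity>" "\<And>n. fps_majorant n f (norm z) \<le> B"
  shows "norm (eval_fps f z) \<le> B"
proof (rule Lim_bounded)
  have "(\<lambda>n. fps_nth f n * z ^ n) sums eval_fps f z"
    using assms(1) by (intro sums_eval_fps) simp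
  hence "(\<lambda>n. \<Sum>k\<le>n. fps_nth f k * z ^ k) \<longlonglongrightarrow> eval_fps f z" by (simp add: sums_def_le)
  thus "(\<lambda>n. norm (\<Sum>k\<le>n. fps_nth f k * z ^ k)) \<longlonglongrightarrow> norm (eval_fps f z)" by (rule tendsto_norm)
  show "\<forall>n\<ge>0. norm (\<Sum>k\<le>n. fps_nth f k * z ^ k) \<le> B"
    using order_trans[OF norm_truncation_le assms(2)] by blast
qed

lemma two_le_exp_1: "(2 :: real) \<le> exp 1"
  using exp_ge_add_one_self[of 1] by simp

lemma max_powr_le:
  fixes a b :: real
  assumes "0 \<le> a" "0 \<le> b"
  shows "max a b powr \<mu> \<le> a powr \<mu> + b powr \<mu>"
  by (simp add: max_def)

lemma fps_growthI_coeffs: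
  assumes \<mu>: "\<mu> > 0" and C: "C \<ge> 0"
    and f: "\<And>r k. r \<ge> 1 \<Longrightarrow> norm (fps_nth f k) * r ^ k \<le> exp (C * r powr \<mu>)"
  shows "fps_growth \<mu> f"
  unfolding fps_growth_def
proof (intro exI conjI allI impI)
  show "0 \<le> 1 + C * (1 + 2 powr \<mu>)" using C by simp
  fix n and s :: real assume s: "s \<ge> 0"
  \<comment> \<open>At least 2 * s, where the summation costs only a factor 2, and at least 1, where
    the coefficient bound starts. The factor 2 then disappears in exp 1.\<close>
  define r where "r = max 1 (2 * s)"
  have "fps_majorant n f s \<le> 2 * exp (C * r powr \<mu>)"
    by (rule fps_majorant_le_of_coeffs[OF f]) (use s in \<open>auto simp: r_def\<close>)
  also have "\<dots> \<le> exp 1 * exp (C * r powr \<mu>)"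
    using two_le_exp_1 by (intro mult_right_mono) auto
  also have "\<dots> = exp (1 + C * r powr \<mu>)" by (simp add: exp_add)
  also have "\<dots> \<le> exp ((1 + C * (1 + 2 powr \<mu>)) * (1 + s powr \<mu>))"
  proof (subst exp_le_cancel_iff)
    have "r powr \<mu> \<le> 1 powr \<mu> + (2 * s) powr \<mu>"
      unfolding r_def using s by (intro max_powr_le) auto
    also have "\<dots> = 1 + 2 powr \<mu> * s powr \<mu>" using s by (simp add: powr_mult)
    also have "\<dots> \<le> (1 + 2 powr \<mu>) * (1 + s powr \<mu>)" by (simp add: algebra_simps)
    finally have "C * r powr \<mu> \<le> C * ((1 + 2 powr \<mu>) * (1 + s powr \<mu>))"
      using C by (intro mult_left_mono)
    moreover have "1 \<le> 1 + s powr \<mu>" by simp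
    ultimately have "1 + C * r powr \<mu> \<le> (1 + s powr \<mu>) + C * ((1 + 2 powr \<mu>) * (1 + s powr \<mu>))"
      by linarith
    thus "1 + C * r powr \<mu> \<le> (1 + C * (1 + 2 powr \<mu>)) * (1 + s powr \<mu>)"
      by (simp add: algebra_simps)
  qed
  finally show "fps_majorant n f s \<le> exp ((1 + C * (1 + 2 powr \<mu>)) * (1 + s powr \<mu>))" .
qed

lemma fps_growth_iff:
  assumes \<mu>: "\<mu> > 0"
  shows "fps_growth \<mu> f \<longleftrightarrow> fps_conv_radius f = \<infinity> \<and>
    (\<exists>C\<ge>0. \<forall>z. norm (eval_fps f z) \<le> exp (C * (1 + norm z powr \<mu>)))"
proof safe
  assume "fps_growth \<mu> f"
  then obtain C where C: "C \<ge> 0"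
    "\<And>n s. s \<ge> 0 \<Longrightarrow> fps_majorant n f s \<le> exp (C * (1 + s powr \<mu>))"
    by (auto simp: fps_growth_def)
  show conv: "fps_conv_radius f = \<infinity>"
  proof (rule conv_radius_of_coeff_bounds)
    fix r :: real assume "r > 0"
    thus "\<exists>B. \<forall>k. norm (fps_nth f k) * r ^ k \<le> B"
      using order_trans[OF norm_nth_le_fps_majorant C(2)] by (metis less_imp_le)
  qed
  show "\<exists>C\<ge>0. \<forall>z. norm (eval_fps f z) \<le> exp (C * (1 + norm z powr \<mu>))"
    using C(1) norm_eval_fps_le[OF conv C(2)] by auto
next
  fix C :: real assume conv: "fps_conv_radius f = \<infinity>" and C: "0 \<le> C"
    and bound: "\<forall>z. norm (eval_fps f z) \<le> exp (C * (1 + norm z powr \<mu>))"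
  show "fps_growth \<mu> f"
  proof (rule fps_growthI_coeffs[OF \<mu>])
    show "0 \<le> 2 * C" using C by simp
    fix r :: real and k assume r: "r \<ge> 1"
    have "norm (fps_nth f k) * r ^ k \<le> exp (C * (1 + r powr \<mu>))"
      by (rule fps_nth_cauchy_bound) (use bound conv r in auto)
    also have "\<dots> \<le> exp (2 * C * r powr \<mu>)"
    proof (subst exp_le_cancel_iff)
      have "1 + r powr \<mu> \<le> 2 * r powr \<mu>" using r \<mu> by (simp add: ge_one_powr_ge_zero)
      from mult_left_mono[OF this C] show "C * (1 + r powr \<mu>) \<le> 2 * C * r powr \<mu>" by simp
    qed
    finally show "norm (fps_nth f k) * r ^ k \<le> exp (2 * C * r powr \<mu>)" .
  qed
qed

lemma fps_growth_mono:
  assumes "fps_growth \<mu> f" "0 < \<mu>" "\<mu> \<le> \<nu>"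
  shows "fps_growth \<nu> f"
proof -
  obtain C where C: "C \<ge> 0"
    "\<And>n s. s \<ge> 0 \<Longrightarrow> fps_majorant n f s \<le> exp (C * (1 + s powr \<mu>))"
    using assms(1) by (auto simp: fps_growth_def)
  have "fps_majorant n f s \<le> exp (2 * C * (1 + s powr \<nu>))" if s: "s \<ge> 0" for n s
  proof -
    have "1 + s powr \<mu> \<le> 2 * (1 + s powr \<nu>)"
      using powr_le_one_plus_powr[OF s assms(3) less_imp_le[OF assms(2)]] powr_ge_zero[of s \<nu>]
      by (simp only: distrib_left)
    from mult_left_mono[OF this C(1)]
    have "C * (1 + s powr \<mu>) \<le> 2 * C * (1 + s powr \<nu>)" by (simp add: mult_ac)
    thus ?thesis using order_trans[OF C(2)[OF s]] by simp
  qed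
  thus ?thesis unfolding fps_growth_def using C(1) by (intro exI[of _ "2 * C"]) auto
qed

section \<open>Maximum modulus and order\<close>

lemma norm_le_max_modulus:
  assumes "continuous_on UNIV F"
  shows "norm (F z) \<le> max_modulus F (norm z)"
  unfolding max_modulus_def
proof (rule cSUP_upper)
  have "compact ((\<lambda>z. norm (F z)) ` sphere 0 (norm z))"
    by (intro compact_continuous_image continuous_on_norm continuous_on_subset[OF assms]) auto
  thus "bdd_above ((\<lambda>z. norm (F z)) ` sphere 0 (norm z))"
    by (intro bounded_imp_bdd_above compact_imp_bounded)
qed auto

lemma max_modulus_le:
  assumes "r \<ge> 0" "\<And>z. norm z = r \<Longrightarrow> norm (F z) \<le> B"
  shows "max_modulus F r \<le> B"
  unfolding max_modulus_def
  by (rule cSUP_least) (use assms in auto)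

lemma max_modulus_ge_1:
  assumes conv: "fps_conv_radius f = \<infinity>" and f0: "fps_nth f 0 = 1" and r: "r > 0"
  shows "max_modulus (eval_fps f) r \<ge> 1"
proof -
  have cont: "continuous_on UNIV (eval_fps f)"
    using continuous_on_eval_fps[of f] conv by simp
  have "norm (fps_nth f 0) * r ^ 0 \<le> max_modulus (eval_fps f) r"
    by (rule fps_nth_cauchy_bound[OF r]) (use conv norm_le_max_modulus[OF cont] in auto)
  thus ?thesis using f0 by simp
qed

text \<open>The limes superior speaks of large radii and hides constants. Forward, the maximum
  principle carries the bound at radius \<open>r0\<close> into the disc inside; backward, an
  exponent \<nu> strictly between \<mu> and \<rho> absorbs the constant \<open>C\<close>.\<close>

lemma entire_order_less_iff_growth:
  assumes \<rho>: "\<rho> > 0" and f0: "fps_nth f 0 = 1"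
  shows "fps_conv_radius f = \<infinity> \<and> entire_order (eval_fps f) < ereal \<rho> \<longleftrightarrow>
    (\<exists>\<mu>. 0 < \<mu> \<and> \<mu> < \<rho> \<and> fps_growth \<mu> f)"
proof safe
  assume conv: "fps_conv_radius f = \<infinity>" and order: "entire_order (eval_fps f) < ereal \<rho>"
  have hol: "eval_fps f holomorphic_on UNIV"
    by (rule holomorphic_on_eval_fps) (simp add: conv)
  have cont: "continuous_on UNIV (eval_fps f)"
    using hol by (rule holomorphic_on_imp_continuous_on)
  define m where "m = max_modulus (eval_fps f)"
  obtain c' where "entire_order (eval_fps f) < c'" "c' < ereal \<rho>"
    using dense[OF order] by blast
  then obtain c where c: "entire_order (eval_fps f) < ereal c" "c < \<rho>"
    by (cases c') auto
  \<comment> \<open>\<open>c\<close> may be zero or negative, whereas growth exponents are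
    positive.\<close>
  define \<mu> where "\<mu> = max c (\<rho> / 2)"
  have \<mu>: "0 < \<mu>" "\<mu> < \<rho>" "c \<le> \<mu>" using \<rho> c by (auto simp: \<mu>_def)
  have "eventually (\<lambda>r. ereal (ln (ln (m r)) / ln r) < ereal c) at_top"
    using Limsup_lessD[OF c(1)[unfolded entire_order_def]] by (simp add: m_def)
  then obtain r1 where r1: "\<And>r. r \<ge> r1 \<Longrightarrow> ln (ln (m r)) / ln r < c"
    by (auto simp: eventually_at_top_linorder)
  define r0 where "r0 = max r1 2"
  have m_le: "m r \<le> exp (r powr \<mu>)" if "r \<ge> r0" for r
  proof -
    have r: "r \<ge> 2" "r \<ge> r1" using that by (auto simp: r0_def)
    have m1: "m r \<ge> 1" unfolding m_def using r by (intro max_modulus_ge_1 conv f0) auto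
    \<comment> \<open>For m r = 1 the double logarithm carries no information, as ln 0 = 0, but then
      the bound is trivial.\<close>
    have "ln (m r) \<le> r powr \<mu>"
    proof (cases "ln (m r) > 0")
      case True
      have "ln r > 0" using r by simp
      hence "ln (ln (m r)) < c * ln r" using r1[OF r(2)] by (simp add: pos_divide_less_eq)
      also have "\<dots> \<le> \<mu> * ln r" using \<mu> \<open>ln r > 0\<close> by (intro mult_right_mono) auto
      finally have "exp (ln (ln (m r))) \<le> exp (\<mu> * ln r)" by simp
      thus ?thesis using True r by (simp add: powr_def)
    next
      case False
      thus ?thesis by (meson not_less order_trans powr_ge_zero)
    qed
    hence "exp (ln (m r)) \<le> exp (r powr \<mu>)" by simp
    thus ?thesis using m1 by simp
  qed
  have bound: "norm (eval_fps f z) \<le> exp ((1 + r0 powr \<mu>) * (1 + norm z powr \<mu>))" for z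
  proof -
    define r where "r = max (norm z) r0"
    have r: "r > 0" "r \<ge> r0" "norm z \<le> r" by (auto simp: r_def r0_def)
    have "norm (eval_fps f z) \<le> m r"
      by (rule norm_le_of_sphere_bound[OF hol r(1) _ r(3)])
        (use norm_le_max_modulus[OF cont] in \<open>auto simp: m_def\<close>)
    also have "\<dots> \<le> exp (r powr \<mu>)" by (rule m_le[OF r(2)])
    also have "\<dots> \<le> exp ((1 + r0 powr \<mu>) * (1 + norm z powr \<mu>))"
    proof (subst exp_le_cancel_iff)
      have "r powr \<mu> \<le> norm z powr \<mu> + r0 powr \<mu>"
        unfolding r_def by (rule max_powr_le) (auto simp: r0_def)
      also have "\<dots> \<le> (1 + r0 powr \<mu>) * (1 + norm z powr \<mu>)" by (simp add: algebra_simps)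
      finally show "r powr \<mu> \<le> (1 + r0 powr \<mu>) * (1 + norm z powr \<mu>)" .
    qed
    finally show ?thesis .
  qed
  have "fps_growth \<mu> f"
    unfolding fps_growth_iff[OF \<mu>(1)] using conv bound
    by (intro conjI exI[of _ "1 + r0 powr \<mu>"]) auto
  thus "\<exists>\<mu>. 0 < \<mu> \<and> \<mu> < \<rho> \<and> fps_growth \<mu> f" using \<mu> by blast
next
  fix \<mu> assume \<mu>: "0 < \<mu>" "\<mu> < \<rho>" and growth: "fps_growth \<mu> f"
  from growth show conv: "fps_conv_radius f = \<infinity>" by (simp add: fps_growth_iff[OF \<mu>(1)])
  obtain C where C: "C \<ge> 0" "\<And>z. norm (eval_fps f z) \<le> exp (C * (1 + norm z powr \<mu>))"
    using growth by (auto simp: fps_growth_iff[OF \<mu>(1)])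
  define \<nu> where "\<nu> = (\<mu> + \<rho>) / 2"
  have \<nu>: "\<mu> < \<nu>" "\<nu> < \<rho>" using \<mu> by (auto simp: \<nu>_def)
  have "eventually (\<lambda>r :: real. C * (1 + r powr \<mu>) \<le> r powr \<nu>) at_top"
    using \<mu> \<nu> C(1) by real_asymp
  hence "eventually (\<lambda>r. ereal (ln (ln (max_modulus (eval_fps f) r)) / ln r) \<le> ereal \<nu>) at_top"
    using eventually_gt_at_top[of 1]
  proof eventually_elim
    case (elim r)
    define m where "m = max_modulus (eval_fps f) r"
    have "m \<ge> 1" unfolding m_def using elim by (intro max_modulus_ge_1 conv f0) auto
    have "m \<le> exp (C * (1 + r powr \<mu>))"
      unfolding m_def using elim C(2) by (intro max_modulus_le) auto
    also have "\<dots> \<le> exp (r powr \<nu>)" using elim by simp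
    finally have le: "ln m \<le> r powr \<nu>" using \<open>m \<ge> 1\<close> by (intro ln_le_of_le_exp) auto
    have "ln (ln m) \<le> \<nu> * ln r"
    proof (cases "ln m > 0")
      case True
      have "r powr \<nu> = exp (\<nu> * ln r)" using elim by (simp add: powr_def)
      thus ?thesis using True le by (auto intro: ln_le_of_le_exp[where a = "ln m"])
    next
      case False
      hence "ln m = 0" using \<open>m \<ge> 1\<close> by (simp add: not_less)
      thus ?thesis using \<mu> \<nu> elim by simp
    qed
    moreover have "ln r > 0" using elim by simp
    ultimately show ?case by (simp add: m_def pos_divide_le_eq)
  qed
  hence "entire_order (eval_fps f) \<le> ereal \<nu>"
    unfolding entire_order_def by (rule Limsup_bounded)
  also have "\<dots> < ereal \<rho>" using \<nu> by simp
  finally show "entire_order (eval_fps f) < ereal \<rho>" .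
qed

lemma entire_lt_iff:
  assumes "\<rho> > 0"
  shows "f \<in> entire_lt A \<rho> \<longleftrightarrow> f \<in> one_series A \<and> (\<exists>\<mu>. 0 < \<mu> \<and> \<mu> < \<rho> \<and> fps_growth \<mu> f)"
  using entire_order_less_iff_growth[OF assms, of f] by (auto simp: entire_lt_def one_series_def)

section \<open>Operations on functions of bounded growth\<close>

lemma fps_growth_mult:
  assumes \<mu>: "\<mu> > 0" and f: "fps_growth \<mu> f" and g: "fps_growth \<mu> g"
  shows "fps_growth \<mu> (f * g)"
proof -
  obtain C where C: "fps_conv_radius f = \<infinity>" "C \<ge> 0"
    "\<And>z. norm (eval_fps f z) \<le> exp (C * (1 + norm z powr \<mu>))"
    using f by (auto simp: fps_growth_iff[OF \<mu>])
  obtain D where D: "fps_conv_radius g = \<infinity>" "D \<ge> 0"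
    "\<And>z. norm (eval_fps g z) \<le> exp (D * (1 + norm z powr \<mu>))"
    using g by (auto simp: fps_growth_iff[OF \<mu>])
  have "norm (eval_fps (f * g) z) \<le> exp ((C + D) * (1 + norm z powr \<mu>))" for z
  proof -
    have "norm (eval_fps (f * g) z) = norm (eval_fps f z) * norm (eval_fps g z)"
      by (subst eval_fps_mult) (use C D in \<open>auto simp: norm_mult\<close>)
    also have "\<dots> \<le> exp (C * (1 + norm z powr \<mu>)) * exp (D * (1 + norm z powr \<mu>))"
      by (intro mult_mono C D) auto
    finally show ?thesis by (simp add: exp_add distrib_right)
  qed
  moreover have "fps_conv_radius (f * g) = \<infinity>"
    using fps_conv_radius_mult[of f g] C D by simp
  ultimately show ?thesis
    unfolding fps_growth_iff[OF \<mu>] using C(2) D(2) by (intro conjI exI[of _ "C + D"]) auto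
qed

lemma fps_growth_1: "fps_growth \<mu> 1"
proof -
  have "fps_majorant n 1 s \<le> exp (0 * (1 + s powr \<mu>))" for n and s :: real
    by (simp add: fps_majorant_def if_distrib[of norm] if_distrib[of "\<lambda>c. c * _"] cong: if_cong)
  thus ?thesis unfolding fps_growth_def by (intro exI[of _ 0]) auto
qed

lemma fps_growth_one_minus_X:
  assumes \<mu>: "\<mu> > 0"
  shows "fps_growth \<mu> (1 - fps_X)"
proof (rule fps_growthI_coeffs[OF \<mu>])
  show "1 / \<mu> \<ge> 0" using \<mu> by simp
  fix r :: real and k assume r: "r \<ge> 1"
  have "norm (fps_nth (1 - fps_X :: complex fps) k) * r ^ k \<le> r"
    using r by (auto simp: fps_X_def)
  also have "\<dots> = exp (ln r)" using r by simp
  also have "\<dots> \<le> exp (1 / \<mu> * r powr \<mu>)"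
    using ln_powr_bound[OF r \<mu>] by simp
  finally show "norm (fps_nth (1 - fps_X :: complex fps) k) * r ^ k \<le> exp (1 / \<mu> * r powr \<mu>)" .
qed

text \<open>Entireness of the reciprocal excludes zeros, so f = exp H with \<open>H\<close> entire
  and H 0 = 0. The growth of \<open>f\<close> bounds Re H from above only; Borel-Caratheodory from
  radius 2 * \<bar>z\<bar> to \<bar>z\<bar> upgrades this to a bound for the modulus of
  \<open>H\<close>, hence for exp (- H), with the same exponent.\<close>

lemma fps_growth_inverse:
  assumes \<mu>: "\<mu> > 0" and f: "fps_growth \<mu> f" and f0: "fps_nth f 0 = 1"
    and conv': "fps_conv_radius (inverse f) = \<infinity>"
  shows "fps_growth \<mu> (inverse f)"
proof -
  obtain C where C: "fps_conv_radius f = \<infinity>" "C \<ge> 0"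
    "\<And>z. norm (eval_fps f z) \<le> exp (C * (1 + norm z powr \<mu>))"
    using f by (auto simp: fps_growth_iff[OF \<mu>])
  have inv: "eval_fps f z * eval_fps (inverse f) z = 1" for z
  proof -
    have "eval_fps (f * inverse f) z = eval_fps f z * eval_fps (inverse f) z"
      by (rule eval_fps_mult) (use C conv' in auto)
    moreover have "f * inverse f = 1" using inverse_mult_eq_1[of f] f0 by (simp add: mult.commute)
    ultimately show ?thesis by simp
  qed
  have hol: "eval_fps f holomorphic_on UNIV"
    by (rule holomorphic_on_eval_fps) (simp add: C)
  have nz: "eval_fps f z \<noteq> 0" for z using inv[of z] by auto
  obtain L where L: "L holomorphic_on UNIV" "\<And>z. exp (L z) = eval_fps f z"
    using holomorphic_logarithm_exists[of UNIV "eval_fps f" 0] hol nz by auto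
  define H where "H z = L z - L 0" for z
  have H: "H holomorphic_on UNIV" unfolding H_def by (intro holomorphic_intros L)
  have H0: "H 0 = 0" by (simp add: H_def)
  have exp_H: "exp (H z) = eval_fps f z" for z
    using L(2)[of z] L(2)[of 0] f0 by (simp add: H_def exp_diff eval_fps_at_0)
  have bound: "norm (eval_fps (inverse f) z) \<le> exp ((2 * C * (1 + 2 powr \<mu>) + 2) * (1 + norm z powr \<mu>))" for z
  proof (cases "z = 0")
    case True
    have "eval_fps (inverse f) 0 = 1" using inv[of 0] f0 by (simp add: eval_fps_at_0)
    thus ?thesis using True C by simp
  next
    case False
    define R where "R = 2 * norm z"
    define a where "a = C * (1 + R powr \<mu>) + 1"
    have R: "R > 0" "norm z < R" using False by (auto simp: R_def)
    have ReH: "Re (H w) < a" if "norm w < R" for w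
    proof -
      have "exp (Re (H w)) = norm (eval_fps f w)" by (simp flip: exp_H)
      also have "\<dots> \<le> exp (C * (1 + norm w powr \<mu>))" by (rule C)
      finally have "Re (H w) \<le> C * (1 + norm w powr \<mu>)" by simp
      also have "\<dots> \<le> C * (1 + R powr \<mu>)"
        using that \<mu> C(2) by (intro mult_left_mono add_left_mono powr_mono2) auto
      finally show ?thesis by (simp add: a_def)
    qed
    have "norm (H z) \<le> 2 * a * norm z / (R - norm z)"
      by (rule borel_caratheodory[OF holomorphic_on_subset[OF H] H0 ReH R(2)]) auto
    also have "\<dots> = 2 * a" using False by (simp add: R_def)
    finally have Hz: "norm (H z) \<le> 2 * a" .
    have "eval_fps (inverse f) z = exp (- H z)"
      using inv[of z] nz[of z] by (simp add: exp_minus exp_H field_simps)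
    hence "norm (eval_fps (inverse f) z) \<le> exp (norm (H z))"
      using norm_exp[of "- H z"] by simp
    also have "\<dots> \<le> exp (2 * a)" using Hz by simp
    also have "2 * a \<le> (2 * C * (1 + 2 powr \<mu>) + 2) * (1 + norm z powr \<mu>)"
    proof -
      have "1 + R powr \<mu> = 1 + 2 powr \<mu> * norm z powr \<mu>" by (simp add: R_def powr_mult)
      also have "\<dots> \<le> (1 + 2 powr \<mu>) * (1 + norm z powr \<mu>)" by (simp add: algebra_simps)
      finally have "2 * C * (1 + R powr \<mu>) \<le> 2 * C * ((1 + 2 powr \<mu>) * (1 + norm z powr \<mu>))"
        using C(2) by (intro mult_left_mono) auto
      moreover have "2 \<le> 2 * (1 + norm z powr \<mu>)" by simp
      ultimately have "2 * C * (1 + R powr \<mu>) + 2 \<le>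
          2 * C * ((1 + 2 powr \<mu>) * (1 + norm z powr \<mu>)) + 2 * (1 + norm z powr \<mu>)"
        by (rule add_mono)
      thus ?thesis unfolding a_def by (simp add: algebra_simps)
    qed
    finally show ?thesis by simp
  qed
  show ?thesis
    unfolding fps_growth_iff[OF \<mu>] using conv' bound C(2)
    by (intro conjI exI[of _ "2 * C * (1 + 2 powr \<mu>) + 2"]) auto
qed

lemma fps_growth_ene:
  assumes \<mu>: "0 < \<mu>" "\<mu> < \<nu>" and f: "fps_growth \<mu> f" "fps_nth f 0 = 1"
    and g: "fps_growth \<mu> g" "fps_nth g 0 = 1"
  shows "fps_growth \<nu> (ene f g)"
proof -
  obtain C where C: "C \<ge> 0" "\<And>n s. s \<ge> 0 \<Longrightarrow> fps_majorant n f s \<le> exp (C * (1 + s powr \<mu>))"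
    using f by (auto simp: fps_growth_def)
  obtain D where D: "D \<ge> 0" "\<And>n s. s \<ge> 0 \<Longrightarrow> fps_majorant n g s \<le> exp (D * (1 + s powr \<mu>))"
    using g by (auto simp: fps_growth_def)
  have le: "exp (C * (1 + s powr \<mu>)) \<le> exp (max C D * (1 + s powr \<mu>))"
    "exp (D * (1 + s powr \<mu>)) \<le> exp (max C D * (1 + s powr \<mu>))" for s
    unfolding exp_le_cancel_iff by (intro mult_right_mono; simp)+
  have f': "fps_majorant n f s \<le> exp (max C D * (1 + s powr \<mu>))"
    and g': "fps_majorant n g s \<le> exp (max C D * (1 + s powr \<mu>))" if "s \<ge> 0" for n s
    by (rule order_trans[OF C(2)[OF that] le(1)], rule order_trans[OF D(2)[OF that] le(2)])
  have CD: "max C D \<ge> 0" using C(1) by simp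
  show ?thesis
  proof (rule ene_nth_growth[OF f(2) g(2) \<mu> CD])
    fix C' :: real
    assume "C' \<ge> 0" "\<And>n r. r \<ge> 1 \<Longrightarrow> norm (fps_nth (ene f g) n) * r ^ n \<le> exp (C' * r powr \<nu>)"
    thus ?thesis using \<mu> by (intro fps_growthI_coeffs[of \<nu> C']) auto
  qed (use f' g' in auto)
qed

section \<open>The subring of entire functions of bounded order\<close>

lemma ring_closed_of_subring:
  assumes "subring A (ring_of_type_algebra :: complex ring)"
  shows "ring_closed A"
proof -
  interpret ring "ring_of_type_algebra :: complex ring"
    by (rule ring_from_type_algebra)
  have one: "1 \<in> A" and mult: "\<And>a b. a \<in> A \<Longrightarrow> b \<in> A \<Longrightarrow> a * b \<in> A"
    and add: "\<And>a b. a \<in> A \<Longrightarrow> b \<in> A \<Longrightarrow> a + b \<in> A"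
    using subringE(3,6,7)[OF assms] by (auto simp: ring_of_type_algebra_def)
  have "\<ominus>\<^bsub>(ring_of_type_algebra :: complex ring)\<^esub> a = - a" for a
    by (rule minus_equality) (auto simp: ring_of_type_algebra_def)
  hence um: "- a \<in> A" if "a \<in> A" for a using subringE(5)[OF assms that] by simp
  have "a - b \<in> A" if "a \<in> A" "b \<in> A" for a b using add[OF that(1) um[OF that(2)]] by simp
  thus ?thesis using one mult by (simp add: ring_closed_def)
qed

lemma one_series_nth:
  assumes "ring_closed A" "f \<in> one_series A"
  shows "fps_nth f n \<in> A"
  using assms ring_closed_1[OF assms(1)] by (cases "n = 0") (auto simp: one_series_def)

lemma one_seriesI:
  assumes "fps_nth f 0 = 1" "\<And>n. fps_nth f n \<in> A"
  shows "f \<in> one_series A"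
  using assms by (simp add: one_series_def)

lemma ring_closed_mp_eval:
  assumes "ring_closed A" "\<And>v. v \<in> mp_vars Q \<Longrightarrow> \<phi> v \<in> A"
  shows "mp_eval \<phi> Q \<in> A"
  unfolding mp_eval_def
  by (intro ring_closed_sum ring_closed_mult ring_closed_prod ring_closed_power
      ring_closed_of_int assms) (auto simp: mp_vars_def)

lemma one_series_ene:
  assumes A: "ring_closed A" and fg: "f \<in> one_series A" "g \<in> one_series A"
  shows "ene f g \<in> one_series A"
proof (rule one_seriesI)
  fix n
  have "mp_eval (case_sum (fps_nth f) (fps_nth g)) (ene_poly n) \<in> A"
    by (rule ring_closed_mp_eval[OF A])
      (use one_series_nth[OF A fg(1)] one_series_nth[OF A fg(2)] in \<open>auto split: sum.splits\<close>)
  thus "fps_nth (ene f g) n \<in> A"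
    by (auto simp: ene_def intro!: ring_closed_1 ring_closed_mult ring_closed_power ring_closed_uminus A)
qed (simp add: ene_def)

lemma one_series_mult:
  assumes A: "ring_closed A" and fg: "f \<in> one_series A" "g \<in> one_series A"
  shows "f * g \<in> one_series A"
proof (rule one_seriesI)
  show "fps_nth (f * g) 0 = 1" using fg by (simp add: one_series_def)
  show "fps_nth (f * g) n \<in> A" for n
    unfolding fps_mult_nth
    by (intro ring_closed_sum ring_closed_mult A one_series_nth[OF A fg(1)] one_series_nth[OF A fg(2)])
qed

text \<open>The constant term is 1, so the recursion for the coefficients of the reciprocal involves
  no division.\<close>

lemma one_series_inverse:
  assumes A: "ring_closed A" and f: "f \<in> one_series A"
  shows "inverse f \<in> one_series A"
proof (rule one_seriesI)
  have f0: "fps_nth f 0 = 1" using f by (simp add: one_series_def)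
  thus inv0: "fps_nth (inverse f) 0 = 1" by simp
  fix n
  show "fps_nth (inverse f) n \<in> A"
  proof (induction n rule: less_induct)
    case (less n)
    show ?case
    proof (cases "n = 0")
      case True
      thus ?thesis using inv0 ring_closed_1[OF A] by simp
    next
      case False
      have "0 = fps_nth (inverse f * f) n" using inverse_mult_eq_1[of f] f0 False by simp
      also have "\<dots> = (\<Sum>i=0..n. fps_nth (inverse f) i * fps_nth f (n - i))" by (rule fps_mult_nth)
      also have "\<dots> = (\<Sum>i\<in>{0..<n}. fps_nth (inverse f) i * fps_nth f (n - i)) + fps_nth (inverse f) n"
        using f0 by (simp flip: atLeastLessThanSuc_atLeastAtMost)
      finally have "fps_nth (inverse f) n = - (\<Sum>i\<in>{0..<n}. fps_nth (inverse f) i * fps_nth f (n - i))"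
        by (simp add: eq_neg_iff_add_eq_0 add.commute)
      thus ?thesis
        using less one_series_nth[OF A f]
        by (auto intro!: ring_closed_uminus ring_closed_sum ring_closed_mult A)
    qed
  qed
qed

lemma entire_lt_common_growth:
  assumes "\<rho> > 0" "f \<in> entire_lt A \<rho>" "g \<in> entire_lt A \<rho>"
  obtains \<mu> where "0 < \<mu>" "\<mu> < \<rho>" "fps_growth \<mu> f" "fps_growth \<mu> g"
proof -
  obtain \<mu> \<nu> where "0 < \<mu>" "\<mu> < \<rho>" "fps_growth \<mu> f" "0 < \<nu>" "\<nu> < \<rho>" "fps_growth \<nu> g"
    using assms by (auto simp: entire_lt_iff)
  thus ?thesis
    by (intro that[of "max \<mu> \<nu>"]) (auto intro: fps_growth_mono)
qed

text \<open>The strict inequality in the order leaves room for an exponent \<nu> between \<mu> and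
  \<rho>, which pays for the loss in \<open>fps_growth_ene\<close>.\<close>

lemma entire_lt_ene:
  assumes A: "ring_closed A" and \<rho>: "\<rho> > 0" and f: "f \<in> entire_lt A \<rho>" and g: "g \<in> entire_lt A \<rho>"
  shows "ene f g \<in> entire_lt A \<rho>"
proof -
  obtain \<mu> where \<mu>: "0 < \<mu>" "\<mu> < \<rho>" "fps_growth \<mu> f" "fps_growth \<mu> g"
    by (rule entire_lt_common_growth[OF \<rho> f g]) (rule that)
  obtain \<nu> where \<nu>: "\<mu> < \<nu>" "\<nu> < \<rho>" using dense[OF \<mu>(2)] by blast
  have fg: "f \<in> one_series A" "g \<in> one_series A" using f g by (auto simp: entire_lt_def)
  have "fps_growth \<nu> (ene f g)"
    by (rule fps_growth_ene[OF \<mu>(1) \<nu>(1) \<mu>(3) _ \<mu>(4)]) (use fg in \<open>auto simp: one_series_def\<close>)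
  thus ?thesis
    unfolding entire_lt_iff[OF \<rho>] using one_series_ene[OF A fg] \<mu> \<nu> by (auto intro: less_trans)
qed

lemma entire_lt_mult:
  assumes A: "ring_closed A" and \<rho>: "\<rho> > 0" and f: "f \<in> entire_lt A \<rho>" and g: "g \<in> entire_lt A \<rho>"
  shows "f * g \<in> entire_lt A \<rho>"
proof -
  obtain \<mu> where \<mu>: "0 < \<mu>" "\<mu> < \<rho>" "fps_growth \<mu> f" "fps_growth \<mu> g"
    by (rule entire_lt_common_growth[OF \<rho> f g]) (rule that)
  have fg: "f \<in> one_series A" "g \<in> one_series A" using f g by (auto simp: entire_lt_def)
  show ?thesis
    unfolding entire_lt_iff[OF \<rho>] using one_series_mult[OF A fg] fps_growth_mult[OF \<mu>(1,3,4)] \<mu> by auto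
qed

lemma entire_lt_1:
  assumes A: "ring_closed A" and \<rho>: "\<rho> > 0"
  shows "1 \<in> entire_lt A \<rho>"
proof -
  have "(1 :: complex fps) \<in> one_series A"
    by (rule one_seriesI) (auto simp: ring_closed_0[OF A] ring_closed_1[OF A])
  moreover have "0 < \<rho> / 2" "\<rho> / 2 < \<rho>" using \<rho> by auto
  ultimately show ?thesis unfolding entire_lt_iff[OF \<rho>] using fps_growth_1 by blast
qed

lemma entire_lt_one_minus_X:
  assumes A: "ring_closed A" and \<rho>: "\<rho> > 0"
  shows "1 - fps_X \<in> entire_lt A \<rho>"
proof -
  have "(1 - fps_X :: complex fps) \<in> one_series A"
    by (rule one_seriesI)
      (auto simp: fps_X_def ring_closed_0[OF A] ring_closed_1[OF A] ring_closed_uminus[OF A])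
  moreover have "0 < \<rho> / 2" "\<rho> / 2 < \<rho>" using \<rho> by auto
  ultimately show ?thesis unfolding entire_lt_iff[OF \<rho>] using fps_growth_one_minus_X by blast
qed

lemma entire_lt_a_inv:
  assumes A: "ring_closed A" and \<rho>: "\<rho> > 0" and f: "f \<in> entire_lt A \<rho>"
    and conv: "fps_conv_radius (a_inv (ene_ring A) f) = \<infinity>"
  shows "a_inv (ene_ring A) f \<in> entire_lt A \<rho>"
proof -
  have fA: "f \<in> one_series A" using f by (simp add: entire_lt_def)
  have inv: "inverse f \<in> one_series A" by (rule one_series_inverse[OF A fA])
  have eq: "a_inv (ene_ring A) f = inverse f" by (rule a_inv_ene_ring[OF fA inv])
  obtain \<mu> where \<mu>: "0 < \<mu>" "\<mu> < \<rho>" "fps_growth \<mu> f" using f by (auto simp: entire_lt_iff[OF \<rho>])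
  have "fps_growth \<mu> (inverse f)"
    by (rule fps_growth_inverse[OF \<mu>(1,3)]) (use fA conv in \<open>auto simp: one_series_def eq\<close>)
  thus ?thesis unfolding eq entire_lt_iff[OF \<rho>] using inv \<mu> by blast
qed

lemma subsemiring_entire_lt:
  assumes A: "ring_closed A" and \<rho>: "\<rho> > 0"
  shows "subsemiring (entire_lt A \<rho>) (ene_ring A)"
  unfolding subsemiring_def submonoid_def
  using entire_lt_mult[OF A \<rho>] entire_lt_ene[OF A \<rho>] entire_lt_1[OF A \<rho>] entire_lt_one_minus_X[OF A \<rho>]
  by (auto simp: ene_ring_def entire_lt_def)

section \<open>Perturbation of the factors\<close>

lemma tendsto_mp_eval:
  fixes \<phi> :: "'b \<Rightarrow> 'v \<Rightarrow> complex"
  assumes "\<And>v. ((\<lambda>m. \<phi> m v) \<longlongrightarrow> \<psi> v) F"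
  shows "((\<lambda>m. mp_eval (\<phi> m) Q) \<longlongrightarrow> mp_eval \<psi> Q) F"
  unfolding mp_eval_def by (intro tendsto_intros assms)

lemma tendsto_ene_nth:
  assumes "\<And>k. (\<lambda>m. fps_nth (f m) k) \<longlonglongrightarrow> fps_nth f' k" "\<And>k. (\<lambda>m. fps_nth (g m) k) \<longlonglongrightarrow> fps_nth g' k"
  shows "(\<lambda>m. fps_nth (ene (f m) (g m)) n) \<longlonglongrightarrow> fps_nth (ene f' g') n"
proof -
  have "(\<lambda>m. mp_eval (case_sum (fps_nth (f m)) (fps_nth (g m))) (ene_poly n)) \<longlonglongrightarrow>
      mp_eval (case_sum (fps_nth f') (fps_nth g')) (ene_poly n)"
    by (rule tendsto_mp_eval) (auto simp: assms split: sum.splits)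
  thus ?thesis by (cases "n = 0") (auto simp: ene_def intro!: tendsto_intros)
qed

lemma norm_nth_diff_le:
  fixes f g :: "complex fps"
  assumes "fps_conv_radius f = \<infinity>" "fps_conv_radius g = \<infinity>" "r > 0"
    and "\<And>z. z \<in> cball 0 r \<Longrightarrow> dist (eval_fps f z) (eval_fps g z) < \<delta>"
  shows "norm (fps_nth f k - fps_nth g k) * r ^ k \<le> \<delta>"
proof -
  have "norm (fps_nth (f - g) k) * r ^ k \<le> \<delta>"
  proof (rule fps_nth_cauchy_bound[OF assms(3)])
    show "ereal r < fps_conv_radius (f - g)"
      using fps_conv_radius_diff[of f g] assms(1,2) by simp
    fix z :: complex assume "norm z = r"
    thus "norm (eval_fps (f - g) z) \<le> \<delta>"
      using assms(4)[of z] by (subst eval_fps_diff) (auto simp: assms(1,2) dist_norm less_imp_le)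
  qed
  thus ?thesis by simp
qed

lemma fps_majorant_near:
  assumes "\<And>k. norm (fps_nth f k - fps_nth g k) * r ^ k \<le> \<delta>" and s: "0 \<le> s" "2 * s \<le> r" "r > 0"
  shows "fps_majorant n f s \<le> fps_majorant n g s + 2 * \<delta>"
proof -
  have "fps_majorant n f s \<le> fps_majorant n g s + fps_majorant n (f - g) s"
    unfolding fps_majorant_def sum.distrib[symmetric] distrib_right[symmetric]
    using s norm_triangle_sub[of "fps_nth f _" "fps_nth g _"]
    by (intro sum_mono mult_right_mono) auto
  moreover have "fps_majorant n (f - g) s \<le> 2 * \<delta>"
    by (rule fps_majorant_le_of_coeffs[OF _ s]) (use assms(1) in simp)
  ultimately show ?thesis by simp
qed

text \<open>The head is meant for coefficientwise convergence, the tail for uniform coefficient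
  bounds at the doubled radius. Splitting (1 / 2) ^ n as (2 / 3) ^ n * (3 / 4) ^ n leaves (2 / 3) ^
  N as decay, while the second factor sums to 4.\<close>

lemma norm_eval_fps_le_split:
  fixes h :: "complex fps"
  assumes conv: "fps_conv_radius h = \<infinity>" and B: "\<And>n. norm (fps_nth h n) * (2 * r) ^ n \<le> B"
    and r: "r > 0" and z: "norm z \<le> r"
  shows "norm (eval_fps h z) \<le> (\<Sum>n<N. norm (fps_nth h n) * r ^ n) + 4 * B * (2 / 3) ^ N"
proof -
  have B0: "B \<ge> 0" using order_trans[OF norm_ge_zero] B[of 0] by simp
  have "(\<lambda>n. fps_nth h n * z ^ n) sums eval_fps h z"
    using conv by (intro sums_eval_fps) simp
  moreover have "(\<lambda>n. (if n \<in> {..<N} then norm (fps_nth h n) * r ^ n else 0) + B * (2 / 3) ^ N * (3 / 4) ^ n) sums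
      ((\<Sum>n<N. norm (fps_nth h n) * r ^ n) + B * (2 / 3) ^ N * (1 / (1 - 3 / 4)))"
    by (intro sums_add sums_mult geometric_sums sums_If_finite_set) auto
  moreover have "norm (fps_nth h n * z ^ n) \<le>
      (if n \<in> {..<N} then norm (fps_nth h n) * r ^ n else 0) + B * (2 / 3) ^ N * (3 / 4) ^ n" for n
  proof -
    have le: "norm (fps_nth h n * z ^ n) \<le> norm (fps_nth h n) * r ^ n"
      using z by (auto simp: norm_mult norm_power intro!: mult_left_mono power_mono)
    show ?thesis
    proof (cases "n < N")
      case True
      thus ?thesis using le B0 by (simp add: add_increasing2)
    next
      case False
      have "norm (fps_nth h n) * r ^ n = norm (fps_nth h n) * (2 * r) ^ n * (1 / 2) ^ n"
        by (simp add: power_mult_distrib power_divide)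
      also have "\<dots> \<le> B * (1 / 2) ^ n" using B[of n] by (intro mult_right_mono) auto
      also have "(1 / 2 :: real) ^ n = (2 / 3) ^ n * (3 / 4) ^ n" by (simp flip: power_mult_distrib)
      also have "B * ((2 / 3) ^ n * (3 / 4) ^ n) \<le> B * ((2 / 3) ^ N * (3 / 4) ^ n)"
        using False by (intro mult_left_mono mult_right_mono power_decreasing B0) auto
      finally show ?thesis using le False by (simp add: mult.assoc)
    qed
  qed
  ultimately have "norm (eval_fps h z) \<le>
      (\<Sum>n<N. norm (fps_nth h n) * r ^ n) + B * (2 / 3) ^ N * (1 / (1 - 3 / 4))"
    by (rule norm_le_of_sums)
  thus ?thesis by (simp add: mult_ac)
qed

lemma fps_majorant_bounded:
  assumes "fps_conv_radius f = \<infinity>" "s > 0"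
  obtains B where "\<And>n. fps_majorant n f s \<le> B"
proof -
  have "continuous_on (sphere 0 (2 * s)) (eval_fps f)"
    by (rule continuous_on_subset[OF continuous_on_eval_fps]) (simp add: assms)
  hence "bounded (eval_fps f ` sphere 0 (2 * s))"
    by (intro compact_imp_bounded compact_continuous_image) auto
  then obtain B where "\<forall>w\<in>eval_fps f ` sphere 0 (2 * s). norm w \<le> B"
    unfolding bounded_iff by (elim exE)
  hence B: "norm (eval_fps f z) \<le> B" if "norm z = 2 * s" for z using that by simp
  show ?thesis
    by (rule that[of "2 * B"], rule fps_majorant_le_of_sphere[where r = "2 * s"])
      (use assms B in auto)
qed

text \<open>Coefficients within 1 of those of \<open>f\<close> and \<open>g\<close>, measured at
  radius 2 * T, raise the majorants at radii up to \<open>T\<close> by at most 2. Constants computed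
  from \<open>f\<close> and \<open>g\<close> with a margin of 2 therefore serve the whole
  neighbourhood.\<close>

lemma ene_nth_locally_bounded:
  assumes f: "fps_conv_radius f = \<infinity>" "fps_nth f 0 = 1" and g: "fps_conv_radius g = \<infinity>" "fps_nth g 0 = 1"
    and r: "r > 0"
  obtains S B where "S > 0"
    "\<forall>f' g' n. fps_nth f' 0 = 1 \<longrightarrow> fps_nth g' 0 = 1 \<longrightarrow>
      (\<forall>k. norm (fps_nth f' k - fps_nth f k) * S ^ k \<le> 1) \<longrightarrow>
      (\<forall>k. norm (fps_nth g' k - fps_nth g k) * S ^ k \<le> 1) \<longrightarrow>
      norm (fps_nth (ene f' g') n) * r ^ n \<le> B"
proof -
  obtain Mf where Mf: "\<And>n. fps_majorant n f 1 \<le> Mf" by (rule fps_majorant_bounded[OF f(1), of 1]) auto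
  obtain Mg where Mg: "\<And>n. fps_majorant n g 1 \<le> Mg" by (rule fps_majorant_bounded[OF g(1), of 1]) auto
  define M where "M = max Mf Mg + 2"
  \<comment> \<open>The radii required by \<open>ene_nth_bound_crude\<close>; the 1 also covers the
    majorant at radius 1, which bounds the roots.\<close>
  define T where "T = max 1 (max (4 * sqrt (8 * r)) (8 * M * r))"
  have T: "T \<ge> 1" "4 * sqrt (8 * r) \<le> T" "8 * M * r \<le> T" by (auto simp: T_def)
  obtain Kf where Kf: "\<And>n. fps_majorant n f T \<le> Kf"
    by (rule fps_majorant_bounded[OF f(1), of T]) (use T in auto)
  obtain Kg where Kg: "\<And>n. fps_majorant n g T \<le> Kg"
    by (rule fps_majorant_bounded[OF g(1), of T]) (use T in auto)
  define K where "K = ln (max Kf Kg + 2)"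
  have "Kf \<ge> 1" using order_trans[OF fps_majorant_ge_1[OF f(2)] Kf] T by simp
  hence expK: "exp K = max Kf Kg + 2" by (simp add: K_def)
  show ?thesis
  proof (rule that[of "2 * T" "exp (10 * (K + 1)\<^sup>2)"])
    show "2 * T > 0" using T by simp
  next
    show "\<forall>f' g' n. fps_nth f' 0 = 1 \<longrightarrow> fps_nth g' 0 = 1 \<longrightarrow>
      (\<forall>k. norm (fps_nth f' k - fps_nth f k) * (2 * T) ^ k \<le> 1) \<longrightarrow>
      (\<forall>k. norm (fps_nth g' k - fps_nth g k) * (2 * T) ^ k \<le> 1) \<longrightarrow>
      norm (fps_nth (ene f' g') n) * r ^ n \<le> exp (10 * (K + 1)\<^sup>2)"
    proof (intro allI impI)
      fix f' g' :: "complex fps" and n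
      assume f0: "fps_nth f' 0 = 1" and g0: "fps_nth g' 0 = 1"
        and df: "\<forall>k. norm (fps_nth f' k - fps_nth f k) * (2 * T) ^ k \<le> 1"
        and dg: "\<forall>k. norm (fps_nth g' k - fps_nth g k) * (2 * T) ^ k \<le> 1"
      have near: "fps_majorant n f' s \<le> fps_majorant n f s + 2" "fps_majorant n g' s \<le> fps_majorant n g s + 2"
        if "0 \<le> s" "s \<le> T" for s
        using fps_majorant_near[OF df[rule_format], of s n] fps_majorant_near[OF dg[rule_format], of s n] that T by auto
      show "norm (fps_nth (ene f' g') n) * r ^ n \<le> exp (10 * (K + 1)\<^sup>2)"
      proof (rule ene_nth_bound_crude[OF f0 g0 r _ _ T(2,3)])
        show "fps_majorant n f' 1 \<le> M" "fps_majorant n g' 1 \<le> M"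
          using near[of 1] Mf[of n] Mg[of n] T by (auto simp: M_def)
        show "fps_majorant n f' T \<le> exp K" "fps_majorant n g' T \<le> exp K"
          using near[of T] Kf[of n] Kg[of n] T unfolding expK by auto
      qed
    qed
  qed
qed

section \<open>Continuity\<close>

text \<open>Each coefficient of an ene product depends continuously on finitely many coefficients of
  the factors, but without uniformity in the index; the local bound supplies the missing control of
  the tails. Arguing by contradiction with \<delta> = 1 / (m + 1) reduces the claim to sequences,
  while \<open>L\<close> stays the fixed disc on which closeness implies the local bound.\<close>

lemma ene_compact_close:
  assumes A: "ring_closed A" and \<rho>: "\<rho> > 0" and f: "f \<in> entire_lt A \<rho>" and g: "g \<in> entire_lt A \<rho>"
    and K: "compact K" and \<epsilon>: "\<epsilon> > 0"
  obtains L \<delta> where "compact L" "\<delta> > 0"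
    "\<forall>f'\<in>entire_lt A \<rho>. \<forall>g'\<in>entire_lt A \<rho>.
      (\<forall>w\<in>L. dist (eval_fps f' w) (eval_fps f w) < \<delta>) \<longrightarrow>
      (\<forall>w\<in>L. dist (eval_fps g' w) (eval_fps g w) < \<delta>) \<longrightarrow>
      (\<forall>z\<in>K. dist (eval_fps (ene f' g') z) (eval_fps (ene f g) z) < \<epsilon>)"
proof -
  have conv: "fps_conv_radius h = \<infinity>" and h0: "fps_nth h 0 = 1" if "h \<in> entire_lt A \<rho>" for h
    using that by (auto simp: entire_lt_def one_series_def)
  have ene_conv: "fps_conv_radius (ene f' g') = \<infinity>"
    if "f' \<in> entire_lt A \<rho>" "g' \<in> entire_lt A \<rho>" for f' g'
    by (rule conv[OF entire_lt_ene[OF A \<rho> that]])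
  obtain r0 where r0: "\<forall>z\<in>K. norm z \<le> r0"
    using compact_imp_bounded[OF K] by (auto simp: bounded_iff)
  define r where "r = max r0 1"
  have r: "r > 0" "\<And>z. z \<in> K \<Longrightarrow> norm z \<le> r" using r0 by (force simp: r_def)+
  have r2: "2 * r > 0" using r by simp
  obtain S B where S: "S > 0" and B: "\<forall>f' g' n. fps_nth f' 0 = 1 \<longrightarrow> fps_nth g' 0 = 1 \<longrightarrow>
      (\<forall>k. norm (fps_nth f' k - fps_nth f k) * S ^ k \<le> 1) \<longrightarrow>
      (\<forall>k. norm (fps_nth g' k - fps_nth g k) * S ^ k \<le> 1) \<longrightarrow>
      norm (fps_nth (ene f' g') n) * (2 * r) ^ n \<le> B"
    by (rule ene_nth_locally_bounded[OF conv[OF f] h0[OF f] conv[OF g] h0[OF g] r2]) (rule that)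
  have near: "norm (fps_nth f' k - fps_nth f k) * S ^ k \<le> \<delta>"
    if "f' \<in> entire_lt A \<rho>" "f \<in> entire_lt A \<rho>"
      "\<forall>w\<in>cball 0 S. dist (eval_fps f' w) (eval_fps f w) < \<delta>" for f' f k \<delta>
    by (rule norm_nth_diff_le[OF conv[OF that(1)] conv[OF that(2)] S]) (use that(3) in blast)
  have "\<exists>\<delta>>0. \<forall>f'\<in>entire_lt A \<rho>. \<forall>g'\<in>entire_lt A \<rho>.
      (\<forall>w\<in>cball 0 S. dist (eval_fps f' w) (eval_fps f w) < \<delta>) \<longrightarrow>
      (\<forall>w\<in>cball 0 S. dist (eval_fps g' w) (eval_fps g w) < \<delta>) \<longrightarrow>
      (\<forall>z\<in>K. dist (eval_fps (ene f' g') z) (eval_fps (ene f g) z) < \<epsilon>)"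
  proof (rule ccontr)
    assume neg: "\<not> ?thesis"
    have "\<exists>f' g' z. f' \<in> entire_lt A \<rho> \<and> g' \<in> entire_lt A \<rho> \<and>
        (\<forall>w\<in>cball 0 S. dist (eval_fps f' w) (eval_fps f w) < inverse (real (Suc m))) \<and>
        (\<forall>w\<in>cball 0 S. dist (eval_fps g' w) (eval_fps g w) < inverse (real (Suc m))) \<and>
        z \<in> K \<and> \<epsilon> \<le> dist (eval_fps (ene f' g') z) (eval_fps (ene f g) z)" for m
    proof (rule ccontr)
      assume "\<nexists>f' g' z. f' \<in> entire_lt A \<rho> \<and> g' \<in> entire_lt A \<rho> \<and>
        (\<forall>w\<in>cball 0 S. dist (eval_fps f' w) (eval_fps f w) < inverse (real (Suc m))) \<and>
        (\<forall>w\<in>cball 0 S. dist (eval_fps g' w) (eval_fps g w) < inverse (real (Suc m))) \<and>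
        z \<in> K \<and> \<epsilon> \<le> dist (eval_fps (ene f' g') z) (eval_fps (ene f g) z)"
      hence "inverse (real (Suc m)) > 0 \<and> (\<forall>f'\<in>entire_lt A \<rho>. \<forall>g'\<in>entire_lt A \<rho>.
        (\<forall>w\<in>cball 0 S. dist (eval_fps f' w) (eval_fps f w) < inverse (real (Suc m))) \<longrightarrow>
        (\<forall>w\<in>cball 0 S. dist (eval_fps g' w) (eval_fps g w) < inverse (real (Suc m))) \<longrightarrow>
        (\<forall>z\<in>K. dist (eval_fps (ene f' g') z) (eval_fps (ene f g) z) < \<epsilon>))"
        by (simp add: not_le) blast
      thus False using neg by blast
    qed
    then obtain F G Z where F: "\<And>m. F m \<in> entire_lt A \<rho>" and G: "\<And>m. G m \<in> entire_lt A \<rho>"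
      and dF: "\<And>m. \<forall>w\<in>cball 0 S. dist (eval_fps (F m) w) (eval_fps f w) < inverse (real (Suc m))"
      and dG: "\<And>m. \<forall>w\<in>cball 0 S. dist (eval_fps (G m) w) (eval_fps g w) < inverse (real (Suc m))"
      and Z: "\<And>m. Z m \<in> K"
      and far: "\<And>m. \<epsilon> \<le> dist (eval_fps (ene (F m) (G m)) (Z m)) (eval_fps (ene f g) (Z m))"
      by metis
    have lim: "(\<lambda>m. fps_nth (H m) k) \<longlonglongrightarrow> fps_nth h k"
      if H: "\<And>m. norm (fps_nth (H m) k - fps_nth h k) * S ^ k \<le> inverse (real (Suc m))"
      for H :: "nat \<Rightarrow> complex fps" and h k
    proof (rule Lim_null[THEN iffD2], rule Lim_null_comparison)
      show "\<forall>\<^sub>F m in sequentially. norm (fps_nth (H m) k - fps_nth h k) \<le> inverse (real (Suc m)) / S ^ k"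
        using H S by (simp add: pos_le_divide_eq)
      show "(\<lambda>m. inverse (real (Suc m)) / S ^ k) \<longlonglongrightarrow> 0"
        using tendsto_divide[OF LIMSEQ_inverse_real_of_nat tendsto_const[of "S ^ k"]] S by simp
    qed
    have nF: "norm (fps_nth (F m) k - fps_nth f k) * S ^ k \<le> inverse (real (Suc m))" for m k
      by (rule near[OF F f dF])
    have nG: "norm (fps_nth (G m) k - fps_nth g k) * S ^ k \<le> inverse (real (Suc m))" for m k
      by (rule near[OF G g dG])
    have le1: "inverse (real (Suc m)) \<le> 1" for m by (simp add: field_simps)
    have Bm: "norm (fps_nth (ene (F m) (G m)) n) * (2 * r) ^ n \<le> B" for m n
      by (rule B[rule_format, OF h0[OF F] h0[OF G] order_trans[OF nF le1] order_trans[OF nG le1]])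
    have B0: "norm (fps_nth (ene f g) n) * (2 * r) ^ n \<le> B" for n
      by (rule B[rule_format, OF h0[OF f] h0[OF g]]) auto
    define h where "h m = ene (F m) (G m) - ene f g" for m
    have h_bound: "norm (fps_nth (h m) n) * (2 * r) ^ n \<le> 2 * B" for m n
    proof -
      have "norm (fps_nth (h m) n) * (2 * r) ^ n \<le>
          (norm (fps_nth (ene (F m) (G m)) n) + norm (fps_nth (ene f g) n)) * (2 * r) ^ n"
        unfolding h_def fps_sub_nth using r by (intro mult_right_mono norm_triangle_ineq4) auto
      thus ?thesis using Bm[of m n] B0[of n] by (simp add: distrib_right)
    qed
    have h_conv: "fps_conv_radius (h m) = \<infinity>" for m
      using fps_conv_radius_diff[of "ene (F m) (G m)" "ene f g"] ene_conv[OF F G] ene_conv[OF f g]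
      by (simp add: h_def)
    \<comment> \<open>\<open>N\<close> is fixed before \<open>m\<close>: the tail is small for all
      \<open>m\<close> at once, and only finitely many coefficients are left to converge.\<close>
    have "(\<lambda>N. 4 * (2 * B) * (2 / 3) ^ N) \<longlonglongrightarrow> 4 * (2 * B) * 0"
      by (intro tendsto_intros LIMSEQ_realpow_zero) auto
    hence "\<forall>\<^sub>F N in sequentially. 4 * (2 * B) * (2 / 3) ^ N < \<epsilon> / 2"
      using \<epsilon> by (intro order_tendstoD(2)) auto
    then obtain N where N: "4 * (2 * B) * (2 / 3) ^ N < \<epsilon> / 2"
      by (auto simp: eventually_sequentially)
    have "(\<lambda>m. \<Sum>n<N. norm (fps_nth (h m) n) * r ^ n) \<longlonglongrightarrow> (\<Sum>n<N. norm (fps_nth (ene f g) n - fps_nth (ene f g) n) * r ^ n)"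
      unfolding h_def fps_sub_nth
      by (intro tendsto_intros tendsto_ene_nth lim nF nG)
    hence "(\<lambda>m. \<Sum>n<N. norm (fps_nth (h m) n) * r ^ n) \<longlonglongrightarrow> 0" by simp
    hence "\<forall>\<^sub>F m in sequentially. (\<Sum>n<N. norm (fps_nth (h m) n) * r ^ n) < \<epsilon> / 2"
      using \<epsilon> by (intro order_tendstoD(2)) auto
    then obtain m where m: "(\<Sum>n<N. norm (fps_nth (h m) n) * r ^ n) < \<epsilon> / 2"
      by (auto simp: eventually_sequentially)
    have "dist (eval_fps (ene (F m) (G m)) (Z m)) (eval_fps (ene f g) (Z m)) = norm (eval_fps (h m) (Z m))"
      unfolding h_def dist_norm
      by (subst eval_fps_diff) (auto simp: ene_conv[OF F G] ene_conv[OF f g])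
    also have "\<dots> \<le> (\<Sum>n<N. norm (fps_nth (h m) n) * r ^ n) + 4 * (2 * B) * (2 / 3) ^ N"
      by (rule norm_eval_fps_le_split[OF h_conv h_bound r(1) r(2)[OF Z]])
    also have "\<dots> < \<epsilon>" using m N by linarith
    finally show False using far[of m] by simp
  qed
  then obtain \<delta> where \<delta>: "\<delta> > 0" "\<forall>f'\<in>entire_lt A \<rho>. \<forall>g'\<in>entire_lt A \<rho>.
      (\<forall>w\<in>cball 0 S. dist (eval_fps f' w) (eval_fps f w) < \<delta>) \<longrightarrow>
      (\<forall>w\<in>cball 0 S. dist (eval_fps g' w) (eval_fps g w) < \<delta>) \<longrightarrow>
      (\<forall>z\<in>K. dist (eval_fps (ene f' g') z) (eval_fps (ene f g) z) < \<epsilon>)"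
    by (elim exE conjE)
  show ?thesis
    by (rule that[OF compact_cball[of 0 S] \<delta>])
qed

text \<open>\<open>V\<close> asks for a margin \<open>e\<close> below \<delta> that is uniform on
  \<open>L\<close>, so its openness is the triangle inequality; pointwise distance below \<delta>
  would call for a maximum over \<open>L\<close>.\<close>

lemma compact_conv_nhd:
  assumes L: "compact L" and \<delta>: "\<delta> > 0" and f: "f \<in> E"
  obtains V where "openin (compact_conv_topology E) V" "f \<in> V" "V \<subseteq> E"
    "\<forall>f'\<in>V. \<forall>w\<in>L. dist (eval_fps f' w) (eval_fps f w) < \<delta>"
proof -
  define V where "V = {f'\<in>E. \<exists>e<\<delta>. \<forall>w\<in>L. dist (eval_fps f' w) (eval_fps f w) \<le> e}"
  show ?thesis
  proof (rule that[of V])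
    show "openin (compact_conv_topology E) V"
      unfolding openin_compact_conv compact_conv_open_def
    proof (intro conjI ballI)
      show "V \<subseteq> E" by (auto simp: V_def)
      fix h assume "h \<in> V"
      then obtain e where e: "e < \<delta>" "\<forall>w\<in>L. dist (eval_fps h w) (eval_fps f w) \<le> e"
        by (auto simp: V_def)
      have "{h'\<in>E. \<forall>w\<in>L. dist (eval_fps h' w) (eval_fps h w) < (\<delta> - e) / 2} \<subseteq> V"
      proof
        fix h' assume h': "h' \<in> {h'\<in>E. \<forall>w\<in>L. dist (eval_fps h' w) (eval_fps h w) < (\<delta> - e) / 2}"
        have "dist (eval_fps h' w) (eval_fps f w) \<le> (\<delta> + e) / 2" if "w \<in> L" for w
        proof -
          have "dist (eval_fps h' w) (eval_fps f w) \<le>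
              dist (eval_fps h' w) (eval_fps h w) + dist (eval_fps h w) (eval_fps f w)"
            by (rule dist_triangle)
          also have "\<dots> \<le> (\<delta> - e) / 2 + e"
            using h' e(2) that by (intro add_mono) auto
          finally show ?thesis by (simp add: field_simps)
        qed
        moreover have "(\<delta> + e) / 2 < \<delta>" using e(1) by simp
        ultimately show "h' \<in> V" using h' unfolding V_def by blast
      qed
      moreover have "(\<delta> - e) / 2 > 0" using e(1) by simp
      ultimately show "\<exists>K \<epsilon>. compact K \<and> \<epsilon> > 0 \<and>
          {g\<in>E. \<forall>z\<in>K. dist (eval_fps g z) (eval_fps h z) < \<epsilon>} \<subseteq> V" using L by blast
    qed
    show "f \<in> V" using f \<delta> by (auto simp: V_def intro!: exI[of _ 0])
    show "V \<subseteq> E" by (auto simp: V_def)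
    show "\<forall>f'\<in>V. \<forall>w\<in>L. dist (eval_fps f' w) (eval_fps f w) < \<delta>"
      by (auto simp: V_def intro: le_less_trans)
  qed
qed

lemma continuous_map_ene:
  assumes A: "ring_closed A" and \<rho>: "\<rho> > 0"
  shows "continuous_map
      (prod_topology (compact_conv_topology (entire_lt A \<rho>)) (compact_conv_topology (entire_lt A \<rho>)))
      (compact_conv_topology (entire_lt A \<rho>)) (\<lambda>(f, g). ene f g)"
  (is "continuous_map (prod_topology ?T ?T) ?T ?ene")
  unfolding continuous_map_def
proof (intro conjI allI impI)
  show "?ene \<in> topspace (prod_topology ?T ?T) \<rightarrow> topspace ?T"
    using entire_lt_ene[OF A \<rho>] by (auto simp: topspace_prod_topology)
  fix U assume U: "openin ?T U"
  show "openin (prod_topology ?T ?T) {p \<in> topspace (prod_topology ?T ?T). ?ene p \<in> U}"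
    unfolding openin_prod_topology_alt
  proof (intro allI impI)
    fix f g assume "(f, g) \<in> {p \<in> topspace (prod_topology ?T ?T). ?ene p \<in> U}"
    hence fg: "f \<in> entire_lt A \<rho>" "g \<in> entire_lt A \<rho>" "ene f g \<in> U"
      by (auto simp: topspace_prod_topology)
    from U fg(3) have "\<exists>K \<epsilon>. compact K \<and> \<epsilon> > 0 \<and>
        {h\<in>entire_lt A \<rho>. \<forall>z\<in>K. dist (eval_fps h z) (eval_fps (ene f g) z) < \<epsilon>} \<subseteq> U"
      by (simp add: openin_compact_conv compact_conv_open_def)
    then obtain K \<epsilon> where K: "compact K" "\<epsilon> > 0"
      "{h\<in>entire_lt A \<rho>. \<forall>z\<in>K. dist (eval_fps h z) (eval_fps (ene f g) z) < \<epsilon>} \<subseteq> U"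
      by (elim exE conjE)
    obtain L \<delta> where L: "compact L" "\<delta> > 0" and close:
      "\<forall>f'\<in>entire_lt A \<rho>. \<forall>g'\<in>entire_lt A \<rho>.
        (\<forall>w\<in>L. dist (eval_fps f' w) (eval_fps f w) < \<delta>) \<longrightarrow>
        (\<forall>w\<in>L. dist (eval_fps g' w) (eval_fps g w) < \<delta>) \<longrightarrow>
        (\<forall>z\<in>K. dist (eval_fps (ene f' g') z) (eval_fps (ene f g) z) < \<epsilon>)"
      by (rule ene_compact_close[OF A \<rho> fg(1,2) K(1,2)]) (rule that)
    obtain V where V: "openin ?T V" "f \<in> V" "V \<subseteq> entire_lt A \<rho>"
      "\<forall>f'\<in>V. \<forall>w\<in>L. dist (eval_fps f' w) (eval_fps f w) < \<delta>"
      by (rule compact_conv_nhd[OF L fg(1)]) (rule that)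
    obtain W where W: "openin ?T W" "g \<in> W" "W \<subseteq> entire_lt A \<rho>"
      "\<forall>g'\<in>W. \<forall>w\<in>L. dist (eval_fps g' w) (eval_fps g w) < \<delta>"
      by (rule compact_conv_nhd[OF L fg(2)]) (rule that)
    have "ene f' g' \<in> U" if "f' \<in> V" "g' \<in> W" for f' g'
    proof -
      have fg': "f' \<in> entire_lt A \<rho>" "g' \<in> entire_lt A \<rho>" using that V(3) W(3) by auto
      have "\<forall>z\<in>K. dist (eval_fps (ene f' g') z) (eval_fps (ene f g) z) < \<epsilon>"
        using close fg' V(4) W(4) that by blast
      thus ?thesis using K(3) entire_lt_ene[OF A \<rho> fg'] by blast
    qed
    hence "V \<times> W \<subseteq> {p \<in> topspace (prod_topology ?T ?T). ?ene p \<in> U}"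
      using V(3) W(3) by (auto simp: topspace_prod_topology)
    thus "\<exists>V W. openin ?T V \<and> openin ?T W \<and> f \<in> V \<and> g \<in> W \<and>
        V \<times> W \<subseteq> {p \<in> topspace (prod_topology ?T ?T). ?ene p \<in> U}"
      using V(1,2) W(1,2) by blast
  qed
qed

text \<open>By \<open>not_subring_entire_lt\<close>, closure under all additive inverses fails;
  being a subring is therefore expressed by \<open>subsemiring\<close> together with closure under
  those additive inverses that are entire.\<close>

theorem theorem9p1:
  fixes A :: "complex set" and \<rho> :: real
  assumes "subring A (ring_of_type_algebra :: complex ring)"
    and "0 < \<rho>"
  shows "(\<forall>f\<in>entire_lt A \<rho>. \<forall>g\<in>entire_lt A \<rho>. ene f g \<in> entire_lt A \<rho>) \<and>
    subsemiring (entire_lt A \<rho>) (ene_ring A) \<and>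
    (\<forall>f\<in>entire_lt A \<rho>. fps_conv_radius (a_inv (ene_ring A) f) = \<infinity> \<longrightarrow>
        a_inv (ene_ring A) f \<in> entire_lt A \<rho>) \<and>
    continuous_map
      (prod_topology (compact_conv_topology (entire_lt A \<rho>)) (compact_conv_topology (entire_lt A \<rho>)))
      (compact_conv_topology (entire_lt A \<rho>))
      (\<lambda>(f, g). ene f g)"
proof -
  have A: "ring_closed A" by (rule ring_closed_of_subring[OF assms(1)])
  show ?thesis
    using entire_lt_ene[OF A assms(2)] subsemiring_entire_lt[OF A assms(2)]
      entire_lt_a_inv[OF A assms(2)] continuous_map_ene[OF A assms(2)] by blast
qed

end
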